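(* Let $n\in\mathbb N$, let $T:\ell_2^n\to\ell_2^n$ be a (bounded) linear operator, and let $0<p<2$. Then $$M_p\left(T(B_2^n),d_2\right)=\mathfrak m_p\,\pi_p(T)^p .$$
   Context: All spaces are real. $\ell_2^n$ is $\mathbb R^n$ with the Euclidean norm $\|\cdot\|_2$, $B_2^n$ is its closed unit ball, $d_2(x,y)=\|x-y\|_2$. For a compact set $K\subset\mathbb R^n$, $\mathfrak M^1(K)$ is the set of finite signed Borel measures $\mu$ on $K$ with $\mu(K)=1$, and $M_p(K,d_2)=\sup\{\int_K\int_K\|x-y\|_2^p\,d\mu(x)d\mu(y):\mu\in\mathfrak M^1(K)\}$. Also $\mathfrak m_p:=M_p([-1,1],d_2)=\sup\{\int_{-1}^1\int_{-1}^1|u-v|^p\,d\mu(u)d\mu(v):\mu\in\mathfrak M^1([-1,1])\}$. For $0<p<\infty$ and a linear operator $T:E\to F$ between finite-dimensional normed spaces, the absolutely $p$-summing norm $\pi_p(T)$ (a quasi-norm if $p<1$) is the least $C\ge 0$ such that for all finite families $x_1,\dots,x_m\in E$, $\left(\sum_i\|Tx_i\|_F^p\right)^{1/p}\le C\sup_{x'\in B_{E'}}\left(\sum_i|x'(x_i)|^p\right)^{1/p}$, where $B_{E'}$ is the closed unit ball of the dual of $E$. *)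

theory Defs
  imports "HOL-Analysis.Analysis"
begin

text \<open>
  Finite signed measures are real-valued countably additive set functions on the sigma-algebra
  \<open>sets M\<close>. Only the measurable space underlying \<open>M\<close> matters; values of \<open>\<mu>\<close> off \<open>sets M\<close> are never used.
\<close>

definition signed_measure :: "'a measure \<Rightarrow> ('a set \<Rightarrow> real) \<Rightarrow> bool" where
  "signed_measure M \<mu> \<longleftrightarrow>
     \<mu> {} = 0 \<and>
     (\<forall>A :: nat \<Rightarrow> 'a set. range A \<subseteq> sets M \<longrightarrow> disjoint_family A \<longrightarrow>
        (\<lambda>i. \<mu> (A i)) sums \<mu> (\<Union>i. A i))"

text \<open>
  The positive part of the Jordan decomposition. Since \<open>B = {}\<close> is allowed, the supremum is
  unaffected by \<open>ennreal\<close> truncating negative values. For a signed measure the set function below is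
  countably additive and finite, so it is the \<open>emeasure\<close> of the resulting measure.
\<close>

definition pos_variation :: "'a measure \<Rightarrow> ('a set \<Rightarrow> real) \<Rightarrow> 'a measure" where
  "pos_variation M \<mu> =
     measure_of (space M) (sets M) (\<lambda>A. SUP B\<in>{B \<in> sets M. B \<subseteq> A}. ennreal (\<mu> B))"

definition neg_variation :: "'a measure \<Rightarrow> ('a set \<Rightarrow> real) \<Rightarrow> 'a measure" where
  "neg_variation M \<mu> = pos_variation M (\<lambda>A. - \<mu> A)"

definition signed_integral :: "'a measure \<Rightarrow> ('a set \<Rightarrow> real) \<Rightarrow> ('a \<Rightarrow> real) \<Rightarrow> real" where
  "signed_integral M \<mu> f =
     (\<integral>x. f x \<partial>pos_variation M \<mu>) - (\<integral>x. f x \<partial>neg_variation M \<mu>)"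

definition signed_borel_mass_one :: "'a::metric_space set \<Rightarrow> ('a set \<Rightarrow> real) set" where
  "signed_borel_mass_one K = {\<mu>. signed_measure (restrict_space borel K) \<mu> \<and> \<mu> K = 1}"

definition energy :: "real \<Rightarrow> 'a::metric_space set \<Rightarrow> ('a set \<Rightarrow> real) \<Rightarrow> real" where
  "energy p K \<mu> =
     signed_integral (restrict_space borel K) \<mu>
       (\<lambda>y. signed_integral (restrict_space borel K) \<mu> (\<lambda>x. dist x y powr p))"

text \<open>The supremum is taken in the extended reals, so that it is meaningful without a
  boundedness proof.\<close>

definition max_energy :: "real \<Rightarrow> 'a::metric_space set \<Rightarrow> ereal" where
  "max_energy p K = (SUP \<mu>\<in>signed_borel_mass_one K. ereal (energy p K \<mu>))"

text \<open>
  The set of admissible constants is closed, so \<open>Inf\<close> is its least element whenever it is nonempty,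
  as is the case for every linear operator between finite-dimensional spaces. The inner supremum is
  over a nonempty family bounded by the value with \<open>norm (x i)\<close> in place of the functional.
\<close>

definition summing_const ::
    "real \<Rightarrow> ('a::real_normed_vector \<Rightarrow> 'b::real_normed_vector) \<Rightarrow> real \<Rightarrow> bool" where
  "summing_const p T C \<longleftrightarrow>
     0 \<le> C \<and>
     (\<forall>(m::nat) (x :: nat \<Rightarrow> 'a).
        (\<Sum>i<m. norm (T (x i)) powr p) powr (1 / p)
        \<le> C * (SUP \<phi>\<in>{\<phi> :: 'a \<Rightarrow>\<^sub>L real. norm \<phi> \<le> 1}.
                 (\<Sum>i<m. \<bar>blinfun_apply \<phi> (x i)\<bar> powr p) powr (1 / p)))"

definition summing_norm ::
    "real \<Rightarrow> ('a::real_normed_vector \<Rightarrow> 'b::real_normed_vector) \<Rightarrow> real" where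
  "summing_norm p T = Inf {C. summing_const p T C}"

end

(* Let \<beta> be Lebesgue measure on the unit ball and \<kappa> the integral of |x . e|^p against \<beta> for a unit
   vector e. By rotation invariance, \<kappa> |x|^p is the average of |x . u|^p over u. Hence \<kappa> times an energy
   on T(B) is an average of energies of one-dimensional projections, which live on segments of
   half-length |T* u|; this gives the inequality \<le> with the constant (1/\<kappa>) times the integral of |T* u|^p.
   The same averaging, together with a discretisation of \<beta>, identifies this constant with the p-th power
   of the summing norm.

   For the inequality \<ge>, take a finitely supported signed measure on [-1,1]. Symmetrising it does not
   decrease its energy, because |s + t|^p - |s - t|^p is a positive definite kernel for p < 2. Even measures
   are approximated by densities of the form (1 - t^2) (1 - t^2)^((n-1)/2) q(1 - t^2) with q a polynomial,
   and these are marginals of polynomial radial densities on the ball. Pushing such a radial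
   density forward by T multiplies its marginal energy by the constant above. *)

theory Submission
  imports Defs "HOL-Computational_Algebra.Polynomial"
begin

section \<open>Jordan decomposition and maximal energies\<close>

text \<open>After averaging over directions \<open>u\<close>, the energy of a pushforward under
  \<open>T\<close> only sees projections onto \<open>adjoint T u\<close>. If the measure on the ball
  is rotation invariant, all these projections have the same law up to the scale
  \<open>norm (adjoint T u)\<close>, so the direction splits off as one factor. The price is that
  such marginals are even and, in higher dimension, smoothed: the slice at height t has volume
  proportional to (1 - t^2)^((n-1)/2), so point masses on the interval can in general only be
  approximated. Powers of 1 - |x|^2 are chosen because their marginals are again constants times
  powers of 1 - t^2. Lifting a polynomial density from the line to the ball is then a rescaling of
  coefficients, and no integral equation has to be inverted. Powers of 1 - (t^2 - s^2)^2 supply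
  polynomials in 1 - t^2 that concentrate at s and -s. Energies are compared in the extended reals,
  so a possibly infinite supremum and the factor 0 coming from T = 0 are treated separately.\<close>

lemma signed_measure_empty: "signed_measure M \<mu> \<Longrightarrow> \<mu> {} = 0"
  by (simp add: signed_measure_def)

lemma signed_measure_Un:
  assumes "signed_measure M \<mu>" "A \<in> sets M" "B \<in> sets M" "A \<inter> B = {}"
  shows "\<mu> (A \<union> B) = \<mu> A + \<mu> B"
proof -
  have "range (binaryset A B) \<subseteq> sets M"
    using assms by (auto simp: range_binaryset_eq)
  moreover have "disjoint_family (binaryset A B)"
    using assms by (auto simp: disjoint_family_on_def binaryset_def)
  ultimately have "(\<lambda>i. \<mu> (binaryset A B i)) sums \<mu> (\<Union>i. binaryset A B i)"
    using assms(1) unfolding signed_measure_def by blast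
  moreover have "(\<lambda>i. \<mu> (binaryset A B i)) sums (\<mu> A + \<mu> B)"
    by (rule binaryset_sums) (use signed_measure_empty[OF assms(1)] in simp)
  ultimately show ?thesis
    by (metis UN_binaryset_eq sums_unique2)
qed

lemma signed_measure_Diff:
  assumes "signed_measure M \<mu>" "A \<in> sets M" "B \<in> sets M" "B \<subseteq> A"
  shows "\<mu> (A - B) = \<mu> A - \<mu> B"
proof -
  have "\<mu> (B \<union> (A - B)) = \<mu> B + \<mu> (A - B)"
    using assms by (intro signed_measure_Un) auto
  moreover have "B \<union> (A - B) = A"
    using assms by auto
  ultimately show ?thesis by simp
qed

lemma signed_measure_uminus:
  "signed_measure M \<mu> \<Longrightarrow> signed_measure M (\<lambda>A. - \<mu> A)"
  unfolding signed_measure_def by (auto intro: sums_minus)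

text \<open>Negative values are truncated to 0 by \<open>ennreal\<close>, so addition is only
  subadditive; this is the direction that survives for arbitrary signs.\<close>

lemma ennreal_add_le: "ennreal (a + b) \<le> ennreal a + ennreal b"
  by (cases "0 \<le> a"; cases "0 \<le> b")
    (auto simp flip: ennreal_plus simp: ennreal_neg intro!: ennreal_leI)

lemma ennreal_sum_le: "ennreal (\<Sum>i\<in>I. f i) \<le> (\<Sum>i\<in>I. ennreal (f i))"
proof (induction I rule: infinite_finite_induct)
  case (insert x F)
  then show ?case
    by (simp add: order_trans[OF ennreal_add_le] add_left_mono)
qed auto

lemma ennreal_sums_le:
  assumes "f sums x"
  shows "ennreal x \<le> (\<Sum>i. ennreal (f i))"
proof (rule LIMSEQ_le_const2)
  show "(\<lambda>n. ennreal (\<Sum>i<n. f i)) \<longlonglongrightarrow> ennreal x"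
    using assms unfolding sums_def by (intro tendsto_ennrealI)
  show "\<exists>N. \<forall>n\<ge>N. ennreal (\<Sum>i<n. f i) \<le> (\<Sum>i. ennreal (f i))"
    by (intro exI allI impI order_trans[OF ennreal_sum_le] sum_le_suminf) auto
qed

text \<open>The set function inside \<open>pos_variation\<close>, kept apart because
  \<open>measure_of\<close> has it as its \<open>emeasure\<close> only once positivity and countable
  additivity are proved.\<close>

definition pos_part_fun :: "'a measure \<Rightarrow> ('a set \<Rightarrow> real) \<Rightarrow> 'a set \<Rightarrow> ennreal" where
  "pos_part_fun M \<mu> A = (SUP B\<in>{B \<in> sets M. B \<subseteq> A}. ennreal (\<mu> B))"

lemma pos_part_fun_upper: "B \<in> sets M \<Longrightarrow> B \<subseteq> A \<Longrightarrow> ennreal (\<mu> B) \<le> pos_part_fun M \<mu> A"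
  unfolding pos_part_fun_def by (rule SUP_upper) auto

lemma pos_part_fun_mono: "A \<subseteq> B \<Longrightarrow> pos_part_fun M \<mu> A \<le> pos_part_fun M \<mu> B"
  unfolding pos_part_fun_def by (rule SUP_subset_mono) auto

lemma pos_part_fun_empty: "signed_measure M \<mu> \<Longrightarrow> pos_part_fun M \<mu> {} = 0"
  unfolding pos_part_fun_def by (auto simp: signed_measure_empty SUP_eq_const cong: conj_cong)

lemma pos_part_fun_superadditive:
  assumes sm: "signed_measure M \<mu>" and AB: "A \<inter> B = {}"
  shows "pos_part_fun M \<mu> A + pos_part_fun M \<mu> B \<le> pos_part_fun M \<mu> (A \<union> B)"
proof -
  have key: "ennreal (\<mu> C) + ennreal (\<mu> D) \<le> pos_part_fun M \<mu> (A \<union> B)"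
    if C: "C \<in> sets M" "C \<subseteq> A" and D: "D \<in> sets M" "D \<subseteq> B" for C D
  proof -
    \<comment> \<open>A test set of negative value is traded for the empty set: both have the same
      truncated value, and on the new sets \<open>ennreal\<close> is exactly additive.\<close>
    define C' where "C' = (if \<mu> C < 0 then {} else C)"
    define D' where "D' = (if \<mu> D < 0 then {} else D)"
    have C': "C' \<in> sets M" "C' \<subseteq> A" "0 \<le> \<mu> C'" "ennreal (\<mu> C) = ennreal (\<mu> C')"
      using C by (auto simp: C'_def signed_measure_empty[OF sm] ennreal_neg)
    have D': "D' \<in> sets M" "D' \<subseteq> B" "0 \<le> \<mu> D'" "ennreal (\<mu> D) = ennreal (\<mu> D')"
      using D by (auto simp: D'_def signed_measure_empty[OF sm] ennreal_neg)
    have "ennreal (\<mu> C) + ennreal (\<mu> D) = ennreal (\<mu> (C' \<union> D'))"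
      using C' D' AB by (subst signed_measure_Un[OF sm]) auto
    also have "\<dots> \<le> pos_part_fun M \<mu> (A \<union> B)"
      using C' D' by (intro pos_part_fun_upper) auto
    finally show ?thesis .
  qed
  have ne: "{C \<in> sets M. C \<subseteq> X} \<noteq> {}" for X by auto
  have "pos_part_fun M \<mu> A + pos_part_fun M \<mu> B
      = (SUP C\<in>{C \<in> sets M. C \<subseteq> A}. SUP D\<in>{D \<in> sets M. D \<subseteq> B}. ennreal (\<mu> C) + ennreal (\<mu> D))"
    unfolding pos_part_fun_def
    by (subst ennreal_SUP_add_left[OF ne, symmetric]) (simp only: ennreal_SUP_add_right[OF ne])
  also have "\<dots> \<le> pos_part_fun M \<mu> (A \<union> B)"
    by (intro SUP_least key) auto
  finally show ?thesis .
qed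

text \<open>Superadditivity gives one inequality through finite unions. For the other, a test set
  \<open>B\<close> is cut along the sets \<open>A i\<close> and the signed measure is summed over
  the pieces.\<close>

lemma pos_part_fun_countably_additive:
  assumes sm: "signed_measure M \<mu>"
  shows "countably_additive (sets M) (pos_part_fun M \<mu>)"
  unfolding countably_additive_def
proof (intro allI impI antisym)
  fix A :: "nat \<Rightarrow> 'a set"
  assume A: "range A \<subseteq> sets M" "disjoint_family A" "(\<Union>i. A i) \<in> sets M"
  have "(\<Sum>i<n. pos_part_fun M \<mu> (A i)) \<le> pos_part_fun M \<mu> (\<Union>i<n. A i)" for n
  proof (induction n)
    case (Suc n)
    have "A n \<inter> (\<Union>i<n. A i) = {}"
      using A(2) unfolding disjoint_family_on_def by (metis (no_types, lifting) UNIV_I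
          disjoint_iff UN_iff lessThan_iff less_irrefl)
    have "(\<Sum>i<Suc n. pos_part_fun M \<mu> (A i))
        \<le> pos_part_fun M \<mu> (A n) + pos_part_fun M \<mu> (\<Union>i<n. A i)"
      using Suc by (simp add: add.commute add_left_mono)
    also have "\<dots> \<le> pos_part_fun M \<mu> (A n \<union> (\<Union>i<n. A i))"
      by (rule pos_part_fun_superadditive[OF sm]) fact
    also have "A n \<union> (\<Union>i<n. A i) = (\<Union>i<Suc n. A i)"
      by (auto simp: lessThan_Suc)
    finally show ?case .
  qed (simp add: pos_part_fun_empty[OF sm])
  also have "pos_part_fun M \<mu> (\<Union>i<n. A i) \<le> pos_part_fun M \<mu> (\<Union>i. A i)" for n
    by (rule pos_part_fun_mono) auto
  finally show "(\<Sum>i. pos_part_fun M \<mu> (A i)) \<le> pos_part_fun M \<mu> (\<Union>i. A i)"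
    by (auto simp: suminf_eq_SUP intro: SUP_least)
  show "pos_part_fun M \<mu> (\<Union>i. A i) \<le> (\<Sum>i. pos_part_fun M \<mu> (A i))"
    unfolding pos_part_fun_def[of M \<mu> "\<Union>i. A i"]
  proof (rule SUP_least, clarsimp)
    fix B assume B: "B \<in> sets M" "B \<subseteq> (\<Union>i. A i)"
    have "(\<lambda>i. \<mu> (B \<inter> A i)) sums \<mu> (\<Union>i. B \<inter> A i)"
    proof -
      have "range (\<lambda>i. B \<inter> A i) \<subseteq> sets M" "disjoint_family (\<lambda>i. B \<inter> A i)"
        using A B by (auto simp: disjoint_family_on_def)
      with sm show ?thesis unfolding signed_measure_def by blast
    qed
    moreover have "(\<Union>i. B \<inter> A i) = B" using B by auto
    ultimately have "ennreal (\<mu> B) \<le> (\<Sum>i. ennreal (\<mu> (B \<inter> A i)))"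
      using ennreal_sums_le by simp
    also have "\<dots> \<le> (\<Sum>i. pos_part_fun M \<mu> (A i))"
      using A B by (intro suminf_le pos_part_fun_upper) auto
    finally show "ennreal (\<mu> B) \<le> (\<Sum>i. pos_part_fun M \<mu> (A i))" .
  qed
qed

lemma pos_part_fun_additive:
  assumes sm: "signed_measure M \<mu>" and "A \<in> sets M" "B \<in> sets M" "A \<inter> B = {}"
  shows "pos_part_fun M \<mu> (A \<union> B) = pos_part_fun M \<mu> A + pos_part_fun M \<mu> B"
  using sets.countably_additive_additive[OF _ pos_part_fun_countably_additive[OF sm]] assms
  by (auto simp: positive_def pos_part_fun_empty additive_def)

text \<open>An infinite positive part can be pushed into a smaller set while a piece of signed mass
  at least 1 in absolute value is split off. Repeating this yields disjoint pieces whose masses do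
  not tend to 0, against countable additivity.\<close>

lemma pos_part_fun_finite:
  assumes sm: "signed_measure M \<mu>"
  shows "pos_part_fun M \<mu> (space M) < \<infinity>"
proof (rule ccontr)
  assume "\<not> ?thesis"
  hence inf: "pos_part_fun M \<mu> (space M) = \<infinity>" by (simp add: not_less top.extremum_unique)
  let ?I = "\<lambda>E. E \<in> sets M \<and> pos_part_fun M \<mu> E = \<infinity>"
  have step: "\<exists>F. ?I F \<and> F \<subseteq> E \<and> 1 \<le> \<bar>\<mu> (E - F)\<bar>" if E: "?I E" for E
  proof -
    \<comment> \<open>The margin makes both parts of \<open>E\<close> large: \<open>\<mu> B\<close>
      exceeds 1 and \<open>\<mu> (E - B)\<close>, which is \<open>\<mu> E - \<mu> B\<close>, lies
      below -1. Whichever part keeps the infinite value, the other one can be split off.\<close>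
    have "ennreal (1 + \<bar>\<mu> E\<bar>) < pos_part_fun M \<mu> E"
      using E by simp
    then obtain B where B: "B \<in> sets M" "B \<subseteq> E" "ennreal (1 + \<bar>\<mu> E\<bar>) < ennreal (\<mu> B)"
      unfolding pos_part_fun_def less_SUP_iff by blast
    hence muB: "1 + \<bar>\<mu> E\<bar> < \<mu> B"
      by (subst (asm) ennreal_less_iff) auto
    have "pos_part_fun M \<mu> (B \<union> (E - B)) = pos_part_fun M \<mu> B + pos_part_fun M \<mu> (E - B)"
      using B E by (intro pos_part_fun_additive[OF sm]) auto
    moreover have "B \<union> (E - B) = E" using B by auto
    ultimately consider "pos_part_fun M \<mu> B = \<infinity>" | "pos_part_fun M \<mu> (E - B) = \<infinity>"
      using E by (metis ennreal_add_eq_top infinity_ennreal_def)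
    then show ?thesis
    proof cases
      case 1
      show ?thesis
        using 1 B E muB signed_measure_Diff[OF sm, of E B] by (intro exI[of _ B]) auto
    next
      case 2
      have "E - (E - B) = B" using B by auto
      then show ?thesis
        using 2 B E muB by (intro exI[of _ "E - B"]) auto
    qed
  qed
  have "\<exists>E. \<forall>n::nat. ?I (E n) \<and> (E (Suc n) \<subseteq> E n \<and> 1 \<le> \<bar>\<mu> (E n - E (Suc n))\<bar>)"
    by (rule dependent_nat_choice) (use inf step in blast)+
  then obtain E where E: "\<And>n::nat. ?I (E n)" "\<And>n. E (Suc n) \<subseteq> E n"
    "\<And>n. 1 \<le> \<bar>\<mu> (E n - E (Suc n))\<bar>" by auto
  have dec: "E n \<subseteq> E m" if "m \<le> n" for m n
    using lift_Suc_antimono_le[of E, OF E(2) that] .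
  have disj: "disjoint_family (\<lambda>n. E n - E (Suc n))"
    unfolding disjoint_family_on_def
  proof (intro ballI impI)
    fix m n :: nat assume "m \<noteq> n"
    then consider "Suc m \<le> n" | "Suc n \<le> m" by linarith
    then show "(E m - E (Suc m)) \<inter> (E n - E (Suc n)) = {}"
      by cases (use dec in blast)+
  qed
  have "range (\<lambda>n. E n - E (Suc n)) \<subseteq> sets M"
    using E(1) by auto
  with disj sm have "(\<lambda>n. \<mu> (E n - E (Suc n))) sums \<mu> (\<Union>n. E n - E (Suc n))"
    unfolding signed_measure_def by blast
  hence "(\<lambda>n. \<mu> (E n - E (Suc n))) \<longlonglongrightarrow> 0"
    by (intro summable_LIMSEQ_zero) (auto simp: summable_def)
  from LIMSEQ_D[OF this, of 1] obtain n where "\<bar>\<mu> (E n - E (Suc n))\<bar> < 1"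
    by auto
  with E(3)[of n] show False by simp
qed

lemma space_pos_variation [simp]: "space (pos_variation M \<mu>) = space M"
  by (simp add: pos_variation_def)

lemma sets_pos_variation [simp, measurable_cong]: "sets (pos_variation M \<mu>) = sets M"
  by (simp add: pos_variation_def)

lemma sets_neg_variation [simp, measurable_cong]: "sets (neg_variation M \<mu>) = sets M"
  by (simp add: neg_variation_def)

lemma emeasure_pos_variation:
  assumes "signed_measure M \<mu>" "A \<in> sets M"
  shows "emeasure (pos_variation M \<mu>) A = pos_part_fun M \<mu> A"
  by (rule emeasure_measure_of[OF pos_variation_def[folded pos_part_fun_def]])
    (use assms in \<open>simp_all add: positive_def pos_part_fun_empty sets.space_closed
      pos_part_fun_countably_additive\<close>)

lemma finite_measure_pos_variation:
  assumes "signed_measure M \<mu>"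
  shows "finite_measure (pos_variation M \<mu>)"
  by (rule finite_measureI)
    (use pos_part_fun_finite[OF assms] in \<open>simp add: emeasure_pos_variation[OF assms] less_top\<close>)

lemma finite_measure_neg_variation:
  "signed_measure M \<mu> \<Longrightarrow> finite_measure (neg_variation M \<mu>)"
  unfolding neg_variation_def
  by (intro finite_measure_pos_variation signed_measure_uminus)

text \<open>For \<open>B\<close> inside \<open>A\<close>, the value
  \<open>\<mu> B = \<mu> A - \<mu> (A - B)\<close> is at most \<open>\<mu> A\<close> plus the
  negative variation of \<open>A\<close>. The supremum over \<open>B\<close> gives one inequality,
  the same argument for the negated measure the other; no Hahn set enters.\<close>

lemma Jordan_decomposition:
  assumes sm: "signed_measure M \<mu>" and A: "A \<in> sets M"
  shows "\<mu> A = measure (pos_variation M \<mu>) A - measure (neg_variation M \<mu>) A"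
proof -
  note sm' = signed_measure_uminus[OF sm]
  have le: "measure (pos_variation M \<nu>) A \<le> \<nu> A + measure (pos_variation M (\<lambda>A. - \<nu> A)) A"
    if smn: "signed_measure M \<nu>" for \<nu>
  proof -
    let ?P = "pos_variation M \<nu>" and ?N = "pos_variation M (\<lambda>A. - \<nu> A)"
    interpret P: finite_measure ?P by (rule finite_measure_pos_variation[OF smn])
    interpret N: finite_measure ?N
      by (rule finite_measure_pos_variation[OF signed_measure_uminus[OF smn]])
    have ub: "\<nu> B \<le> \<nu> A + measure ?N A" if B: "B \<in> sets M" "B \<subseteq> A" for B
    proof -
      have "ennreal (- \<nu> (A - B)) \<le> emeasure ?N A"
        using A B by (simp add: emeasure_pos_variation[OF signed_measure_uminus[OF smn]] pos_part_fun_upper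
            pos_part_fun_upper[where \<mu> = "\<lambda>A. - \<nu> A"])
      hence "- \<nu> (A - B) \<le> measure ?N A"
        by (simp add: N.emeasure_eq_measure)
      thus ?thesis
        using signed_measure_Diff[OF smn A B] by simp
    qed
    have nn: "0 \<le> \<nu> A + measure ?N A"
      using ub[of "{}"] signed_measure_empty[OF smn] by simp
    have "emeasure ?P A \<le> ennreal (\<nu> A + measure ?N A)"
      unfolding emeasure_pos_variation[OF smn A] pos_part_fun_def
      by (rule SUP_least) (auto intro!: ennreal_leI ub)
    thus ?thesis
      using nn by (simp add: P.emeasure_eq_measure)
  qed
  from le[OF sm] le[OF sm'] show ?thesis
    by (simp add: neg_variation_def)
qed

text \<open>The relation P - N = P' - N' is stated with sums, since subtraction in
  \<open>ennreal\<close> truncates. In this form it passes through the induction over measurable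
  functions.\<close>

lemma nn_integral_eq_of_emeasure_add_eq:
  assumes sets: "sets P = sets M" "sets N = sets M" "sets P' = sets M" "sets N' = sets M"
    and eq: "\<And>A. A \<in> sets M \<Longrightarrow> emeasure P A + emeasure N' A = emeasure P' A + emeasure N A"
    and f: "f \<in> borel_measurable M"
  shows "(\<integral>\<^sup>+x. f x \<partial>P) + (\<integral>\<^sup>+x. f x \<partial>N') = (\<integral>\<^sup>+x. f x \<partial>P') + (\<integral>\<^sup>+x. f x \<partial>N)"
  using f
proof (induction f rule: borel_measurable_induct)
  case (cong f g)
  have "space P = space M" "space N = space M" "space P' = space M" "space N' = space M"
    using sets by (auto dest: sets_eq_imp_space_eq)
  moreover have "(\<integral>\<^sup>+x. f x \<partial>Q) = (\<integral>\<^sup>+x. g x \<partial>Q)" if "space Q = space M" for Q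
    using cong that by (intro nn_integral_cong) simp
  ultimately show ?case
    using cong by metis
next
  case (set A)
  with eq sets show ?case by simp
next
  case (mult u c)
  have [measurable]: "u \<in> borel_measurable Q" if "sets Q = sets M" for Q
    using mult(2) that by (simp cong: measurable_cong_sets)
  show ?case
    using mult sets by (simp add: nn_integral_cmult flip: distrib_left)
next
  case (add u v)
  have m: "u \<in> borel_measurable Q" "v \<in> borel_measurable Q" if "sets Q = sets M" for Q
    using add that by (simp_all cong: measurable_cong_sets)
  have "(\<integral>\<^sup>+x. v x + u x \<partial>Q) = (\<integral>\<^sup>+x. v x \<partial>Q) + (\<integral>\<^sup>+x. u x \<partial>Q)" if "sets Q = sets M" for Q
    using m[OF that] by (rule nn_integral_add[rotated])
  then show ?case
    using add sets by (simp add: algebra_simps)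
next
  case (seq U)
  have m: "U i \<in> borel_measurable Q" if "sets Q = sets M" for Q i
    using seq that by (simp cong: measurable_cong_sets)
  have S: "(\<integral>\<^sup>+x. (SUP xa\<in>range U. xa x) \<partial>Q) = (SUP i. \<integral>\<^sup>+x. U i x \<partial>Q)" if "sets Q = sets M" for Q
    using nn_integral_monotone_convergence_SUP[OF seq(3) m[OF that]] by (simp add: image_image)
  have inc: "incseq (\<lambda>i. \<integral>\<^sup>+x. U i x \<partial>Q)" for Q
    using seq(3) by (auto simp: incseq_def le_fun_def intro!: nn_integral_mono)
  show ?case
    using seq sets by (simp add: S inc flip: ennreal_SUP_add)
qed

text \<open>All representations of a signed measure as a difference of finite measures integrate
  bounded functions alike. Thus \<open>signed_integral\<close> can be computed from a convenient
  pair in place of the Jordan parts.\<close>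

lemma integral_diff_eq_of_measure_diff_eq:
  fixes f :: "'a \<Rightarrow> real"
  assumes sets: "sets P = sets M" "sets N = sets M" "sets P' = sets M" "sets N' = sets M"
    and fin: "finite_measure P" "finite_measure N" "finite_measure P'" "finite_measure N'"
    and eq: "\<And>A. A \<in> sets M \<Longrightarrow> measure P A - measure N A = measure P' A - measure N' A"
    and f: "f \<in> borel_measurable M" and B: "\<And>x. x \<in> space M \<Longrightarrow> \<bar>f x\<bar> \<le> B"
  shows "(\<integral>x. f x \<partial>P) - (\<integral>x. f x \<partial>N) = (\<integral>x. f x \<partial>P') - (\<integral>x. f x \<partial>N')"
proof -
  \<comment> \<open>Adding the bound \<open>B\<close> makes the integrand nonnegative, so that
    \<open>nn_integral_eq_of_emeasure_add_eq\<close> applies; the extra terms are multiples of total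
    masses and cancel at the end.\<close>
  define G where "G Q = (\<integral>\<^sup>+x. ennreal (f x + B) \<partial>Q)" for Q
  have main: "\<exists>r. 0 \<le> r \<and> G Q = ennreal r \<and> r = (\<integral>x. f x \<partial>Q) + B * measure Q (space M)"
    if Q: "sets Q = sets M" "finite_measure Q" for Q
  proof -
    interpret finite_measure Q by fact
    have sp: "space Q = space M" using Q(1) by (rule sets_eq_imp_space_eq)
    have [measurable]: "f \<in> borel_measurable Q" using f Q by (simp cong: measurable_cong_sets)
    have int: "integrable Q f"
      by (rule integrable_const_bound[where B = B]) (auto intro!: AE_I2 B simp: sp)
    have nn: "0 \<le> f x + B" if "x \<in> space Q" for x
    proof -
      have "\<bar>f x\<bar> \<le> B" using that by (intro B) (simp add: sp)
      thus ?thesis by linarith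
    qed
    have "G Q = ennreal (\<integral>x. f x + B \<partial>Q)"
      unfolding G_def
      by (rule nn_integral_eq_integral) (simp_all add: int nn)
    moreover have pos: "0 \<le> (\<integral>x. f x + B \<partial>Q)"
      by (rule integral_nonneg_AE) (simp add: nn)
    moreover have "(\<integral>x. f x + B \<partial>Q) = (\<integral>x. f x \<partial>Q) + B * measure Q (space M)"
      unfolding sp[symmetric] by (subst Bochner_Integration.integral_add) (use int in simp_all)
    ultimately show ?thesis by (intro exI[of _ "\<integral>x. f x + B \<partial>Q"] conjI)
  qed
  have G: "G P + G N' = G P' + G N"
    unfolding G_def
  proof (rule nn_integral_eq_of_emeasure_add_eq[OF sets])
    fix A assume "A \<in> sets M"
    from eq[OF this] have "measure P A + measure N' A = measure P' A + measure N A"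
      by simp
    thus "emeasure P A + emeasure N' A = emeasure P' A + emeasure N A"
      unfolding finite_measure.emeasure_eq_measure[OF fin(1)] finite_measure.emeasure_eq_measure[OF fin(2)]
        finite_measure.emeasure_eq_measure[OF fin(3)] finite_measure.emeasure_eq_measure[OF fin(4)]
      by (simp only: ennreal_plus[symmetric] measure_nonneg)
  next
    show "(\<lambda>x. ennreal (f x + B)) \<in> borel_measurable M"
      using f by measurable
  qed
  obtain a where a: "0 \<le> a" "G P = ennreal a" "a = (\<integral>x. f x \<partial>P) + B * measure P (space M)"
    using main[OF sets(1) fin(1)] by blast
  obtain b where b: "0 \<le> b" "G N = ennreal b" "b = (\<integral>x. f x \<partial>N) + B * measure N (space M)"
    using main[OF sets(2) fin(2)] by blast
  obtain c where c: "0 \<le> c" "G P' = ennreal c" "c = (\<integral>x. f x \<partial>P') + B * measure P' (space M)"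
    using main[OF sets(3) fin(3)] by blast
  obtain d where d: "0 \<le> d" "G N' = ennreal d" "d = (\<integral>x. f x \<partial>N') + B * measure N' (space M)"
    using main[OF sets(4) fin(4)] by blast
  have "ennreal (a + d) = ennreal (c + b)"
    using G unfolding a(2) b(2) c(2) d(2) ennreal_plus[OF a(1) d(1)] ennreal_plus[OF c(1) b(1)] .
  hence "a + d = c + b"
    using a(1) b(1) c(1) d(1) by (subst (asm) ennreal_inj) auto
  moreover have "B * (measure P (space M) - measure N (space M)) = B * (measure P' (space M) - measure N' (space M))"
    by (simp only: eq[OF sets.top])
  ultimately show ?thesis
    unfolding a(3) b(3) c(3) d(3) right_diff_distrib by linarith
qed

lemma signed_measure_diff_measure:
  assumes "finite_measure P" "finite_measure N" "sets M \<subseteq> sets P" "sets M \<subseteq> sets N"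
  shows "signed_measure M (\<lambda>A. measure P A - measure N A)"
  unfolding signed_measure_def
proof (intro conjI allI impI)
  fix A :: "nat \<Rightarrow> 'a set" assume A: "range A \<subseteq> sets M" "disjoint_family A"
  interpret P: finite_measure P by fact
  interpret N: finite_measure N by fact
  show "(\<lambda>i. measure P (A i) - measure N (A i)) sums (measure P (\<Union>i. A i) - measure N (\<Union>i. A i))"
    by (intro sums_diff P.finite_measure_UNION N.finite_measure_UNION) (use A assms in auto)
qed simp

section \<open>Lower bounds for the maximal energy from densities and finite sums\<close>

lemma dist_powr_le_diameter:
  assumes "compact K" "x \<in> K" "y \<in> K" "0 \<le> p"
  shows "dist x y powr p \<le> diameter K powr p"
  using assms by (intro powr_mono2) (auto simp: diameter_bounded_bound compact_imp_bounded)

text \<open>With \<open>M\<close> a counting measure this covers finitely supported signed measures.\<close>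

lemma energy_density_le_max_energy:
  fixes T :: "'b \<Rightarrow> 'a::euclidean_space" and h :: "'b \<Rightarrow> real"
  assumes M: "finite_measure M" and T[measurable]: "T \<in> M \<rightarrow>\<^sub>M borel"
    and K: "compact K" "K \<noteq> {}" and TK: "AE x in M. T x \<in> K"
    and h: "integrable M h" and mass: "(\<integral>x. h x \<partial>M) = 1" and p: "0 < p"
  shows "ereal (\<integral>y. h y * (\<integral>x. h x * dist (T x) (T y) powr p \<partial>M) \<partial>M) \<le> max_energy p K"
proof -
  interpret M: finite_measure M by fact
  have hm[measurable]: "h \<in> borel_measurable M" using h by auto
  \<comment> \<open>\<open>P\<close> and \<open>N\<close> push forward the positive and the negative
    part of \<open>h\<close>. Since \<open>T\<close> may identify points, they can overlap and then
    are not the Jordan parts of their difference; \<open>integral_diff_eq_of_measure_diff_eq\<close>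
    bridges this gap.\<close>
  define P where "P = distr (density M (\<lambda>x. ennreal (max 0 (h x)))) borel T"
  define N where "N = distr (density M (\<lambda>x. ennreal (max 0 (- h x)))) borel T"
  have setsPN [measurable_cong, simp]: "sets P = sets borel" "sets N = sets borel"
    "space P = UNIV" "space N = UNIV"
    by (simp_all add: P_def N_def)
  have hint: "integrable M (\<lambda>x. max 0 (h x))" "integrable M (\<lambda>x. max 0 (- h x))"
    using h by auto
  have finP: "finite_measure P" and finN: "finite_measure N"
  proof -
    have "emeasure P (space P) = (\<integral>\<^sup>+x. ennreal (max 0 (h x)) \<partial>M)"
      by (simp add: P_def emeasure_distr emeasure_density cong: nn_integral_cong)
    also have "\<dots> = ennreal (\<integral>x. max 0 (h x) \<partial>M)"
      by (rule nn_integral_eq_integral[OF hint(1)]) auto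
    finally show "finite_measure P" by (intro finite_measureI) simp
    have "emeasure N (space N) = (\<integral>\<^sup>+x. ennreal (max 0 (- h x)) \<partial>M)"
      by (simp add: N_def emeasure_distr emeasure_density cong: nn_integral_cong)
    also have "\<dots> = ennreal (\<integral>x. max 0 (- h x) \<partial>M)"
      by (rule nn_integral_eq_integral[OF hint(2)]) auto
    finally show "finite_measure N" by (intro finite_measureI) simp
  qed
  interpret P: finite_measure P by fact
  interpret N: finite_measure N by fact
  have Kb[measurable]: "K \<in> sets borel" using K by (simp add: borel_compact)
  have PK: "AE x in P. x \<in> K" and NK: "AE x in N. x \<in> K"
    unfolding P_def N_def using TK by (auto simp: AE_distr_iff AE_density)
  have intPN: "(\<integral>x. f x \<partial>P) - (\<integral>x. f x \<partial>N) = (\<integral>x. h x * f (T x) \<partial>M)"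
    if f[measurable]: "f \<in> borel_measurable borel" and B: "\<And>x. x \<in> K \<Longrightarrow> \<bar>f x\<bar> \<le> B" for f :: "'a \<Rightarrow> real" and B
  proof -
    have B': "AE x in M. \<bar>f (T x)\<bar> \<le> B" using TK by eventually_elim (rule B)
    have i: "integrable M (\<lambda>x. g x * f (T x))" if g: "integrable M g" for g
    proof (rule Bochner_Integration.integrable_bound)
      show "integrable M (\<lambda>x. g x * B)" using g by simp
      show "(\<lambda>x. g x * f (T x)) \<in> borel_measurable M" using g by measurable
      show "AE x in M. norm (g x * f (T x)) \<le> norm (g x * B)"
        using B' by eventually_elim (auto simp: abs_mult intro!: mult_left_mono)
    qed
    have "(\<integral>x. f x \<partial>P) - (\<integral>x. f x \<partial>N)
        = (\<integral>x. max 0 (h x) * f (T x) \<partial>M) - (\<integral>x. max 0 (- h x) * f (T x) \<partial>M)"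
      by (simp add: P_def N_def integral_distr integral_density)
    also have "\<dots> = (\<integral>x. max 0 (h x) * f (T x) - max 0 (- h x) * f (T x) \<partial>M)"
      by (rule Bochner_Integration.integral_diff[symmetric]) (intro i hint)+
    also have "\<dots> = (\<integral>x. h x * f (T x) \<partial>M)"
      by (intro Bochner_Integration.integral_cong) (auto simp: max_def algebra_simps)
    finally show ?thesis .
  qed
  let ?M0 = "restrict_space borel K"
  define \<mu> where "\<mu> A = measure P A - measure N A" for A
  have s0: "sets ?M0 \<subseteq> sets borel"
    using Kb by (auto simp: sets_restrict_space)
  have sm: "signed_measure ?M0 \<mu>"
    unfolding \<mu>_def by (rule signed_measure_diff_measure) (use finP finN s0 in auto)
  have meas: "measure P K = measure P UNIV" "measure N K = measure N UNIV"
    using PK NK by (auto intro!: P.finite_measure_eq_AE N.finite_measure_eq_AE)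
  have "\<mu> K = 1"
    using intPN[of "\<lambda>_. 1" 1] mass meas by (simp add: \<mu>_def)
  with sm have mem: "\<mu> \<in> signed_borel_mass_one K"
    by (simp add: signed_borel_mass_one_def)
  have si: "signed_integral ?M0 \<mu> f = (\<integral>x. h x * f (T x) \<partial>M)"
    if f[measurable]: "f \<in> borel_measurable borel" and B: "\<And>x. x \<in> K \<Longrightarrow> \<bar>f x\<bar> \<le> B" for f :: "'a \<Rightarrow> real" and B
  proof -
    let ?P0 = "restrict_space P K" and ?N0 = "restrict_space N K"
    have finr: "finite_measure ?P0" "finite_measure ?N0"
      by (rule finite_measureI, simp add: space_restrict_space emeasure_restrict_space P.emeasure_eq_measure)
         (rule finite_measureI, simp add: space_restrict_space emeasure_restrict_space N.emeasure_eq_measure)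
    have "signed_integral ?M0 \<mu> f = (\<integral>x. f x \<partial>?P0) - (\<integral>x. f x \<partial>?N0)"
      unfolding signed_integral_def
    proof (rule integral_diff_eq_of_measure_diff_eq[where M = ?M0 and B = B])
      show "sets ?P0 = sets ?M0" "sets ?N0 = sets ?M0"
        by (simp_all add: sets_restrict_space)
      show "measure (pos_variation ?M0 \<mu>) A - measure (neg_variation ?M0 \<mu>) A
          = measure ?P0 A - measure ?N0 A" if A: "A \<in> sets ?M0" for A
      proof -
        have "A \<subseteq> K" using sets.sets_into_space[OF A] by (simp add: space_restrict_space)
        thus ?thesis
          using Jordan_decomposition[OF sm A] by (simp add: \<mu>_def measure_restrict_space)
      qed
      show "f \<in> borel_measurable ?M0" by (rule measurable_restrict_space1) measurable
    qed (use finr sm B in \<open>auto simp: space_restrict_space finite_measure_pos_variation finite_measure_neg_variation\<close>)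
    also have "(\<integral>x. f x \<partial>?P0) = (\<integral>x. f x \<partial>P)"
      using PK by (subst integral_restrict_space) (auto intro!: integral_cong_AE)
    also have "(\<integral>x. f x \<partial>?N0) = (\<integral>x. f x \<partial>N)"
      using NK by (subst integral_restrict_space) (auto intro!: integral_cong_AE)
    finally show ?thesis using intPN[OF f B] by simp
  qed
  \<comment> \<open>The point \<open>y\<close> is adjoined to \<open>K\<close> so that the bound,
    and with it the formula for the inner integral, holds for every \<open>y\<close>, also outside
    \<open>K\<close>. The outer integrand can then be rewritten as a function on the whole
    type.\<close>
  have kb: "\<bar>dist x y powr p\<bar> \<le> diameter (insert y K) powr p" if "x \<in> K" for x y
    using that p dist_powr_le_diameter[of "insert y K" x y p] K by auto
  have inner: "signed_integral ?M0 \<mu> (\<lambda>x. dist x y powr p) = (\<integral>x. h x * dist (T x) y powr p \<partial>M)" for y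
    by (rule si[OF _ kb]) measurable
  have "energy p K \<mu> = (\<integral>y. h y * (\<integral>x. h x * dist (T x) (T y) powr p \<partial>M) \<partial>M)"
    unfolding energy_def inner
  proof (rule si)
    show "(\<lambda>y. \<integral>x. h x * dist (T x) y powr p \<partial>M) \<in> borel_measurable borel"
      by measurable
    fix y assume y: "y \<in> K"
    have "\<bar>\<integral>x. h x * dist (T x) y powr p \<partial>M\<bar> \<le> (\<integral>x. norm (h x * dist (T x) y powr p) \<partial>M)"
      using integral_norm_bound[of M "\<lambda>x. h x * dist (T x) y powr p"] by simp
    also have "\<dots> \<le> (\<integral>x. \<bar>h x\<bar> * diameter K powr p \<partial>M)"
    proof (rule integral_mono_AE')
      show "AE x in M. norm (h x * dist (T x) y powr p) \<le> \<bar>h x\<bar> * diameter K powr p"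
        using TK by eventually_elim
          (use K y p in \<open>auto simp: abs_mult intro!: mult_left_mono dist_powr_le_diameter\<close>)
    qed (use h in auto)
    finally show "\<bar>\<integral>x. h x * dist (T x) y powr p \<partial>M\<bar> \<le> (\<integral>x. \<bar>h x\<bar> * diameter K powr p \<partial>M)" .
  qed
  with mem show ?thesis
    unfolding max_energy_def by (metis SUP_upper)
qed

definition discrete_energy :: "real \<Rightarrow> nat \<Rightarrow> (nat \<Rightarrow> real) \<Rightarrow> (nat \<Rightarrow> 'a::metric_space) \<Rightarrow> real" where
  "discrete_energy p m a x = (\<Sum>j<m. a j * (\<Sum>i<m. a i * dist (x i) (x j) powr p))"

lemma discrete_energy_le_max_energy:
  fixes x :: "nat \<Rightarrow> 'a::euclidean_space"
  assumes K: "compact K" and x: "\<And>i. i < m \<Longrightarrow> x i \<in> K" and mass: "(\<Sum>i<m. a i) = 1" and p: "0 < p"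
  shows "ereal (discrete_energy p m a x) \<le> max_energy p K"
proof -
  let ?M = "count_space {..<m}"
  have "K \<noteq> {}" using mass x by (cases m) auto
  moreover have "finite_measure ?M" by (rule finite_measure_count_space) simp
  ultimately have "ereal (\<integral>j. a j * (\<integral>i. a i * dist (x i) (x j) powr p \<partial>?M) \<partial>?M) \<le> max_energy p K"
    using K x mass p by (intro energy_density_le_max_energy)
      (auto simp: lebesgue_integral_count_space_finite integrable_count_space AE_count_space)
  thus ?thesis
    by (simp add: discrete_energy_def lebesgue_integral_count_space_finite)
qed

section \<open>Discretisation\<close>

text \<open>Finitely many balls of radius \<open>d\<close> are made disjoint and cut with
  \<open>K\<close>. A cell may be empty, and its centre \<open>x i\<close> lies in \<open>K\<close>
  but possibly in another cell.\<close>

lemma compact_fine_partition: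
  fixes K :: "'a::metric_space set"
  assumes K: "compact K" "K \<noteq> {}" and d: "0 < d"
  shows "\<exists>(m::nat) A x. (\<forall>i<m. A i \<in> sets borel) \<and> disjoint_family_on A {..<m} \<and> (\<Union>i<m. A i) = K \<and>
    (\<forall>i<m. x i \<in> K) \<and> (\<forall>i<m. \<forall>y\<in>A i. dist y (x i) < d)"
proof -
  obtain C where C: "finite C" "C \<subseteq> K" "K \<subseteq> (\<Union>c\<in>C. ball c d)"
  proof (rule compactE_image[OF K(1), of K "\<lambda>c. ball c d"])
    show "K \<subseteq> (\<Union>c\<in>K. ball c d)" using d by auto
  qed auto
  obtain m :: nat and x where x: "C = x ` {..<m}"
    using finite_imp_nat_seg_image_inj_on[OF C(1)] unfolding lessThan_def by metis
  define A where "A i = K \<inter> disjointed (\<lambda>i. ball (x i) d) i" for i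
  have Kb: "K \<in> sets borel" using K by (simp add: borel_compact)
  have Ai: "A i \<subseteq> ball (x i) d" for i
    unfolding A_def using disjointed_subset[of "\<lambda>i. ball (x i) d" i] by auto
  show ?thesis
  proof (intro exI[of _ m] exI[of _ A] exI[of _ x] conjI allI impI ballI)
    show "A i \<in> sets borel" for i
      unfolding A_def disjointed_def using Kb by auto
    show "disjoint_family_on A {..<m}"
      using disjoint_family_disjointed[of "\<lambda>i. ball (x i) d"]
      unfolding disjoint_family_on_def A_def by blast
    show "x i \<in> K" if "i < m" for i using x C(2) that by auto
    show "dist y (x i) < d" if "y \<in> A i" for i y
      using that Ai[of i] by (auto simp: dist_commute)
    have "(\<Union>i<m. A i) = K \<inter> (\<Union>i\<in>{0..<m}. disjointed (\<lambda>i. ball (x i) d) i)"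
      unfolding A_def lessThan_atLeast0 by blast
    also have "\<dots> = K \<inter> (\<Union>c\<in>C. ball c d)"
      unfolding finite_UN_disjointed_eq x lessThan_atLeast0 by blast
    also have "\<dots> = K" using C(3) by blast
    finally show "(\<Union>i<m. A i) = K" .
  qed
qed

text \<open>Comparison of \<open>f\<close> with the step function taking the value
  \<open>c i\<close> on \<open>A i\<close>. The cells have to cover almost everything only, so that
  the lemma serves the Jordan parts on \<open>K\<close> as well as the ball measure on the whole
  type.\<close>

lemma integral_partition_approx:
  fixes f :: "'a \<Rightarrow> real" and m :: nat
  assumes M: "finite_measure M" and A: "\<And>i. i < m \<Longrightarrow> A i \<in> sets M"
    and disj: "disjoint_family_on A {..<m}" and cover: "AE y in M. y \<in> (\<Union>i<m. A i)"
    and f: "integrable M f" and osc: "\<And>i y. i < m \<Longrightarrow> y \<in> A i \<Longrightarrow> \<bar>f y - c i\<bar> \<le> e"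
  shows "\<bar>(\<integral>y. f y \<partial>M) - (\<Sum>i<m. measure M (A i) * c i)\<bar> \<le> e * measure M (space M)"
proof -
  interpret finite_measure M by fact
  define s where "s y = (\<Sum>i<m. c i * indicator (A i) y)" for y
  have sA: "s y = c i" if "i < m" "y \<in> A i" for i y
  proof -
    have "c j * indicator (A j) y = (if j = i then c i else 0)" if "j < m" for j
      using disj \<open>i < m\<close> \<open>y \<in> A i\<close> that by (auto simp: disjoint_family_on_def indicator_def)
    hence "s y = (\<Sum>j<m. if j = i then c i else 0)"
      unfolding s_def by (intro sum.cong) auto
    thus ?thesis using \<open>i < m\<close> by simp
  qed
  have si: "integrable M s"
    unfolding s_def using A by (intro Bochner_Integration.integrable_sum integrable_mult_right
        integrable_real_indicator) (auto simp: less_top[symmetric])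
  have "(\<integral>y. s y \<partial>M) = (\<Sum>i<m. measure M (A i) * c i)"
    unfolding s_def using A
    by (subst Bochner_Integration.integral_sum)
      (auto simp: mult.commute less_top[symmetric] intro!: integrable_mult_right integrable_real_indicator)
  hence "\<bar>(\<integral>y. f y \<partial>M) - (\<Sum>i<m. measure M (A i) * c i)\<bar> = \<bar>\<integral>y. f y - s y \<partial>M\<bar>"
    using f si by simp
  also have "\<dots> \<le> (\<integral>y. \<bar>f y - s y\<bar> \<partial>M)"
    by (rule integral_abs_bound)
  also have "\<dots> \<le> (\<integral>y. e \<partial>M)"
  proof (rule integral_mono_AE)
    show "AE y in M. \<bar>f y - s y\<bar> \<le> e"
      using cover
    proof eventually_elim
      case (elim y)
      then obtain i where "i < m" "y \<in> A i" by auto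
      thus "\<bar>f y - s y\<bar> \<le> e" using osc sA by simp
    qed
  qed (use f si in auto)
  finally show ?thesis by (simp add: mult.commute)
qed

text \<open>Uniform continuity on a compact interval treats all exponents at once; for p < 1 the
  power has no Lipschitz bound at 0.\<close>

lemma powr_uniformly_continuous:
  assumes "0 < p" "0 < e"
  shows "\<exists>d>0. \<forall>r\<in>{0..D}. \<forall>s\<in>{0..D}. \<bar>r - s\<bar> < d \<longrightarrow> \<bar>r powr p - s powr p\<bar> < (e::real)"
proof -
  have "continuous_on {0..D} (\<lambda>r. r powr p)"
    using assms by (intro continuous_on_powr') (auto intro!: continuous_intros)
  hence "uniformly_continuous_on {0..D} (\<lambda>r. r powr p)"
    by (intro compact_uniformly_continuous) auto
  thus ?thesis
    using \<open>0 < e\<close> unfolding uniformly_continuous_on_def dist_real_def by (metis abs_minus_commute)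
qed

text \<open>The weight of a cell is its signed mass, so the total mass stays exactly 1. Only the
  kernel is changed, by a uniformly small amount in either variable, and the errors are controlled
  by the total variation \<open>V\<close>.\<close>

lemma energy_le_discrete_energy:
  fixes K :: "'a::euclidean_space set"
  assumes K: "compact K" and p: "0 < p" and mu: "\<mu> \<in> signed_borel_mass_one K" and e: "0 < e"
  shows "\<exists>m a x. (\<forall>i<m. x i \<in> K) \<and> (\<Sum>i<m. a i) = 1 \<and> energy p K \<mu> \<le> discrete_energy p m a x + e"
proof -
  let ?M0 = "restrict_space borel K"
  have sm: "signed_measure ?M0 \<mu>" and mu1: "\<mu> K = 1"
    using mu by (auto simp: signed_borel_mass_one_def)
  have Kb[measurable]: "K \<in> sets borel" using K by (simp add: borel_compact)
  have KM: "space ?M0 = K" "K \<in> sets ?M0" by (auto simp: space_restrict_space sets_restrict_space)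
  have Kne: "K \<noteq> {}" using mu1 signed_measure_empty[OF sm] by auto
  define P where "P = pos_variation ?M0 \<mu>"
  define N where "N = neg_variation ?M0 \<mu>"
  have [measurable_cong, simp]: "sets P = sets ?M0" "sets N = sets ?M0" by (simp_all add: P_def N_def)
  have sp[simp]: "space P = K" "space N = K" by (simp_all add: P_def N_def neg_variation_def KM)
  interpret P: finite_measure P unfolding P_def by (rule finite_measure_pos_variation[OF sm])
  interpret N: finite_measure N unfolding N_def by (rule finite_measure_neg_variation[OF sm])
  have Jor: "\<mu> A = measure P A - measure N A" if "A \<in> sets ?M0" for A
    unfolding P_def N_def by (rule Jordan_decomposition[OF sm that])
  define I where "I f = (\<integral>x. f x \<partial>P) - (\<integral>x. f x \<partial>N)" for f :: "'a \<Rightarrow> real"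
  define V where "V = measure P K + measure N K"
  have V: "0 \<le> V" by (simp add: V_def)
  define D where "D = diameter K"
  define k where "k x y = dist x y powr p" for x y :: 'a
  have E: "energy p K \<mu> = I (\<lambda>y. I (\<lambda>x. k x y))"
    by (simp add: energy_def signed_integral_def I_def P_def N_def k_def)
  have id0[measurable]: "(\<lambda>x. x) \<in> ?M0 \<rightarrow>\<^sub>M (borel :: 'a measure)"
    by (rule measurable_restrict_space1) measurable
  have [measurable]: "(\<lambda>x. k x y) \<in> borel_measurable ?M0" for y
    unfolding k_def by measurable
  have kD: "0 \<le> k x y" "k x y \<le> D powr p" if "x \<in> K" "y \<in> K" for x y
    unfolding k_def D_def using that K p by (auto intro: dist_powr_le_diameter)
  have ki: "integrable P (\<lambda>x. k x y)" "integrable N (\<lambda>x. k x y)" if "y \<in> K" for y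
    using kD that by (intro P.integrable_const_bound[where B = "D powr p"]
        N.integrable_const_bound[where B = "D powr p"]; auto intro!: AE_I2)+
  \<comment> \<open>Discretising the outer and then the inner integral costs
    \<open>e' * V\<^sup>2\<close> each; the summand 1 keeps the denominator positive.\<close>
  define e' where "e' = e / (2 * V\<^sup>2 + 1)"
  have e': "0 < e'" using e by (simp add: e'_def add_nonneg_pos)
  obtain d where d: "0 < d" and dd: "\<And>r s. 0 \<le> r \<Longrightarrow> r \<le> D \<Longrightarrow> 0 \<le> s \<Longrightarrow> s \<le> D \<Longrightarrow> \<bar>r - s\<bar> < d \<Longrightarrow> \<bar>r powr p - s powr p\<bar> < e'"
    using powr_uniformly_continuous[OF p e', of D] by (metis atLeastAtMost_iff)
  obtain m :: nat and A x where "\<forall>i<m. A i \<in> sets (borel :: 'a measure)" and A2: "disjoint_family_on A {..<m}"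
    "(\<Union>i<m. A i) = K" and "\<forall>i<m. x i \<in> K" "\<forall>i<m. \<forall>y\<in>A i. dist y (x i) < d"
    using compact_fine_partition[OF K Kne d] by auto
  hence A: "\<And>i. i < m \<Longrightarrow> A i \<in> sets (borel :: 'a measure)" "disjoint_family_on A {..<m}"
    "(\<Union>i<m. A i) = K" "\<And>i. i < m \<Longrightarrow> x i \<in> K" "\<And>i y. i < m \<Longrightarrow> y \<in> A i \<Longrightarrow> dist y (x i) < d"
    by blast+
  have A0: "A i \<in> sets ?M0" if "i < m" for i
    using A(1,3) that by (auto simp: sets_restrict_space image_iff intro!: bexI[of _ "A i"])
  define a where "a i = \<mu> (A i)" for i
  have AK: "y \<in> K" if "i < m" "y \<in> A i" for i y using A(3) that by auto
  have kosc: "\<bar>k z y - k z (x i)\<bar> \<le> e'" "\<bar>k y z - k (x i) z\<bar> \<le> e'" if "i < m" "y \<in> A i" "z \<in> K" for i y z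
  proof -
    have b: "dist u v \<le> D" if "u \<in> K" "v \<in> K" for u v
      unfolding D_def using that K by (auto intro: diameter_bounded_bound compact_imp_bounded)
    have "\<bar>dist z y - dist z (x i)\<bar> \<le> dist y (x i)"
      using dist_triangle[of z y "x i"] dist_triangle[of z "x i" y] by (simp add: dist_commute)
    hence "\<bar>dist z y - dist z (x i)\<bar> < d" using A(5)[OF that(1,2)] by simp
    thus "\<bar>k z y - k z (x i)\<bar> \<le> e'" unfolding k_def
      using that AK A(4) b by (intro order.strict_implies_order[OF dd]) auto
    thus "\<bar>k y z - k (x i) z\<bar> \<le> e'" by (simp add: k_def dist_commute)
  qed
  have approx: "\<bar>I f - (\<Sum>i<m. a i * f (x i))\<bar> \<le> q * V"
    if f: "integrable P f" "integrable N f" and osc: "\<And>i y. i < m \<Longrightarrow> y \<in> A i \<Longrightarrow> \<bar>f y - f (x i)\<bar> \<le> q" for f q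
  proof -
    have 1: "\<bar>(\<integral>y. f y \<partial>P) - (\<Sum>i<m. measure P (A i) * f (x i))\<bar> \<le> q * measure P (space P)"
      by (rule integral_partition_approx) (use A A0 f osc P.finite_measure_axioms in \<open>auto intro!: AE_I2\<close>)
    have 2: "\<bar>(\<integral>y. f y \<partial>N) - (\<Sum>i<m. measure N (A i) * f (x i))\<bar> \<le> q * measure N (space N)"
      by (rule integral_partition_approx) (use A A0 f osc N.finite_measure_axioms in \<open>auto intro!: AE_I2\<close>)
    have "(\<Sum>i<m. a i * f (x i)) = (\<Sum>i<m. measure P (A i) * f (x i)) - (\<Sum>i<m. measure N (A i) * f (x i))"
      unfolding a_def sum_subtractf[symmetric] by (intro sum.cong) (auto simp: Jor[OF A0] algebra_simps)
    with 1 2 show ?thesis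
      unfolding I_def V_def by (simp add: distrib_left)
  qed
  \<comment> \<open>The potential of \<open>\<mu>\<close>. Integrating the oscillation bound of the
    kernel shows that it deviates by at most \<open>e' * V\<close> from its sample value on a cell,
    so the outer integral can be discretised in the same way.\<close>
  define F where "F y = I (\<lambda>x. k x y)" for y
  have Fosc: "\<bar>F y - F (x i)\<bar> \<le> e' * V" if "i < m" "y \<in> A i" for i y
  proof -
    have b: "\<bar>(\<integral>z. k z y \<partial>Q) - (\<integral>z. k z (x i) \<partial>Q)\<bar> \<le> e' * measure Q K"
      if Q: "finite_measure Q" "space Q = K" "\<And>y. y \<in> K \<Longrightarrow> integrable Q (\<lambda>z. k z y)" for Q
    proof -
      interpret finite_measure Q by fact
      have i: "integrable Q (\<lambda>z. k z y)" "integrable Q (\<lambda>z. k z (x i))"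
        using Q(3) AK \<open>i < m\<close> \<open>y \<in> A i\<close> A(4) by auto
      have "\<bar>(\<integral>z. k z y \<partial>Q) - (\<integral>z. k z (x i) \<partial>Q)\<bar> = \<bar>\<integral>z. k z y - k z (x i) \<partial>Q\<bar>"
        using i by simp
      also have "\<dots> \<le> (\<integral>z. \<bar>k z y - k z (x i)\<bar> \<partial>Q)" by (rule integral_abs_bound)
      also have "\<dots> \<le> (\<integral>z. e' \<partial>Q)"
        using i kosc(1)[OF \<open>i < m\<close> \<open>y \<in> A i\<close>] Q(2) by (intro integral_mono) auto
      finally show ?thesis using Q(2) by (simp add: mult.commute)
    qed
    show ?thesis
      using b[OF P.finite_measure_axioms sp(1) ki(1)] b[OF N.finite_measure_axioms sp(2) ki(2)]
      unfolding F_def I_def V_def by (simp add: distrib_left)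
  qed
  have Fm[measurable]: "F \<in> borel_measurable ?M0"
    unfolding F_def I_def k_def
    by (intro borel_measurable_diff P.borel_measurable_lebesgue_integral N.borel_measurable_lebesgue_integral) measurable
  have Fb: "\<bar>F y\<bar> \<le> D powr p * V" if y: "y \<in> K" for y
  proof -
    have b: "\<bar>\<integral>z. k z y \<partial>Q\<bar> \<le> D powr p * measure Q K"
      if Q: "finite_measure Q" "space Q = K" "\<And>y. y \<in> K \<Longrightarrow> integrable Q (\<lambda>z. k z y)" for Q
    proof -
      interpret finite_measure Q by fact
      have "\<bar>\<integral>z. k z y \<partial>Q\<bar> \<le> (\<integral>z. \<bar>k z y\<bar> \<partial>Q)" by (rule integral_abs_bound)
      also have "\<dots> \<le> (\<integral>z. D powr p \<partial>Q)"
        using Q kD y by (intro integral_mono) (auto intro: integrable_abs)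
      finally show ?thesis using Q(2) by (simp add: mult.commute)
    qed
    show ?thesis
      using b[OF P.finite_measure_axioms sp(1) ki(1)] b[OF N.finite_measure_axioms sp(2) ki(2)]
      unfolding F_def I_def V_def by (simp add: distrib_left)
  qed
  have Fi: "integrable P F" "integrable N F"
    using Fb by (intro P.integrable_const_bound[where B = "D powr p * V"]
        N.integrable_const_bound[where B = "D powr p * V"]; auto intro!: AE_I2)+
  have 1: "\<bar>I F - (\<Sum>j<m. a j * F (x j))\<bar> \<le> e' * V * V"
    by (rule approx[OF Fi Fosc])
  have 2: "\<bar>F (x j) - (\<Sum>i<m. a i * k (x i) (x j))\<bar> \<le> e' * V" if "j < m" for j
    unfolding F_def using that A(4) kosc(2) by (intro approx ki) auto
  have mPN: "measure P K = (\<Sum>i<m. measure P (A i))" "measure N K = (\<Sum>i<m. measure N (A i))"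
    unfolding A(3)[symmetric]
    by (rule P.finite_measure_finite_Union; use A A0 in auto)
      (rule N.finite_measure_finite_Union; use A A0 in auto)
  have absa: "(\<Sum>j<m. \<bar>a j\<bar>) \<le> V"
    unfolding a_def V_def mPN sum.distrib[symmetric]
  proof (rule sum_mono)
    fix j assume "j \<in> {..<m}"
    hence "\<mu> (A j) = measure P (A j) - measure N (A j)" using Jor[OF A0] by simp
    thus "\<bar>\<mu> (A j)\<bar> \<le> measure P (A j) + measure N (A j)"
      using measure_nonneg[of P "A j"] measure_nonneg[of N "A j"] by linarith
  qed
  have suma: "(\<Sum>j<m. a j) = 1"
  proof -
    have "(\<Sum>j<m. a j) = measure P K - measure N K"
      unfolding mPN sum_subtractf[symmetric] a_def by (intro sum.cong) (auto simp: Jor[OF A0])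
    also have "\<dots> = 1" using Jor[OF KM(2)] mu1 by simp
    finally show ?thesis .
  qed
  have "\<bar>(\<Sum>j<m. a j * F (x j)) - discrete_energy p m a x\<bar>
      = \<bar>\<Sum>j<m. a j * (F (x j) - (\<Sum>i<m. a i * k (x i) (x j)))\<bar>"
    unfolding discrete_energy_def k_def by (simp add: right_diff_distrib sum_subtractf)
  also have "\<dots> \<le> (\<Sum>j<m. \<bar>a j\<bar> * (e' * V))"
    using 2 by (intro order_trans[OF sum_abs] sum_mono) (auto simp: abs_mult intro!: mult_left_mono)
  also have "\<dots> \<le> V * (e' * V)"
    unfolding sum_distrib_right[symmetric] using absa V e' by (intro mult_right_mono) auto
  finally have "\<bar>I F - discrete_energy p m a x\<bar> \<le> e' * V * V + V * (e' * V)"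
    using 1 by linarith
  also have "\<dots> = e' * (2 * V\<^sup>2)" by (simp add: power2_eq_square algebra_simps)
  also have "\<dots> \<le> e' * (2 * V\<^sup>2 + 1)" using e' by (intro mult_left_mono) auto
  also have "\<dots> = e"
    unfolding e'_def using add_nonneg_pos[of "2 * V\<^sup>2" 1] by (simp del: add_nonneg_pos)
  finally have "energy p K \<mu> \<le> discrete_energy p m a x + e"
    unfolding E F_def[symmetric] by linarith
  with A(4) suma show ?thesis by blast
qed

text \<open>Reduces every upper bound for a maximal energy to finite sums; it is applied both to the
  image of the ball and to the interval.\<close>

lemma max_energy_leI:
  fixes K :: "'a::euclidean_space set"
  assumes K: "compact K" and p: "0 < p"
    and le: "\<And>m a x. (\<And>i. i < m \<Longrightarrow> x i \<in> K) \<Longrightarrow> (\<Sum>i<m. a i) = 1 \<Longrightarrow> ereal (discrete_energy p m a x) \<le> c"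
  shows "max_energy p K \<le> c"
  unfolding max_energy_def
proof (rule SUP_least)
  fix \<mu> assume mu: "\<mu> \<in> signed_borel_mass_one K"
  show "ereal (energy p K \<mu>) \<le> c"
  proof (rule ereal_le_epsilon2)
    fix e :: real assume "0 < e"
    obtain m a x where "\<forall>i<m. x i \<in> K" "(\<Sum>i<m. a i) = 1"
      "energy p K \<mu> \<le> discrete_energy p m a x + e"
      using energy_le_discrete_energy[OF K p mu \<open>0 < e\<close>] by blast
    moreover from this have "ereal (discrete_energy p m a x) \<le> c" by (intro le) auto
    ultimately show "ereal (energy p K \<mu>) \<le> c + ereal e"
      by (metis add_right_mono ereal_less_eq(3) order_trans plus_ereal.simps(1))
  qed
qed

section \<open>Rotation invariance and marginals of the ball\<close>

lemma nn_integral_lborel_translate: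
  fixes c :: "'a::euclidean_space"
  assumes [measurable]: "g \<in> borel_measurable borel"
  shows "(\<integral>\<^sup>+x. g (x + c) \<partial>lborel) = (\<integral>\<^sup>+x. g x \<partial>lborel)"
proof -
  have "(\<integral>\<^sup>+x. g x \<partial>lborel) = (\<integral>\<^sup>+x. g x \<partial>distr lborel borel ((+) c))"
    by (simp add: lborel_distr_plus)
  also have "\<dots> = (\<integral>\<^sup>+x. g (c + x) \<partial>lborel)"
    by (subst nn_integral_distr) auto
  finally show ?thesis by (simp add: add.commute)
qed

text \<open>The usual uniqueness proof for Haar measure, with the unit ball as test set: an orthogonal map
  preserves it, so the constant is one.\<close>

lemma lborel_orthogonal_transformation:
  fixes f :: "'a::euclidean_space \<Rightarrow> 'a"
  assumes f: "orthogonal_transformation f"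
  shows "distr lborel borel f = lborel"
proof (rule measure_eqI)
  have lin: "linear f" using f by (rule orthogonal_transformation_linear)
  have [measurable]: "f \<in> borel_measurable borel"
    using lin by (intro borel_measurable_continuous_onI linear_continuous_on linear_conv_bounded_linear[THEN iffD1])
  show "sets (distr lborel borel f) = sets lborel" by simp
  fix A assume "A \<in> sets (distr lborel borel f)"
  hence A[measurable]: "A \<in> sets borel" by simp
  let ?C = "ball (0::'a) 1"
  have [measurable]: "?C \<in> sets borel" by simp
  have C: "indicator ?C (- f y) = (indicator ?C y :: ennreal)" for y
    using orthogonal_transformation_norm[OF f] by (simp add: indicator_def)
  have surj: "\<exists>z. x = f z" for x
    using orthogonal_transformation_surj[OF f] by (metis surjD)
  have "emeasure lborel ?C * emeasure (distr lborel borel f) A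
      = (\<integral>\<^sup>+y. indicator A (f y) * emeasure lborel ?C \<partial>lborel)"
  proof -
    have "emeasure (distr lborel borel f) A = (\<integral>\<^sup>+y. indicator A y \<partial>distr lborel borel f)"
      by simp
    also have "\<dots> = (\<integral>\<^sup>+y. indicator A (f y) \<partial>lborel)"
      by (subst nn_integral_distr) auto
    finally show ?thesis by (simp add: nn_integral_multc mult.commute)
  qed
  also have "\<dots> = (\<integral>\<^sup>+y. (\<integral>\<^sup>+x. indicator A (f y) * indicator ?C (x + - f y) \<partial>lborel) \<partial>lborel)"
  proof (rule nn_integral_cong)
    fix y
    have "(\<integral>\<^sup>+x. indicator ?C (x + - f y) \<partial>lborel) = emeasure lborel ?C"
      by (subst nn_integral_lborel_translate[of "indicator ?C"])
        (auto intro!: borel_measurable_indicator)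
    moreover have "(\<integral>\<^sup>+x. indicator A (f y) * indicator ?C (x + - f y) \<partial>lborel)
        = indicator A (f y) * (\<integral>\<^sup>+x. indicator ?C (x + - f y) \<partial>lborel)"
      by (rule nn_integral_cmult) measurable
    ultimately show "indicator A (f y) * emeasure lborel ?C
        = (\<integral>\<^sup>+x. indicator A (f y) * indicator ?C (x + - f y) \<partial>lborel)"
      by simp
  qed
  also have "\<dots> = (\<integral>\<^sup>+x. (\<integral>\<^sup>+y. indicator A (f y) * indicator ?C (x + - f y) \<partial>lborel) \<partial>lborel)"
    by (rule lborel_pair.Fubini') measurable
  also have "\<dots> = (\<integral>\<^sup>+x. (\<integral>\<^sup>+y. indicator A (f y + x) * indicator ?C (- f y) \<partial>lborel) \<partial>lborel)"
  proof (rule nn_integral_cong)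
    fix x
    \<comment> \<open>Surjectivity turns the translation by \<open>x\<close> into a translation of
      \<open>y\<close> by \<open>z\<close>, which moves the shift from the test set to
      \<open>A\<close>.\<close>
    obtain z where z: "x = f z" using surj by blast
    have "(\<integral>\<^sup>+y. indicator A (f y) * indicator ?C (x + - f y) \<partial>lborel)
        = (\<integral>\<^sup>+y. (indicator A (f (y + z)) * indicator ?C (x + - f (y + z)) :: ennreal) \<partial>lborel)"
      by (rule nn_integral_lborel_translate[symmetric]) measurable
    thus "(\<integral>\<^sup>+y. indicator A (f y) * indicator ?C (x + - f y) \<partial>lborel)
        = (\<integral>\<^sup>+y. (indicator A (f y + x) * indicator ?C (- f y) :: ennreal) \<partial>lborel)"
      by (simp add: linear_add[OF lin] z)
  qed
  also have "\<dots> = (\<integral>\<^sup>+y. (\<integral>\<^sup>+x. indicator A (f y + x) * indicator ?C (- f y) \<partial>lborel) \<partial>lborel)"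
    by (rule lborel_pair.Fubini') measurable
  also have "\<dots> = (\<integral>\<^sup>+y. emeasure lborel A * indicator ?C y \<partial>lborel)"
  proof (rule nn_integral_cong)
    fix y
    have "(\<integral>\<^sup>+x. indicator A (x + f y) \<partial>lborel) = emeasure lborel A"
      by (subst nn_integral_lborel_translate[of "indicator A"]) auto
    thus "(\<integral>\<^sup>+x. indicator A (f y + x) * indicator ?C (- f y) \<partial>lborel) = emeasure lborel A * indicator ?C y"
      by (subst nn_integral_multc) (auto simp: add.commute C)
  qed
  also have "\<dots> = emeasure lborel ?C * emeasure lborel A"
    by (subst nn_integral_cmult) (auto simp: mult.commute)
  finally have eq: "emeasure lborel ?C * emeasure (distr lborel borel f) A = emeasure lborel ?C * emeasure lborel A" .
  have "emeasure lborel ?C \<noteq> \<infinity>" "emeasure lborel ?C \<noteq> 0"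
    using emeasure_lborel_ball_finite[of "0::'a" 1] content_ball_pos[of 1 "0::'a"]
    by (auto simp: measure_def)
  with eq show "emeasure (distr lborel borel f) A = emeasure lborel A"
    by (simp add: ennreal_mult_cancel_left)
qed

text \<open>Left unnormalised, because only a quotient of two of its integrals enters the constant.
  Being a density on the whole type, it avoids restricted spaces, at the price that bounds valid on
  the unit ball hold only almost everywhere.\<close>

definition ball_measure :: "'a::euclidean_space measure" where
  "ball_measure = density lborel (indicator (cball 0 1))"

lemma sets_ball_measure [simp, measurable_cong]: "sets ball_measure = sets borel"
  and space_ball_measure [simp]: "space ball_measure = UNIV"
  by (simp_all add: ball_measure_def)

lemma emeasure_ball_measure:
  "A \<in> sets borel \<Longrightarrow> emeasure ball_measure A = emeasure lborel (cball 0 1 \<inter> A)"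
  unfolding ball_measure_def by (subst emeasure_restricted) auto

lemma finite_measure_ball_measure: "finite_measure (ball_measure :: 'a::euclidean_space measure)"
  by (rule finite_measureI) (use emeasure_lborel_cball_finite[of "0::'a" 1] in \<open>simp add: emeasure_ball_measure\<close>)

lemma AE_ball_measure: "AE x in ball_measure. x \<in> cball 0 1"
  unfolding ball_measure_def by (subst AE_density) (auto simp: indicator_def intro!: borel_measurable_indicator)

lemma distr_ball_measure_orthogonal_transformation:
  fixes f :: "'a::euclidean_space \<Rightarrow> 'a"
  assumes f: "orthogonal_transformation f"
  shows "distr ball_measure borel f = ball_measure"
proof -
  have [measurable]: "f \<in> borel_measurable borel"
    using orthogonal_transformation_linear[OF f]
    by (intro borel_measurable_continuous_onI linear_continuous_on linear_conv_bounded_linear[THEN iffD1])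
  have "distr ball_measure borel f
      = distr (density lborel (\<lambda>x. indicator (cball 0 1) (f x))) borel f"
    unfolding ball_measure_def
    by (intro arg_cong[where f = "\<lambda>M. distr M borel f"] arg_cong[where f = "density lborel"] ext)
      (simp add: indicator_def orthogonal_transformation_norm[OF f])
  also have "\<dots> = density (distr lborel borel f) (indicator (cball 0 1))"
    by (rule density_distr[symmetric]) (auto intro!: borel_measurable_indicator)
  also have "\<dots> = ball_measure"
    by (simp add: lborel_orthogonal_transformation[OF f] ball_measure_def)
  finally show ?thesis .
qed

text \<open>In the coordinates of \<open>Basis\<close>, the slice at height \<open>t\<close> is a
  ball of radius \<open>sqrt (s - t\<^sup>2)\<close> in the remaining coordinates. Splitting the
  coordinate \<open>e\<close> off the product measure leaves its volume.\<close>

lemma nn_integral_cball_slice: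
  fixes e :: "'a::euclidean_space" and g :: "real \<Rightarrow> ennreal"
  assumes e: "e \<in> Basis" and [measurable]: "g \<in> borel_measurable borel" and s: "0 \<le> s"
  shows "(\<integral>\<^sup>+x. g (x \<bullet> e) * indicator {x. (norm x)\<^sup>2 \<le> s} x \<partial>lborel)
    = (\<integral>\<^sup>+t. g t * indicator {t. t\<^sup>2 \<le> s} t *
        ennreal (unit_ball_vol (real (DIM('a) - 1)) * sqrt (s - t\<^sup>2) ^ (DIM('a) - 1)) \<partial>lborel)"
proof -
  interpret product_sigma_finite "\<lambda>_::'a. lborel :: real measure" by standard
  define A where "A = (Basis :: 'a set) - {e}"
  have A: "finite A" "e \<notin> A" "Basis = insert e A" "card A = DIM('a) - 1"
    using e by (auto simp: A_def)
  define emb where "emb x = (\<Sum>b\<in>Basis. x b *\<^sub>R b)" for x :: "'a \<Rightarrow> real"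
  have [measurable]: "emb \<in> (\<Pi>\<^sub>M b\<in>Basis. lborel) \<rightarrow>\<^sub>M borel"
    unfolding emb_def by measurable
  have emb_e: "emb x \<bullet> e = x e" for x
    using e by (simp add: emb_def inner_sum_left inner_Basis if_distrib cong: if_cong)
  have emb_norm: "(norm (emb x))\<^sup>2 = (\<Sum>b\<in>Basis. (x b)\<^sup>2)" for x
    unfolding emb_def by (subst norm_sum_Pythagorean) (auto simp: pairwise_def orthogonal_def inner_Basis)
  let ?k = "DIM('a) - 1"
  have "(\<integral>\<^sup>+x. g (x \<bullet> e) * indicator {x. (norm x)\<^sup>2 \<le> s} x \<partial>lborel)
      = (\<integral>\<^sup>+x. g (emb x \<bullet> e) * indicator {x. (norm x)\<^sup>2 \<le> s} (emb x) \<partial>(\<Pi>\<^sub>M b\<in>Basis. lborel))"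
    by (subst lborel_eq, subst nn_integral_distr) (auto simp: emb_def[symmetric, abs_def])
  also have "\<dots> = (\<integral>\<^sup>+x. g (x e) * indicator {x. (\<Sum>b\<in>insert e A. (x b)\<^sup>2) \<le> s} x \<partial>(\<Pi>\<^sub>M b\<in>insert e A. lborel))"
    unfolding emb_e A(3)[symmetric] by (simp add: indicator_def emb_norm)
  also have "\<dots> = (\<integral>\<^sup>+t. \<integral>\<^sup>+x. g ((x(e := t)) e) * indicator {x. (\<Sum>b\<in>insert e A. (x b)\<^sup>2) \<le> s} (x(e := t))
      \<partial>(\<Pi>\<^sub>M b\<in>A. lborel) \<partial>lborel)"
  proof (rule product_nn_integral_insert_rev)
    have "(\<lambda>x. g (x e) * indicator {..s} (\<Sum>b\<in>insert e A. (x b)\<^sup>2)) \<in> borel_measurable (\<Pi>\<^sub>M b\<in>insert e A. lborel)"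
      by measurable
    thus "(\<lambda>x. g (x e) * indicator {x. (\<Sum>b\<in>insert e A. (x b)\<^sup>2) \<le> s} x) \<in> borel_measurable (\<Pi>\<^sub>M b\<in>insert e A. lborel)"
      by (simp add: indicator_def)
  qed (use A in auto)
  also have "\<dots> = (\<integral>\<^sup>+t. g t * (\<integral>\<^sup>+x. indicator {x. (\<Sum>b\<in>A. (x b)\<^sup>2) \<le> s - t\<^sup>2} x
      \<partial>(\<Pi>\<^sub>M b\<in>A. lborel)) \<partial>lborel)"
  proof (rule nn_integral_cong)
    fix t
    have "(\<Sum>b\<in>A. ((x(e := t)) b)\<^sup>2) = (\<Sum>b\<in>A. (x b)\<^sup>2)" for x :: "'a \<Rightarrow> real"
      using A by (intro sum.cong) auto
    hence "(\<integral>\<^sup>+x. g ((x(e := t)) e) * indicator {x. (\<Sum>b\<in>insert e A. (x b)\<^sup>2) \<le> s} (x(e := t)) \<partial>(\<Pi>\<^sub>M b\<in>A. lborel))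
        = (\<integral>\<^sup>+x. g t * indicator {x. (\<Sum>b\<in>A. (x b)\<^sup>2) \<le> s - t\<^sup>2} x \<partial>(\<Pi>\<^sub>M b\<in>A. lborel))"
      using A(1,2) by (intro nn_integral_cong) (auto simp: indicator_def algebra_simps)
    also have "\<dots> = g t * (\<integral>\<^sup>+x. indicator {x. (\<Sum>b\<in>A. (x b)\<^sup>2) \<le> s - t\<^sup>2} x \<partial>(\<Pi>\<^sub>M b\<in>A. lborel))"
      using A by (intro nn_integral_cmult) measurable
    finally show "(\<integral>\<^sup>+x. g ((x(e := t)) e) * indicator {x. (\<Sum>b\<in>insert e A. (x b)\<^sup>2) \<le> s} (x(e := t)) \<partial>(\<Pi>\<^sub>M b\<in>A. lborel))
        = g t * (\<integral>\<^sup>+x. indicator {x. (\<Sum>b\<in>A. (x b)\<^sup>2) \<le> s - t\<^sup>2} x \<partial>(\<Pi>\<^sub>M b\<in>A. lborel))" .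
  qed
  also have "\<dots> = (\<integral>\<^sup>+t. g t * indicator {t. t\<^sup>2 \<le> s} t *
        ennreal (unit_ball_vol (real ?k) * sqrt (s - t\<^sup>2) ^ ?k) \<partial>lborel)"
  proof (rule nn_integral_cong_AE)
    \<comment> \<open>The volume formula asks for a positive radius, so the heights where the slice
      shrinks to a point are discarded as a null set.\<close>
    have "AE t in lborel. t \<notin> {sqrt s, - sqrt s}"
      by (intro AE_not_in) (auto simp: emeasure_lborel_countable)
    thus "AE t in lborel. g t * (\<integral>\<^sup>+x. indicator {x. (\<Sum>b\<in>A. (x b)\<^sup>2) \<le> s - t\<^sup>2} x \<partial>(\<Pi>\<^sub>M b\<in>A. lborel))
        = g t * indicator {t. t\<^sup>2 \<le> s} t * ennreal (unit_ball_vol (real ?k) * sqrt (s - t\<^sup>2) ^ ?k)"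
    proof eventually_elim
      case (elim t)
      have ne: "t\<^sup>2 \<noteq> s"
      proof
        assume "t\<^sup>2 = s"
        hence "\<bar>t\<bar> = sqrt s" by (metis real_sqrt_abs)
        with elim show False by auto
      qed
      show ?case
      proof (cases "t\<^sup>2 \<le> s")
        case True
        with ne have pos: "0 < sqrt (s - t\<^sup>2)" by simp
        have "(\<integral>\<^sup>+x. indicator {x. (\<Sum>b\<in>A. (x b)\<^sup>2) \<le> s - t\<^sup>2} x \<partial>(\<Pi>\<^sub>M b\<in>A. lborel))
            = (\<integral>\<^sup>+x. indicator ({x. sqrt (\<Sum>b\<in>A. (x b)\<^sup>2) \<le> sqrt (s - t\<^sup>2)} \<inter> space (\<Pi>\<^sub>M b\<in>A. lborel)) x \<partial>(\<Pi>\<^sub>M b\<in>A. lborel))"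
          by (intro nn_integral_cong) (simp add: indicator_def)
        also have "\<dots> = emeasure (\<Pi>\<^sub>M b\<in>A. lborel) ({x. sqrt (\<Sum>b\<in>A. (x b)\<^sup>2) \<le> sqrt (s - t\<^sup>2)} \<inter> space (\<Pi>\<^sub>M b\<in>A. lborel))"
          using A(1) by (subst nn_integral_indicator) auto
        also have "\<dots> = ennreal (unit_ball_vol (real (card A)) * sqrt (s - t\<^sup>2) ^ card A)"
          by (rule emeasure_cball_aux[OF A(1) pos])
        finally show ?thesis using True A(4) by simp
      next
        case False
        have "\<not> (\<Sum>b\<in>A. (x b)\<^sup>2) \<le> s - t\<^sup>2" for x :: "'a \<Rightarrow> real"
          using False sum_nonneg[of A "\<lambda>b. (x b)\<^sup>2"] by (simp add: not_le)
        thus ?thesis using False by simp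
      qed
    qed
  qed
  finally show ?thesis .
qed

section \<open>Beta integrals and marginals of radial densities\<close>

lemma nn_integral_power_tail:
  fixes r :: real
  assumes "r \<le> 1"
  shows "(\<integral>\<^sup>+s. ennreal ((1 - s) ^ m) * indicator {r..1} s \<partial>lborel) = ennreal ((1 - r) ^ (m + 1) / (m + 1))"
proof -
  have "((\<lambda>s. - 1 / (m + 1) * (1 - s) ^ Suc m) has_real_derivative - 1 / (m + 1) * ((1 + real m) * ((0 - 1) * (1 - s) ^ m))) (at s)" for s
    by (intro DERIV_cmult DERIV_power_Suc DERIV_diff DERIV_const DERIV_ident)
  hence "((\<lambda>s. - 1 / (m + 1) * (1 - s) ^ (m + 1)) has_real_derivative (1 - s) ^ m) (at s)" for s
    by simp
  hence "(\<integral>\<^sup>+s. ennreal ((1 - s) ^ m) * indicator {r..1} s \<partial>lborel)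
      = ennreal (- 1 / (m + 1) * (1 - 1) ^ (m + 1) - (- 1 / (m + 1) * (1 - r) ^ (m + 1)))"
    using assms by (intro nn_integral_FTC_Icc) auto
  thus ?thesis by simp
qed

text \<open>Euler's Beta integral B(m + 1, k / 2 + 1). Its positivity allows dividing by it when a
  density is lifted to the ball.\<close>

definition beta_const :: "nat \<Rightarrow> nat \<Rightarrow> real" where
  "beta_const m k = (\<integral>y. (1 - y) ^ m * sqrt y ^ k * indicator {0..1} y \<partial>lborel)"

lemma beta_const:
  shows beta_const_pos: "0 < beta_const m k"
    and nn_integral_beta_const:
      "(\<integral>\<^sup>+y. ennreal ((1 - y) ^ m * sqrt y ^ k) * indicator {0..1} y \<partial>lborel) = ennreal (beta_const m k)"
proof -
  let ?f = "\<lambda>y::real. (1 - y) ^ m * sqrt y ^ k * indicator {0..1} y"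
  have "set_integrable lborel {0..1} (\<lambda>y::real. (1 - y) ^ m * sqrt y ^ k)"
    by (intro borel_integrable_atLeastAtMost') (auto intro!: continuous_intros)
  hence int: "integrable lborel ?f"
    by (simp add: set_integrable_def mult.commute)
  have nn: "0 \<le> ?f y" for y by (auto simp: indicator_def)
  have "(\<integral>\<^sup>+y. ennreal (?f y) \<partial>lborel) = ennreal (beta_const m k)"
    unfolding beta_const_def by (rule nn_integral_eq_integral[OF int]) (auto simp: indicator_def)
  moreover have "ennreal ((1 - y) ^ m * sqrt y ^ k) * indicator {0..1} y = ennreal (?f y)" for y
    by (simp add: indicator_def)
  ultimately show "(\<integral>\<^sup>+y. ennreal ((1 - y) ^ m * sqrt y ^ k) * indicator {0..1} y \<partial>lborel) = ennreal (beta_const m k)"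
    by simp
  have "beta_const m k \<noteq> 0"
  proof
    assume "beta_const m k = 0"
    hence "AE y in lborel. ?f y = 0"
      unfolding beta_const_def using integral_nonneg_eq_0_iff_AE[OF int] nn by auto
    hence "AE y in lborel. y \<notin> {0<..<1::real}"
      by eventually_elim (auto simp: indicator_def)
    hence "emeasure lborel {x::real. 0 < x \<and> x < 1} = 0"
      by (subst (asm) AE_iff_measurable[OF _ refl]) auto
    moreover have "{x::real. 0 < x \<and> x < 1} = {0<..<1}" by auto
    ultimately show False by simp
  qed
  moreover have "0 \<le> beta_const m k"
    unfolding beta_const_def by (rule integral_nonneg_AE) (use nn in auto)
  ultimately show "0 < beta_const m k" by simp
qed

text \<open>Substitute s = v + (1 - v) y. At v = 1 the substitution degenerates and both sides
  vanish, since the integral runs over a single point.\<close>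

lemma nn_integral_beta_shift:
  fixes v :: real
  assumes v: "0 \<le> v" "v \<le> 1"
  shows "(\<integral>\<^sup>+s. ennreal ((1 - s) ^ m * sqrt (s - v) ^ k) * indicator {v..1} s \<partial>lborel)
    = ennreal (beta_const m k * (1 - v) ^ (m + 1) * sqrt (1 - v) ^ k)"
proof (cases "v = 1")
  case True
  have "(\<integral>\<^sup>+s. ennreal ((1 - s) ^ m * sqrt (s - v) ^ k) * indicator {v..1} s \<partial>lborel) = nn_integral lborel (\<lambda>s::real. 0)"
  proof (rule nn_integral_cong_AE)
    have "AE s in lborel. s \<notin> {1::real}" by (intro AE_not_in) auto
    thus "AE s in lborel. ennreal ((1 - s) ^ m * sqrt (s - v) ^ k) * indicator {v..1} s = 0"
      by eventually_elim (auto simp: True indicator_def)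
  qed
  thus ?thesis using True by simp
next
  case False
  with v have pos: "0 < 1 - v" by simp
  let ?f = "\<lambda>s::real. ennreal ((1 - s) ^ m * sqrt (s - v) ^ k) * indicator {v..1} s"
  have pt: "?f (v + (1 - v) * y)
      = ennreal ((1 - v) ^ m * sqrt (1 - v) ^ k) * (ennreal ((1 - y) ^ m * sqrt y ^ k) * indicator {0..1} y)" for y
  proof (cases "0 \<le> y \<and> y \<le> 1")
    case True
    have "1 - (v + (1 - v) * y) = (1 - v) * (1 - y)" by (simp add: algebra_simps)
    moreover have "(v + (1 - v) * y) \<in> {v..1}"
    proof -
      have "(1 - v) * y \<le> (1 - v) * 1" using True pos by (intro mult_left_mono) auto
      hence "v + (1 - v) * y \<le> 1" by (simp add: algebra_simps)
      thus ?thesis using True pos by simp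
    qed
    ultimately show ?thesis
      using True pos
      by (simp add: power_mult_distrib real_sqrt_mult mult_ac flip: ennreal_mult)
  next
    case False
    have "v + (1 - v) * y \<notin> {v..1}"
    proof (cases "y < 0")
      case True
      thus ?thesis using mult_pos_neg[OF pos True] by simp
    next
      case False
      with \<open>\<not> (0 \<le> y \<and> y \<le> 1)\<close> have "1 < y" by simp
      hence "(1 - v) * 1 < (1 - v) * y" using pos by (intro mult_strict_left_mono)
      thus ?thesis by simp
    qed
    with False show ?thesis by (auto simp: indicator_def)
  qed
  have "(\<integral>\<^sup>+s. ?f s \<partial>lborel) = ennreal \<bar>1 - v\<bar> * (\<integral>\<^sup>+y. ?f (v + (1 - v) * y) \<partial>lborel)"
    using pos by (intro nn_integral_real_affine) auto
  also have "\<dots> = ennreal \<bar>1 - v\<bar> * (ennreal ((1 - v) ^ m * sqrt (1 - v) ^ k) * ennreal (beta_const m k))"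
    unfolding pt by (subst nn_integral_cmult) (auto simp: nn_integral_beta_const)
  finally show ?thesis
    using pos beta_const_pos[of m k] by (simp add: mult_ac flip: ennreal_mult)
qed

lemma nn_integral_cmult2:
  assumes "F \<in> borel_measurable M"
  shows "(\<integral>\<^sup>+x. a * (b * F x) \<partial>M) = a * (b * (\<integral>\<^sup>+x. F x \<partial>M))"
  using assms by (simp add: nn_integral_cmult)

text \<open>Writing \<open>(1 - r) ^ (m + 1)\<close> as a mixture of indicators of \<open>r \<le> s\<close> reduces the marginal of
  this radial density to the volumes of the slices of balls.\<close>

lemma nn_integral_ball_measure_marginal:
  fixes e :: "'a::euclidean_space" and g :: "real \<Rightarrow> ennreal"
  assumes e: "e \<in> Basis" and g[measurable]: "g \<in> borel_measurable borel"
  defines "k \<equiv> DIM('a) - 1"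
  shows "(\<integral>\<^sup>+x. g (x \<bullet> e) * ennreal ((1 - (norm x)\<^sup>2) ^ (m + 1)) \<partial>ball_measure)
    = (\<integral>\<^sup>+t. g t * ennreal (real (m + 1) * unit_ball_vol (real k) * beta_const m k *
          ((1 - t\<^sup>2) ^ (m + 1) * sqrt (1 - t\<^sup>2) ^ k)) * indicator {-1..1} t \<partial>lborel)"
proof -
  let ?c = "unit_ball_vol (real k)"
  have c: "0 \<le> ?c" by (simp add: unit_ball_vol_def)
  let ?S = "\<lambda>s::real. ennreal ((1 - s) ^ m) * indicator {0..1} s"
  have sq1: "t\<^sup>2 \<le> 1 \<longleftrightarrow> t \<in> {-1..1}" for t :: real
    by (auto simp: abs_square_le_1 abs_le_iff)
  have "(\<integral>\<^sup>+x. g (x \<bullet> e) * ennreal ((1 - (norm x)\<^sup>2) ^ (m + 1)) \<partial>ball_measure)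
      = (\<integral>\<^sup>+x. indicator (cball 0 1) x * (g (x \<bullet> e) * ennreal ((1 - (norm x)\<^sup>2) ^ (m + 1))) \<partial>lborel)"
    unfolding ball_measure_def by (subst nn_integral_density) (auto intro!: borel_measurable_indicator)
  also have "\<dots> = (\<integral>\<^sup>+x. \<integral>\<^sup>+s. ennreal (m + 1) * (?S s * (g (x \<bullet> e) * indicator {r. r \<le> s} ((norm x)\<^sup>2))) \<partial>lborel \<partial>lborel)"
  proof (rule nn_integral_cong)
    fix x :: 'a
    let ?r = "(norm x)\<^sup>2"
    have "(\<integral>\<^sup>+s. ennreal (m + 1) * (?S s * (g (x \<bullet> e) * indicator {r. r \<le> s} ?r)) \<partial>lborel)
        = (\<integral>\<^sup>+s. (ennreal (m + 1) * g (x \<bullet> e)) * (ennreal ((1 - s) ^ m) * indicator {?r..1} s) \<partial>lborel)"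
      by (intro nn_integral_cong) (auto simp: indicator_def mult_ac intro: order_trans[OF zero_le_power2])
    also have "\<dots> = (ennreal (m + 1) * g (x \<bullet> e)) * (\<integral>\<^sup>+s. ennreal ((1 - s) ^ m) * indicator {?r..1} s \<partial>lborel)"
      by (rule nn_integral_cmult) measurable
    also have "\<dots> = indicator (cball 0 1) x * (g (x \<bullet> e) * ennreal ((1 - ?r) ^ (m + 1)))"
    proof (cases "?r \<le> 1")
      case True
      hence "x \<in> cball 0 1" by (simp add: abs_square_le_1)
      moreover have "ennreal (m + 1) * ennreal ((1 - ?r) ^ (m + 1) / (m + 1)) = ennreal ((1 - ?r) ^ (m + 1))"
        using True by (subst ennreal_mult[symmetric]) auto
      ultimately show ?thesis
        unfolding nn_integral_power_tail[OF True] by (simp add: mult_ac)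
    next
      case False
      hence "x \<notin> cball 0 1" by (simp add: abs_square_le_1)
      thus ?thesis using False by simp
    qed
    finally show "indicator (cball 0 1) x * (g (x \<bullet> e) * ennreal ((1 - ?r) ^ (m + 1)))
        = (\<integral>\<^sup>+s. ennreal (m + 1) * (?S s * (g (x \<bullet> e) * indicator {r. r \<le> s} ?r)) \<partial>lborel)" ..
  qed
  also have "\<dots> = (\<integral>\<^sup>+s. \<integral>\<^sup>+x. ennreal (m + 1) * (?S s * (g (x \<bullet> e) * indicator {r. r \<le> s} ((norm x)\<^sup>2))) \<partial>lborel \<partial>lborel)"
  proof (rule lborel_pair.Fubini')
    \<comment> \<open>Membership in a set that varies with \<open>s\<close> is rewritten as
      membership of a pair in the fixed Borel set \<open>{z. fst z \<le> snd z}\<close>, which makes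
      the joint measurability visible.\<close>
    have "(\<lambda>(s, x). ennreal (m + 1) * (?S s * (g (x \<bullet> e) * indicator {z. fst z \<le> snd z} ((norm x)\<^sup>2, s))))
        \<in> borel_measurable (lborel \<Otimes>\<^sub>M lborel)"
      by measurable
    thus "(\<lambda>(s, x). ennreal (m + 1) * (?S s * (g (x \<bullet> e) * indicator {r. r \<le> s} ((norm x)\<^sup>2))))
        \<in> borel_measurable (lborel \<Otimes>\<^sub>M lborel)"
      by (simp add: indicator_def)
  qed
  also have "\<dots> = (\<integral>\<^sup>+s. \<integral>\<^sup>+t. ennreal (m + 1) * (?S s * (g t * indicator {v. v \<le> s} (t\<^sup>2) * ennreal (?c * sqrt (s - t\<^sup>2) ^ k))) \<partial>lborel \<partial>lborel)"
  proof (rule nn_integral_cong)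
    fix s :: real
    show "(\<integral>\<^sup>+x. ennreal (m + 1) * (?S s * (g (x \<bullet> e) * indicator {r. r \<le> s} ((norm x)\<^sup>2))) \<partial>lborel)
        = (\<integral>\<^sup>+t. ennreal (m + 1) * (?S s * (g t * indicator {v. v \<le> s} (t\<^sup>2) * ennreal (?c * sqrt (s - t\<^sup>2) ^ k))) \<partial>lborel)"
    proof (cases "0 \<le> s")
      case True
      have [measurable]: "{r. r \<le> s} \<in> sets borel" by simp
      have 1: "(\<lambda>x. g (x \<bullet> e) * indicator {r. r \<le> s} ((norm x)\<^sup>2)) \<in> borel_measurable lborel"
        by measurable
      have 2: "(\<lambda>t. g t * indicator {v. v \<le> s} (t\<^sup>2) * ennreal (?c * sqrt (s - t\<^sup>2) ^ k)) \<in> borel_measurable lborel"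
        by measurable
      show ?thesis
        using nn_integral_cball_slice[OF e g True]
        unfolding nn_integral_cmult2[OF 1] nn_integral_cmult2[OF 2] by (simp add: indicator_def k_def)
    qed simp
  qed
  also have "\<dots> = (\<integral>\<^sup>+t. \<integral>\<^sup>+s. ennreal (m + 1) * (?S s * (g t * indicator {v. v \<le> s} (t\<^sup>2) * ennreal (?c * sqrt (s - t\<^sup>2) ^ k))) \<partial>lborel \<partial>lborel)"
  proof (rule lborel_pair.Fubini')
    have "(\<lambda>(t, s). ennreal (m + 1) * (?S s * (g t * indicator {z. snd z \<le> fst z} (s, t\<^sup>2) * ennreal (?c * sqrt (s - t\<^sup>2) ^ k))))
        \<in> borel_measurable (lborel \<Otimes>\<^sub>M lborel)"
      by measurable
    thus "(\<lambda>(t, s). ennreal (m + 1) * (?S s * (g t * indicator {v. v \<le> s} (t\<^sup>2) * ennreal (?c * sqrt (s - t\<^sup>2) ^ k))))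
        \<in> borel_measurable (lborel \<Otimes>\<^sub>M lborel)"
      by (simp add: indicator_def)
  qed
  also have "\<dots> = (\<integral>\<^sup>+t. g t * ennreal (real (m + 1) * ?c * beta_const m k *
          ((1 - t\<^sup>2) ^ (m + 1) * sqrt (1 - t\<^sup>2) ^ k)) * indicator {-1..1} t \<partial>lborel)"
  proof (rule nn_integral_cong)
    fix t :: real
    have "(\<integral>\<^sup>+s. ennreal (m + 1) * (?S s * (g t * indicator {v. v \<le> s} (t\<^sup>2) * ennreal (?c * sqrt (s - t\<^sup>2) ^ k))) \<partial>lborel)
        = (\<integral>\<^sup>+s. (ennreal (m + 1) * ennreal ?c * g t) * (ennreal ((1 - s) ^ m * sqrt (s - t\<^sup>2) ^ k) * indicator {t\<^sup>2..1} s) \<partial>lborel)"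
      using c by (intro nn_integral_cong)
        (auto simp: indicator_def mult_ac ennreal_mult intro: order_trans[OF zero_le_power2])
    also have "\<dots> = (ennreal (m + 1) * ennreal ?c * g t) * (\<integral>\<^sup>+s. ennreal ((1 - s) ^ m * sqrt (s - t\<^sup>2) ^ k) * indicator {t\<^sup>2..1} s \<partial>lborel)"
      by (rule nn_integral_cmult) measurable
    also have "\<dots> = g t * ennreal (real (m + 1) * ?c * beta_const m k *
          ((1 - t\<^sup>2) ^ (m + 1) * sqrt (1 - t\<^sup>2) ^ k)) * indicator {-1..1} t"
    proof (cases "t\<^sup>2 \<le> 1")
      case True
      have "ennreal (m + 1) * ennreal ?c * g t * ennreal (beta_const m k * (1 - t\<^sup>2) ^ (m + 1) * sqrt (1 - t\<^sup>2) ^ k)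
          = g t * (ennreal (m + 1) * ennreal ?c * ennreal (beta_const m k * (1 - t\<^sup>2) ^ (m + 1) * sqrt (1 - t\<^sup>2) ^ k))"
        by (simp only: mult_ac)
      also have "ennreal (m + 1) * ennreal ?c * ennreal (beta_const m k * (1 - t\<^sup>2) ^ (m + 1) * sqrt (1 - t\<^sup>2) ^ k)
          = ennreal (real (m + 1) * ?c * (beta_const m k * (1 - t\<^sup>2) ^ (m + 1) * sqrt (1 - t\<^sup>2) ^ k))"
      proof -
        have "0 \<le> beta_const m k * (1 - t\<^sup>2) ^ (m + 1) * sqrt (1 - t\<^sup>2) ^ k"
          using True beta_const_pos[of m k] by (intro mult_nonneg_nonneg zero_le_power) auto
        with c show ?thesis
          by (simp only: ennreal_mult mult_nonneg_nonneg of_nat_0_le_iff)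
      qed
      finally show ?thesis
        unfolding nn_integral_beta_shift[OF zero_le_power2 True] using True sq1[of t] by (simp add: mult_ac)
    next
      case False
      thus ?thesis using sq1[of t] by simp
    qed
    finally show "(\<integral>\<^sup>+s. ennreal (m + 1) * (?S s * (g t * indicator {v. v \<le> s} (t\<^sup>2) * ennreal (?c * sqrt (s - t\<^sup>2) ^ k))) \<partial>lborel)
        = g t * ennreal (real (m + 1) * ?c * beta_const m k *
          ((1 - t\<^sup>2) ^ (m + 1) * sqrt (1 - t\<^sup>2) ^ k)) * indicator {-1..1} t" .
  qed
  finally show ?thesis .
qed

section \<open>Moments and the summing norm\<close>

lemma borel_measurable_linear:
  fixes T :: "'a::euclidean_space \<Rightarrow> 'b::euclidean_space"
  shows "linear T \<Longrightarrow> T \<in> borel_measurable borel"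
  by (intro borel_measurable_continuous_onI linear_continuous_on linear_conv_bounded_linear[THEN iffD1])

lemma integral_ball_measure_orthogonal_transformation:
  fixes f :: "'a::euclidean_space \<Rightarrow> 'a" and g :: "'a \<Rightarrow> real"
  assumes f: "orthogonal_transformation f" and [measurable]: "g \<in> borel_measurable borel"
  shows "(\<integral>x. g (f x) \<partial>ball_measure) = (\<integral>x. g x \<partial>ball_measure)"
proof -
  have [measurable]: "f \<in> borel_measurable borel"
    by (rule borel_measurable_linear[OF orthogonal_transformation_linear[OF f]])
  have "(\<integral>x. g x \<partial>ball_measure) = (\<integral>x. g x \<partial>distr ball_measure borel f)"
    by (simp add: distr_ball_measure_orthogonal_transformation[OF f])
  also have "\<dots> = (\<integral>x. g (f x) \<partial>ball_measure)"
    by (rule integral_distr) measurable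
  finally show ?thesis ..
qed

lemma integrable_ball_measure_bounded:
  fixes f :: "'a::euclidean_space \<Rightarrow> real"
  assumes "f \<in> borel_measurable borel" "\<And>x. norm x \<le> 1 \<Longrightarrow> \<bar>f x\<bar> \<le> B"
  shows "integrable ball_measure f"
proof -
  interpret finite_measure "ball_measure :: 'a measure" by (rule finite_measure_ball_measure)
  have "AE x in ball_measure. norm (f x) \<le> B"
    using AE_ball_measure by eventually_elim (use assms(2) in auto)
  thus ?thesis
    using assms(1) by (intro integrable_const_bound) (auto cong: measurable_cong_sets)
qed

lemma abs_inner_powr_le: "0 \<le> p \<Longrightarrow> norm x \<le> 1 \<Longrightarrow> \<bar>x \<bullet> u\<bar> powr p \<le> norm u powr p"
  using Cauchy_Schwarz_ineq2[of x u] mult_right_mono[of "norm x" 1 "norm u"]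
  by (intro powr_mono2) auto

lemma integrable_abs_inner_powr:
  "0 \<le> p \<Longrightarrow> integrable ball_measure (\<lambda>x::'a::euclidean_space. \<bar>x \<bullet> u\<bar> powr p)"
  by (rule integrable_ball_measure_bounded[where B = "norm u powr p"])
    (measurable, simp add: abs_inner_powr_le)

text \<open>The constant \<kappa>: an unnormalised absolute moment of one coordinate. The type
  argument fixes the dimension, and \<open>undefined\<close> serves as an arbitrary index; by
  rotation invariance every unit vector gives the same value.\<close>

definition abs_moment :: "'n::finite itself \<Rightarrow> real \<Rightarrow> real" where
  "abs_moment _ p = (\<integral>x. \<bar>x \<bullet> axis undefined 1\<bar> powr p \<partial>(ball_measure :: (real^'n) measure))"

text \<open>Some orthogonal \<open>f\<close> maps \<open>norm u *\<^sub>R ?e\<close> to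
  \<open>u\<close>. Replacing \<open>x\<close> by \<open>f x\<close> does not change the integral,
  and \<open>f x \<bullet> u = norm u * (x \<bullet> ?e)\<close> because \<open>f\<close> preserves
  inner products.\<close>

lemma integral_abs_inner_powr:
  fixes u :: "real^'n"
  assumes p: "0 < p"
  shows "(\<integral>x. \<bar>x \<bullet> u\<bar> powr p \<partial>ball_measure) = norm u powr p * abs_moment TYPE('n) p"
proof -
  let ?e = "axis undefined 1 :: real^'n"
  obtain f where f: "orthogonal_transformation f" "f (norm u *\<^sub>R ?e) = u"
    using orthogonal_transformation_exists[of "norm u *\<^sub>R ?e" u] by auto
  have "(\<integral>x. \<bar>x \<bullet> u\<bar> powr p \<partial>ball_measure) = (\<integral>x. \<bar>f x \<bullet> u\<bar> powr p \<partial>ball_measure)"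
    by (rule integral_ball_measure_orthogonal_transformation[OF f(1), symmetric]) measurable
  also have "f x \<bullet> u = norm u * (x \<bullet> ?e)" for x
    using f unfolding orthogonal_transformation_def by (metis inner_scaleR_right)
  hence "(\<integral>x. \<bar>f x \<bullet> u\<bar> powr p \<partial>ball_measure) = (\<integral>x. norm u powr p * \<bar>x \<bullet> ?e\<bar> powr p \<partial>ball_measure)"
    by (simp add: abs_mult powr_mult)
  also have "\<dots> = norm u powr p * abs_moment TYPE('n) p"
    by (simp add: abs_moment_def)
  finally show ?thesis .
qed

text \<open>If the moment vanished, \<open>integral_abs_inner_powr\<close> would force every
  coordinate to vanish almost everywhere, and the ball measure would be concentrated at the
  origin.\<close>

lemma abs_moment_pos:
  assumes p: "0 < p"
  shows "0 < abs_moment TYPE('n::finite) p"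
proof -
  let ?e = "axis undefined 1 :: real^'n"
  have nn: "0 \<le> abs_moment TYPE('n) p"
    unfolding abs_moment_def by simp
  have "abs_moment TYPE('n) p \<noteq> 0"
  proof
    assume 0: "abs_moment TYPE('n) p = 0"
    have "AE x in ball_measure. x \<bullet> u = 0" for u :: "real^'n"
    proof -
      have "(\<integral>x. \<bar>x \<bullet> u\<bar> powr p \<partial>ball_measure) = 0"
        using integral_abs_inner_powr[OF p, of u] 0 by simp
      hence "AE x in ball_measure. \<bar>x \<bullet> u\<bar> powr p = 0"
        using p by (subst (asm) integral_nonneg_eq_0_iff_AE) (auto intro!: integrable_abs_inner_powr)
      thus ?thesis by eventually_elim simp
    qed
    hence "AE x in (ball_measure :: (real^'n) measure). \<forall>b\<in>Basis. x \<bullet> b = 0"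
      by (intro AE_finite_allI) auto
    hence "AE x in (ball_measure :: (real^'n) measure). x = 0"
      by eventually_elim (simp add: euclidean_all_zero_iff)
    hence "emeasure ball_measure (- {0 :: real^'n}) = 0"
      by (subst (asm) AE_iff_measurable[where N = "- {0}"]) auto
    moreover have "emeasure ball_measure ({0 :: real^'n}) = 0"
      by (simp add: emeasure_ball_measure)
    ultimately have "emeasure ball_measure ({0 :: real^'n} \<union> - {0}) = 0"
      by (subst emeasure_Un_null_set) (auto simp: null_sets_def)
    hence "emeasure lborel (cball (0 :: real^'n) 1) = 0"
      by (simp add: emeasure_ball_measure)
    thus False
      using content_cball_pos[of 1 "0 :: real^'n"] by (simp add: measure_def)
  qed
  with nn show ?thesis by simp
qed

text \<open>With B at least 1, the same bound is valid for functionals of norm at most 1, and mesh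
  sizes can be divided by it.\<close>

lemma linear_norm_bound:
  fixes T :: "'a::euclidean_space \<Rightarrow> 'b::euclidean_space"
  assumes "linear T"
  shows "\<exists>B\<ge>1. \<forall>x. norm (T x) \<le> B * norm x"
proof -
  obtain B where B: "\<And>x. norm (T x) \<le> B * norm x"
    using linear_bounded[OF assms] by blast
  have "norm (T x) \<le> max B 1 * norm x" for x
    by (rule order_trans[OF B]) (intro mult_right_mono, auto)
  thus ?thesis by (intro exI[of _ "max B 1"]) auto
qed

lemma integrable_norm_linear_powr:
  fixes T :: "'a::euclidean_space \<Rightarrow> 'b::euclidean_space"
  assumes T: "linear T" and p: "0 \<le> p"
  shows "integrable ball_measure (\<lambda>x. norm (T x) powr p)"
proof -
  have [measurable]: "T \<in> borel_measurable borel" by (rule borel_measurable_linear[OF T])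
  obtain B where B: "1 \<le> B" "\<forall>x. norm (T x) \<le> B * norm x" using linear_norm_bound[OF T] by blast
  show ?thesis
  proof (rule integrable_ball_measure_bounded[where B = "B powr p"])
    fix x :: 'a assume "norm x \<le> 1"
    hence "norm (T x) \<le> B"
      using B mult_left_mono[of "norm x" 1 B] order_trans[of "norm (T x)" "B * norm x" B] by auto
    thus "\<bar>norm (T x) powr p\<bar> \<le> B powr p" using p by (simp add: powr_mono2)
  qed measurable
qed

definition op_moment :: "real \<Rightarrow> ('a::euclidean_space \<Rightarrow> 'b::euclidean_space) \<Rightarrow> real" where
  "op_moment p T = (\<integral>x. norm (T x) powr p \<partial>ball_measure)"

lemma op_moment_nonneg: "0 \<le> op_moment p T"
  unfolding op_moment_def by simp

text \<open>Both sides equal the double integral of \<open>\<bar>T x \<bullet> u\<bar>\<close> to the power \<open>p\<close>, up to the moment.\<close>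

lemma op_moment_adjoint:
  fixes T :: "real^'n \<Rightarrow> real^'n"
  assumes T: "linear T" and p: "0 < p"
  shows "op_moment p (adjoint T) = op_moment p T"
proof -
  let ?\<beta> = "ball_measure :: (real^'n) measure" and ?\<kappa> = "abs_moment TYPE('n) p"
  interpret finite_measure ?\<beta> by (rule finite_measure_ball_measure)
  interpret pair_sigma_finite ?\<beta> ?\<beta> ..
  have T'lin: "linear (adjoint T)" by (rule adjoint_linear[OF T])
  have [measurable]: "T \<in> borel_measurable borel" "adjoint T \<in> borel_measurable borel"
    using T T'lin by (auto intro: borel_measurable_linear)
  have moment: "(\<integral>\<^sup>+x. ennreal (\<bar>x \<bullet> v\<bar> powr p) \<partial>?\<beta>) = ennreal (norm v powr p * ?\<kappa>)" for v :: "real^'n"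
    unfolding integral_abs_inner_powr[OF p, symmetric]
    by (rule nn_integral_eq_integral) (use p in \<open>auto intro: integrable_abs_inner_powr\<close>)
  have \<kappa>: "0 < ?\<kappa>" by (rule abs_moment_pos[OF p])
  have eq: "(\<integral>\<^sup>+x. ennreal (norm (S x) powr p * ?\<kappa>) \<partial>?\<beta>) = ennreal (op_moment p S * ?\<kappa>)"
    if "linear S" for S :: "real^'n \<Rightarrow> real^'n"
    unfolding op_moment_def integral_mult_left_zero[symmetric]
    by (rule nn_integral_eq_integral)
      (use \<kappa> p that in \<open>auto intro!: integrable_norm_linear_powr integrable_mult_left\<close>)
  have "ennreal (op_moment p T * ?\<kappa>) = (\<integral>\<^sup>+x. (\<integral>\<^sup>+u. ennreal (\<bar>u \<bullet> T x\<bar> powr p) \<partial>?\<beta>) \<partial>?\<beta>)"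
    by (simp add: eq[OF T] moment)
  also have "\<dots> = (\<integral>\<^sup>+u. (\<integral>\<^sup>+x. ennreal (\<bar>u \<bullet> T x\<bar> powr p) \<partial>?\<beta>) \<partial>?\<beta>)"
    by (rule Fubini') measurable
  also have "\<dots> = (\<integral>\<^sup>+u. (\<integral>\<^sup>+x. ennreal (\<bar>x \<bullet> adjoint T u\<bar> powr p) \<partial>?\<beta>) \<partial>?\<beta>)"
    by (simp add: adjoint_works[OF T] inner_commute)
  also have "\<dots> = ennreal (op_moment p (adjoint T) * ?\<kappa>)"
    by (simp add: eq[OF T'lin] moment)
  finally have "op_moment p T * ?\<kappa> = op_moment p (adjoint T) * ?\<kappa>"
    using \<kappa> by (subst (asm) ennreal_inj) (auto intro!: mult_nonneg_nonneg op_moment_nonneg)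
  thus ?thesis using \<kappa> by simp
qed

text \<open>The weak l_p norm of the finite family, written exactly as the supremum in
  \<open>summing_const\<close> so that it can be folded there.\<close>

definition weak_sum :: "real \<Rightarrow> nat \<Rightarrow> (nat \<Rightarrow> 'a::real_normed_vector) \<Rightarrow> real" where
  "weak_sum p m x = (SUP \<phi>\<in>{\<phi> :: 'a \<Rightarrow>\<^sub>L real. norm \<phi> \<le> 1}.
     (\<Sum>i<m. \<bar>blinfun_apply \<phi> (x i)\<bar> powr p) powr (1 / p))"

text \<open>A real supremum is informative only over a bounded set; the bound is the strong l_p norm
  of the family.\<close>

lemma weak_sum_bdd_above:
  assumes p: "0 < p"
  shows "bdd_above ((\<lambda>\<phi> :: 'a::real_normed_vector \<Rightarrow>\<^sub>L real.
    (\<Sum>i<m. \<bar>blinfun_apply \<phi> (x i)\<bar> powr p) powr (1 / p)) ` {\<phi>. norm \<phi> \<le> 1})"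
proof (rule bdd_aboveI2)
  fix \<phi> :: "'a \<Rightarrow>\<^sub>L real" assume "\<phi> \<in> {\<phi>. norm \<phi> \<le> 1}"
  hence "\<bar>blinfun_apply \<phi> z\<bar> \<le> norm z" for z
    using norm_blinfun[of \<phi> z] mult_right_mono[of "norm \<phi>" 1 "norm z"] by simp
  thus "(\<Sum>i<m. \<bar>blinfun_apply \<phi> (x i)\<bar> powr p) powr (1 / p) \<le> (\<Sum>i<m. norm (x i) powr p) powr (1 / p)"
    using p by (intro powr_mono2 sum_mono sum_nonneg) auto
qed

lemma sum_functional_le_weak_sum:
  fixes \<phi> :: "'a::real_normed_vector \<Rightarrow>\<^sub>L real"
  assumes p: "0 < p" and "norm \<phi> \<le> 1"
  shows "(\<Sum>i<m. \<bar>blinfun_apply \<phi> (x i)\<bar> powr p) \<le> weak_sum p m x powr p"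
proof -
  have "(\<Sum>i<m. \<bar>blinfun_apply \<phi> (x i)\<bar> powr p) powr (1 / p) \<le> weak_sum p m x"
    unfolding weak_sum_def by (rule cSUP_upper) (use assms weak_sum_bdd_above in auto)
  hence "((\<Sum>i<m. \<bar>blinfun_apply \<phi> (x i)\<bar> powr p) powr (1 / p)) powr p \<le> weak_sum p m x powr p"
    using p by (intro powr_mono2) auto
  thus ?thesis using p by (simp add: powr_powr sum_nonneg)
qed

lemma weak_sum_nonneg: "0 < p \<Longrightarrow> 0 \<le> weak_sum p m (x :: nat \<Rightarrow> 'a::real_normed_vector)"
  unfolding weak_sum_def
  by (rule cSUP_upper2[OF weak_sum_bdd_above, of _ 0]) auto

lemma weak_sum_le:
  fixes x :: "nat \<Rightarrow> 'a::real_normed_vector"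
  assumes "0 < p" "\<And>\<phi> :: 'a \<Rightarrow>\<^sub>L real. norm \<phi> \<le> 1 \<Longrightarrow> (\<Sum>i<m. \<bar>blinfun_apply \<phi> (x i)\<bar> powr p) \<le> c"
  shows "weak_sum p m x powr p \<le> c"
proof -
  have c: "0 \<le> c" using assms(2)[of 0] by (auto intro: order_trans[OF sum_nonneg])
  have "weak_sum p m x \<le> c powr (1 / p)"
    unfolding weak_sum_def
  proof (rule cSUP_least)
    have "(0 :: 'a \<Rightarrow>\<^sub>L real) \<in> {\<phi>. norm \<phi> \<le> 1}" by simp
    thus "{\<phi> :: 'a \<Rightarrow>\<^sub>L real. norm \<phi> \<le> 1} \<noteq> {}" by blast
  qed (use assms in \<open>auto intro!: powr_mono2 sum_nonneg\<close>)
  hence "weak_sum p m x powr p \<le> (c powr (1 / p)) powr p"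
    using assms(1) by (intro powr_mono2 weak_sum_nonneg) auto
  thus ?thesis using assms(1) c by (simp add: powr_powr)
qed

text \<open>Averaging over \<open>u\<close> replaces the norm of \<open>T (x i)\<close> by
  \<open>\<bar>x i \<bullet> adjoint T u\<bar>\<close>. For each \<open>u\<close> this tests the
  family with a functional of norm \<open>norm (adjoint T u)\<close>, which the weak sum controls.
  Integration leaves the moment of the adjoint, equal to that of \<open>T\<close>.\<close>

lemma summing_const_op_moment:
  fixes T :: "real^'n \<Rightarrow> real^'n"
  assumes T: "linear T" and p: "0 < p"
  shows "summing_const p T ((op_moment p T / abs_moment TYPE('n) p) powr (1 / p))"
  unfolding summing_const_def weak_sum_def[symmetric]
proof (intro conjI allI)
  fix m :: nat and x :: "nat \<Rightarrow> real^'n"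
  let ?\<kappa> = "abs_moment TYPE('n) p" and ?W = "weak_sum p m x"
  have \<kappa>: "0 < ?\<kappa>" by (rule abs_moment_pos[OF p])
  have T'lin: "linear (adjoint T)" by (rule adjoint_linear[OF T])
  have "(\<Sum>i<m. norm (T (x i)) powr p) * ?\<kappa> = (\<Sum>i<m. \<integral>u. \<bar>u \<bullet> T (x i)\<bar> powr p \<partial>ball_measure)"
    by (simp add: integral_abs_inner_powr[OF p] sum_distrib_right)
  also have "\<dots> = (\<integral>u. (\<Sum>i<m. \<bar>u \<bullet> T (x i)\<bar> powr p) \<partial>ball_measure)"
    using p by (intro Bochner_Integration.integral_sum[symmetric] integrable_abs_inner_powr) auto
  also have "\<dots> \<le> (\<integral>u. norm (adjoint T u) powr p * ?W powr p \<partial>ball_measure)"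
  proof (rule integral_mono)
    show "integrable ball_measure (\<lambda>u. \<Sum>i<m. \<bar>u \<bullet> T (x i)\<bar> powr p)"
      using p by (intro Bochner_Integration.integrable_sum integrable_abs_inner_powr) auto
    show "integrable ball_measure (\<lambda>u. norm (adjoint T u) powr p * ?W powr p)"
      using p by (intro integrable_mult_left integrable_norm_linear_powr T'lin) auto
    fix u :: "real^'n"
    let ?v = "adjoint T u"
    have uv: "u \<bullet> T z = z \<bullet> ?v" for z
      by (simp add: adjoint_works[OF T] inner_commute)
    show "(\<Sum>i<m. \<bar>u \<bullet> T (x i)\<bar> powr p) \<le> norm ?v powr p * ?W powr p"
    proof (cases "?v = 0")
      case True
      thus ?thesis unfolding uv by simp
    next
      case False
      define \<phi> where "\<phi> = (1 / norm ?v) *\<^sub>R blinfun_inner_right ?v"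
      have \<phi>: "blinfun_apply \<phi> z = (z \<bullet> ?v) / norm ?v" for z
        by (simp add: \<phi>_def blinfun.scaleR_left inner_commute)
      have "norm \<phi> \<le> 1"
        by (rule norm_blinfun_bound)
          (use False Cauchy_Schwarz_ineq2[of _ ?v] in \<open>simp_all add: \<phi> divide_le_eq\<close>)
      have "(\<Sum>i<m. \<bar>u \<bullet> T (x i)\<bar> powr p) = norm ?v powr p * (\<Sum>i<m. \<bar>blinfun_apply \<phi> (x i)\<bar> powr p)"
        unfolding sum_distrib_left using False
        by (intro sum.cong) (simp_all add: uv \<phi> powr_divide)
      also have "\<dots> \<le> norm ?v powr p * ?W powr p"
        by (intro mult_left_mono sum_functional_le_weak_sum p \<open>norm \<phi> \<le> 1\<close>) simp
      finally show ?thesis .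
    qed
  qed
  also have "\<dots> = op_moment p T * ?W powr p"
    by (simp add: op_moment_def[symmetric] op_moment_adjoint[OF T p])
  finally have "(\<Sum>i<m. norm (T (x i)) powr p) \<le> op_moment p T / ?\<kappa> * ?W powr p"
    using \<kappa> by (simp add: field_simps)
  hence "(\<Sum>i<m. norm (T (x i)) powr p) powr (1 / p) \<le> (op_moment p T / ?\<kappa> * ?W powr p) powr (1 / p)"
    using p by (intro powr_mono2 sum_nonneg) auto
  also have "\<dots> = (op_moment p T / ?\<kappa>) powr (1 / p) * ?W"
    using p \<kappa> weak_sum_nonneg[OF p, of m x] op_moment_nonneg[of p T]
    by (subst powr_mult) (auto simp: powr_powr)
  finally show "(\<Sum>i<m. norm (T (x i)) powr p) powr (1 / p) \<le> (op_moment p T / ?\<kappa>) powr (1 / p) * ?W" .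
qed simp

text \<open>The Riesz vector is the adjoint applied to 1; testing the functional on this vector
  gives the norm bound.\<close>

lemma blinfun_apply_eq_inner:
  fixes \<phi> :: "'a::euclidean_space \<Rightarrow>\<^sub>L real"
  obtains v where "norm v \<le> norm \<phi>" "\<And>x. blinfun_apply \<phi> x = x \<bullet> v"
proof
  let ?v = "adjoint (blinfun_apply \<phi>) 1"
  have lin: "linear (blinfun_apply \<phi>)"
    using blinfun.bounded_linear_right bounded_linear.linear by blast
  show v: "blinfun_apply \<phi> x = x \<bullet> ?v" for x
    using adjoint_works[OF lin, of x 1] by simp
  have "norm ?v * norm ?v = blinfun_apply \<phi> ?v"
    by (simp add: v power2_norm_eq_inner flip: power2_eq_square)
  also have "\<dots> \<le> norm \<phi> * norm ?v"
    using norm_blinfun[of \<phi> ?v] by simp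
  finally show "norm ?v \<le> norm \<phi>"
    by (cases "?v = 0") auto
qed

text \<open>The summing inequality is applied to a discretised ball, with points weighted by the
  masses of their cells. Both sides then approximate integrals over the ball: the left one gives
  \<open>op_moment p T\<close>, and each functional on the right gives at most \<kappa>.\<close>

lemma op_moment_le_summing_const:
  fixes T :: "real^'n \<Rightarrow> real^'n"
  assumes T: "linear T" and p: "0 < p" and C: "summing_const p T C"
  shows "op_moment p T \<le> C powr p * abs_moment TYPE('n) p"
proof (rule field_le_epsilon)
  fix e :: real assume e: "0 < e"
  let ?\<beta> = "ball_measure :: (real^'n) measure" and ?\<kappa> = "abs_moment TYPE('n) p"
  interpret finite_measure ?\<beta> by (rule finite_measure_ball_measure)
  define V where "V = measure ?\<beta> (space ?\<beta>)"
  have V: "0 \<le> V" by (simp add: V_def)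
  \<comment> \<open>The discretisation error is \<open>e' * V\<close> for \<open>T\<close> and
    \<open>C powr p * (e' * V)\<close> for the functionals; 1 is added to \<open>V\<close> and to
    \<open>C powr p\<close> to keep the denominator positive.\<close>
  define e' where "e' = e / ((1 + C powr p) * (V + 1))"
  have den: "0 < (1 + C powr p) * (V + 1)"
    using V by (intro mult_pos_pos) (auto intro: add_pos_nonneg)
  have e': "0 < e'" using e den by (simp add: e'_def)
  obtain B where B: "1 \<le> B" "\<And>x. norm (T x) \<le> B * norm x" using linear_norm_bound[OF T] by blast
  obtain d where d: "0 < d" and dd: "\<And>r s. 0 \<le> r \<Longrightarrow> r \<le> B \<Longrightarrow> 0 \<le> s \<Longrightarrow> s \<le> B \<Longrightarrow> \<bar>r - s\<bar> < d \<Longrightarrow> \<bar>r powr p - s powr p\<bar> < e'"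
    using powr_uniformly_continuous[OF p e', of B] by (metis atLeastAtMost_iff)
  have dB: "0 < d / B" using d B by simp
  obtain m :: nat and A x where "\<forall>i<m. A i \<in> sets (borel :: (real^'n) measure)" and A2: "disjoint_family_on A {..<m}"
    "(\<Union>i<m. A i) = cball 0 1" and "\<forall>i<m. x i \<in> cball 0 1" "\<forall>i<m. \<forall>y\<in>A i. dist y (x i) < d / B"
    using compact_fine_partition[OF compact_cball _ dB, of "0 :: real^'n" 1] by auto
  hence A: "\<And>i. i < m \<Longrightarrow> A i \<in> sets borel" "\<And>i. i < m \<Longrightarrow> norm (x i) \<le> 1"
    "\<And>i y. i < m \<Longrightarrow> y \<in> A i \<Longrightarrow> dist y (x i) < d / B"
    by auto
  have AK: "norm y \<le> 1" if "i < m" "y \<in> A i" for i y using A2(2) that by auto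
  \<comment> \<open>One partition serves all linear maps bounded by \<open>B\<close>. The error is
    thus uniform in the functional, and the supremum in \<open>weak_sum\<close> can be taken
    afterwards.\<close>
  have approx: "\<bar>(\<integral>y. norm (L y) powr p \<partial>?\<beta>) - (\<Sum>i<m. measure ?\<beta> (A i) * norm (L (x i)) powr p)\<bar> \<le> e' * V"
    if L: "linear L" and LB: "\<And>y. norm (L y) \<le> B * norm y" for L :: "real^'n \<Rightarrow> 'b::euclidean_space"
    unfolding V_def
  proof (rule integral_partition_approx[OF finite_measure_axioms _ A2(1)])
    show "AE y in ?\<beta>. y \<in> (\<Union>i<m. A i)" using AE_ball_measure A2(2) by simp
    show "integrable ?\<beta> (\<lambda>y. norm (L y) powr p)"
      using p by (intro integrable_norm_linear_powr L) simp
    fix i y assume iy: "i < m" "y \<in> A i"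
    have b: "norm (L z) \<le> B" if "norm z \<le> 1" for z
    proof -
      have "B * norm z \<le> B * 1" using that B(1) by (intro mult_left_mono) auto
      with LB[of z] show ?thesis by simp
    qed
    have "\<bar>norm (L y) - norm (L (x i))\<bar> \<le> norm (L (y - x i))"
      by (simp add: linear_diff[OF L] norm_triangle_ineq3)
    also have "\<dots> \<le> B * norm (y - x i)" by (rule LB)
    also have "\<dots> < B * (d / B)"
      using A(3)[OF iy] B(1) by (intro mult_strict_left_mono) (auto simp: dist_norm)
    also have "\<dots> = d" using B(1) by simp
    finally show "\<bar>norm (L y) powr p - norm (L (x i)) powr p\<bar> \<le> e'"
      using AK[OF iy] A(2)[OF iy(1)] b by (intro order.strict_implies_order[OF dd]) auto
  qed (use A in auto)
  \<comment> \<open>Scaling by the p-th root of the cell mass multiplies the p-th power of the norm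
    of every linear image by that mass.\<close>
  define x' where "x' i = measure ?\<beta> (A i) powr (1 / p) *\<^sub>R x i" for i
  have x': "norm (L (x' i)) powr p = measure ?\<beta> (A i) * norm (L (x i)) powr p" if "linear L" for L :: "real^'n \<Rightarrow> 'b::euclidean_space" and i
    using p by (simp add: x'_def linear_cmul[OF that] powr_mult powr_powr)
  have weak: "weak_sum p m x' powr p \<le> ?\<kappa> + e' * V"
  proof (rule weak_sum_le[OF p])
    fix \<phi> :: "(real^'n) \<Rightarrow>\<^sub>L real" assume \<phi>: "norm \<phi> \<le> 1"
    have lin: "linear (blinfun_apply \<phi>)"
      using blinfun.bounded_linear_right bounded_linear.linear by blast
    obtain v where v: "norm v \<le> norm \<phi>" "\<And>x. blinfun_apply \<phi> x = x \<bullet> v"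
      using blinfun_apply_eq_inner by blast
    have "norm (blinfun_apply \<phi> y) \<le> B * norm y" for y
      using norm_blinfun[of \<phi> y] \<phi> B(1) mult_right_mono[of "norm \<phi>" B "norm y"] by simp
    from approx[OF lin this]
    have "(\<Sum>i<m. measure ?\<beta> (A i) * norm (blinfun_apply \<phi> (x i)) powr p) \<le> (\<integral>y. norm (blinfun_apply \<phi> y) powr p \<partial>?\<beta>) + e' * V"
      by linarith
    also have "(\<integral>y. norm (blinfun_apply \<phi> y) powr p \<partial>?\<beta>) = norm v powr p * ?\<kappa>"
      by (simp add: v integral_abs_inner_powr[OF p])
    also have "\<dots> \<le> 1 * ?\<kappa>"
      using v(1) \<phi> p abs_moment_pos[OF p, where 'n = 'n]
      by (intro mult_right_mono) (auto intro!: powr_le1)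
    finally show "(\<Sum>i<m. \<bar>blinfun_apply \<phi> (x' i)\<bar> powr p) \<le> ?\<kappa> + e' * V"
      using x'[OF lin] by simp
  qed
  have "op_moment p T \<le> (\<Sum>i<m. norm (T (x' i)) powr p) + e' * V"
    unfolding x'[OF T] op_moment_def using approx[OF T B(2)] by linarith
  also have "(\<Sum>i<m. norm (T (x' i)) powr p) = ((\<Sum>i<m. norm (T (x' i)) powr p) powr (1 / p)) powr p"
    using p by (simp add: powr_powr sum_nonneg)
  also have "\<dots> \<le> (C * weak_sum p m x') powr p"
    using C p unfolding summing_const_def weak_sum_def by (intro powr_mono2) auto
  also have "\<dots> = C powr p * weak_sum p m x' powr p"
    using C weak_sum_nonneg[OF p, of m x'] by (simp add: powr_mult summing_const_def)
  also have "\<dots> \<le> C powr p * (?\<kappa> + e' * V)"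
    by (intro mult_left_mono weak) simp
  finally have "op_moment p T \<le> C powr p * ?\<kappa> + e' * ((1 + C powr p) * V)"
    by (simp add: algebra_simps)
  also have "e' * ((1 + C powr p) * V) \<le> e' * ((1 + C powr p) * (V + 1))"
    using e' by (intro mult_left_mono) auto
  also have "\<dots> = e"
    unfolding e'_def by (rule nonzero_eq_divide_eq[THEN iffD1, OF _ refl]) (use den in linarith)
  finally show "op_moment p T \<le> C powr p * ?\<kappa> + e" by simp
qed

text \<open>The constant is admissible and lies below every admissible one, so the infimum is
  attained at it.\<close>

lemma summing_norm_powr:
  fixes T :: "real^'n \<Rightarrow> real^'n"
  assumes T: "linear T" and p: "0 < p"
  shows "summing_norm p T powr p = op_moment p T / abs_moment TYPE('n) p"
proof -
  let ?\<kappa> = "abs_moment TYPE('n) p"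
  let ?C0 = "(op_moment p T / ?\<kappa>) powr (1 / p)"
  have \<kappa>: "0 < ?\<kappa>" by (rule abs_moment_pos[OF p])
  have "summing_norm p T = ?C0"
    unfolding summing_norm_def
  proof (rule cInf_eq_minimum)
    show "?C0 \<in> {C. summing_const p T C}" using summing_const_op_moment[OF T p] by simp
    fix C assume "C \<in> {C. summing_const p T C}"
    hence C: "summing_const p T C" by simp
    have "op_moment p T / ?\<kappa> \<le> C powr p"
      using op_moment_le_summing_const[OF T p C] \<kappa> by (simp add: divide_le_eq)
    hence "?C0 \<le> (C powr p) powr (1 / p)"
      using p \<kappa> op_moment_nonneg[of p T] by (intro powr_mono2) auto
    thus "?C0 \<le> C" using p C by (simp add: powr_powr summing_const_def)
  qed
  thus ?thesis using p \<kappa> op_moment_nonneg[of p T] by (simp add: powr_powr)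
qed

section \<open>Upper estimate for linear images of the ball\<close>

lemma discrete_energy_linear_image_le:
  fixes T :: "real^'n \<Rightarrow> real^'n"
  assumes T: "linear T" and p: "0 < p"
    and x: "\<And>i. i < m \<Longrightarrow> x i \<in> T ` cball 0 1" and a: "(\<Sum>i<m. a i) = 1"
  shows "ereal (discrete_energy p m a x)
    \<le> max_energy p {-1..1::real} * ereal (op_moment p T / abs_moment TYPE('n) p)"
proof -
  let ?\<kappa> = "abs_moment TYPE('n) p" and ?M = "max_energy p {-1..1::real}"
  have \<kappa>: "0 < ?\<kappa>" by (rule abs_moment_pos[OF p])
  have T'lin: "linear (adjoint T)" by (rule adjoint_linear[OF T])
  obtain y where y: "\<And>i. i < m \<Longrightarrow> norm (y i) \<le> 1 \<and> x i = T (y i)"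
  proof -
    have "\<forall>i. \<exists>y. i < m \<longrightarrow> norm y \<le> 1 \<and> x i = T y" using x by fastforce
    thus ?thesis using that by metis
  qed
  \<comment> \<open>\<open>\<Phi> u\<close> is the energy of the points projected to the direction
    \<open>u\<close>. In terms of the preimages \<open>y i\<close>, the projections are inner
    products with \<open>adjoint T u\<close>, hence points of a segment of half-length
    \<open>norm (adjoint T u)\<close>.\<close>
  define \<Phi> where "\<Phi> u = (\<Sum>j<m. a j * (\<Sum>i<m. a i * \<bar>u \<bullet> (x i - x j)\<bar> powr p))" for u
  have int: "integrable ball_measure \<Phi>"
    unfolding \<Phi>_def using p
    by (intro Bochner_Integration.integrable_sum integrable_mult_right integrable_abs_inner_powr) auto
  have E: "discrete_energy p m a x * ?\<kappa> = (\<integral>u. \<Phi> u \<partial>ball_measure)"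
  proof -
    have "(\<integral>u. \<Phi> u \<partial>ball_measure) = (\<Sum>j<m. a j * (\<Sum>i<m. a i * (\<integral>u. \<bar>u \<bullet> (x i - x j)\<bar> powr p \<partial>ball_measure)))"
      unfolding \<Phi>_def using p
      by (subst Bochner_Integration.integral_sum, intro integrable_mult_right
          Bochner_Integration.integrable_sum integrable_abs_inner_powr, simp,
          intro sum.cong refl, simp, subst Bochner_Integration.integral_sum,
          intro integrable_mult_right integrable_abs_inner_powr) auto
    also have "\<dots> = discrete_energy p m a x * ?\<kappa>"
      by (simp add: integral_abs_inner_powr[OF p] discrete_energy_def dist_norm sum_distrib_right mult.assoc)
    finally show ?thesis ..
  qed
  have \<Phi>: "ereal (\<Phi> u) \<le> ?M * ereal (norm (adjoint T u) powr p)"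
    and \<Phi>0: "adjoint T u = 0 \<Longrightarrow> \<Phi> u = 0" for u
  proof -
    let ?v = "adjoint T u"
    have uv: "u \<bullet> (x i - x j) = (y i - y j) \<bullet> ?v" if "i < m" "j < m" for i j
      using y[OF that(1)] y[OF that(2)] adjoint_works[OF T, of "y i - y j" u]
      by (simp add: linear_diff[OF T] inner_commute)
    have 0: "\<Phi> u = (\<Sum>j<m. a j * (\<Sum>i<m. a i * \<bar>(y i - y j) \<bullet> ?v\<bar> powr p))"
      unfolding \<Phi>_def by (intro sum.cong refl arg_cong2[where f = "(*)"]) (simp add: uv)
    show Z: "\<Phi> u = 0" if "?v = 0" unfolding 0 using that by simp
    show "ereal (\<Phi> u) \<le> ?M * ereal (norm ?v powr p)"
    proof (cases "?v = 0")
      case True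
      thus ?thesis using Z by (simp add: zero_ereal_def[symmetric])
    next
      case False
      define t where "t i = (y i \<bullet> ?v) / norm ?v" for i
      have "\<bar>(y i - y j) \<bullet> ?v\<bar> powr p = norm ?v powr p * dist (t i) (t j) powr p" for i j
      proof -
        have "\<bar>(y i - y j) \<bullet> ?v\<bar> = norm ?v * dist (t i) (t j)"
          using False by (simp add: t_def dist_real_def inner_diff_left flip: diff_divide_distrib)
        thus ?thesis by (simp add: powr_mult)
      qed
      hence eq: "\<Phi> u = discrete_energy p m a t * norm ?v powr p"
        unfolding 0 discrete_energy_def by (simp add: sum_distrib_left sum_distrib_right mult_ac)
      have "t i \<in> {-1..1}" if "i < m" for i
      proof -
        have "\<bar>y i \<bullet> ?v\<bar> \<le> norm (y i) * norm ?v" by (rule Cauchy_Schwarz_ineq2)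
        also have "\<dots> \<le> 1 * norm ?v" using y[OF that] by (intro mult_right_mono) auto
        finally have "\<bar>t i\<bar> \<le> 1" using False by (simp add: t_def)
        thus ?thesis by (simp add: abs_le_iff)
      qed
      hence "ereal (discrete_energy p m a t) \<le> ?M"
        by (intro discrete_energy_le_max_energy a p) auto
      hence "ereal (discrete_energy p m a t) * ereal (norm ?v powr p) \<le> ?M * ereal (norm ?v powr p)"
        by (intro ereal_mult_right_mono) auto
      thus ?thesis unfolding eq by simp
    qed
  qed
  have nonneg: "0 \<le> ?M"
    using discrete_energy_le_max_energy[of "{-1..1::real}" 1 "\<lambda>_. 0" "\<lambda>_. 1" p] p
    by (simp add: discrete_energy_def zero_ereal_def[symmetric])
  show ?thesis
  \<comment> \<open>The pointwise bound can only be integrated if \<open>?M\<close> is finite. If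
    the moment vanishes, the right side is 0 even for infinite \<open>?M\<close>, and the claim
    rests on \<open>\<Phi>\<close> being 0 almost everywhere. Otherwise an infinite
    \<open>?M\<close> makes the right side infinite.\<close>
  proof (cases "op_moment p T = 0")
    case True
    hence "(\<integral>u. norm (adjoint T u) powr p \<partial>ball_measure) = 0"
      using op_moment_adjoint[OF T p] by (simp add: op_moment_def)
    hence "AE u in ball_measure. norm (adjoint T u) powr p = 0"
      using p by (subst (asm) integral_nonneg_eq_0_iff_AE) (auto intro!: integrable_norm_linear_powr T'lin)
    hence "AE u in ball_measure. \<Phi> u = 0"
      by eventually_elim (use \<Phi>0 in auto)
    hence "(\<integral>u. \<Phi> u \<partial>ball_measure) = 0"
      by (subst integral_cong_AE[where g = "\<lambda>_. 0"]) (use int in auto)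
    with E \<kappa> True show ?thesis by (simp add: zero_ereal_def[symmetric])
  next
    case False
    hence pos: "0 < op_moment p T / ?\<kappa>"
      using op_moment_nonneg[of p T] \<kappa> by simp
    show ?thesis
    proof (cases ?M)
      case (real r)
      have "(\<integral>u. \<Phi> u \<partial>ball_measure) \<le> (\<integral>u. r * norm (adjoint T u) powr p \<partial>ball_measure)"
      proof (rule integral_mono[OF int])
        show "integrable ball_measure (\<lambda>u. r * norm (adjoint T u) powr p)"
          using p by (intro integrable_mult_right integrable_norm_linear_powr T'lin) auto
        show "\<Phi> u \<le> r * norm (adjoint T u) powr p" for u
          using \<Phi>[of u] real by simp
      qed
      also have "\<dots> = r * op_moment p T"
        by (simp add: op_moment_adjoint[OF T p] flip: op_moment_def)
      finally show ?thesis
        unfolding E[symmetric] using \<kappa> real by (simp add: field_simps)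
    next
      case PInf
      have "\<infinity> * ereal (op_moment p T / ?\<kappa>) = \<infinity>"
        unfolding times_ereal.simps using pos by (auto simp del: divide_eq_0_iff)
      thus ?thesis using PInf by simp
    next
      case MInf
      thus ?thesis using nonneg by simp
    qed
  qed
qed

section \<open>A positive definite kernel\<close>

text \<open>Integrand of a formula of Levy-Khintchine type, which writes |t|^p up to a constant as a
  mixture of the functions 1 - cos (t s) with mixing density s^(-1-p) on s > 0.\<close>

definition cos_kernel :: "real \<Rightarrow> real \<Rightarrow> real \<Rightarrow> real" where
  "cos_kernel p t s = (1 - cos (t * s)) * (s powr (-1 - p) * indicator {0<..} s)"

lemma borel_measurable_cos_kernel [measurable]: "cos_kernel p t \<in> borel_measurable borel"
  unfolding cos_kernel_def[abs_def] by measurable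

lemma cos_kernel_nonneg: "0 \<le> cos_kernel p t s"
  by (simp add: cos_kernel_def)

lemma one_minus_cos_le: "1 - cos x \<le> x\<^sup>2 / 2" for x :: real
proof -
  have "1 - cos x = 2 * (sin (x / 2))\<^sup>2"
    using cos_double_sin[of "x / 2"] by simp
  also have "(sin (x / 2))\<^sup>2 \<le> (x / 2)\<^sup>2"
    using abs_sin_x_le_abs_x[of "x / 2"] by (simp only: abs_le_square_iff)
  finally show ?thesis by (simp add: power_divide)
qed

lemma integrable_lborel_of_nonneg_integrable_on:
  fixes f :: "real \<Rightarrow> real"
  assumes "f integrable_on S" "\<And>x. x \<in> S \<Longrightarrow> 0 \<le> f x" "f \<in> borel_measurable borel" "S \<in> sets borel"
  shows "integrable lborel (\<lambda>x. indicator S x * f x)"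
proof -
  have "f absolutely_integrable_on S"
    using assms by (intro nonnegative_absolutely_integrable_1)
  thus ?thesis
    using assms(3,4) by (simp add: set_integrable_def integrable_completion)
qed

text \<open>Near 0 the bound 1 - cos x \<le> x^2 / 2 leaves a multiple of s^(1-p), integrable
  because p < 2. Beyond 1 the bound 2 s^(-1-p) is integrable because p > 0.\<close>

lemma integrable_cos_kernel:
  assumes p: "0 < p" "p < 2"
  shows "integrable lborel (cos_kernel p t)"
proof (rule Bochner_Integration.integrable_bound)
  let ?g = "\<lambda>s. t\<^sup>2 / 2 * (indicator {0..1} s * s powr (1 - p)) + 2 * (indicator {1..} s * s powr (-1 - p))"
  show "integrable lborel ?g"
    using p by (intro Bochner_Integration.integrable_add integrable_mult_right
        integrable_lborel_of_nonneg_integrable_on integrable_on_powr_from_0 has_integral_integrable[OF has_integral_powr_to_inf]) auto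
  show "AE s in lborel. norm (cos_kernel p t s) \<le> norm (?g s)"
  proof (intro AE_I2)
    fix s :: real
    have g: "0 \<le> ?g s" by (simp add: indicator_def)
    have "cos_kernel p t s \<le> ?g s"
    proof -
      consider "s \<le> 0" | "0 < s" "s \<le> 1" | "1 < s" by linarith
      thus ?thesis
      proof cases
        case 1
        thus ?thesis using g by (simp add: cos_kernel_def)
      next
        case 2
        have "cos_kernel p t s \<le> (t * s)\<^sup>2 / 2 * s powr (-1 - p)"
          using 2 one_minus_cos_le[of "t * s"] unfolding cos_kernel_def by (intro mult_mono) auto
        also have "(t * s)\<^sup>2 / 2 * s powr (-1 - p) = t\<^sup>2 / 2 * (s powr 2 * s powr (-1 - p))"
          using 2 by (simp add: power_mult_distrib powr_realpow[of s 2, simplified])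
        also have "s powr 2 * s powr (-1 - p) = s powr (1 - p)"
          by (simp flip: powr_add)
        also have "t\<^sup>2 / 2 * s powr (1 - p) \<le> ?g s"
          using 2 by (simp add: indicator_def)
        finally show ?thesis .
      next
        case 3
        have "cos_kernel p t s \<le> 2 * s powr (-1 - p)"
          using 3 cos_ge_minus_one[of "t * s"] unfolding cos_kernel_def
          by (intro mult_mono) (auto simp: indicator_def)
        also have "\<dots> \<le> ?g s" using 3 by (simp add: indicator_def)
        finally show ?thesis .
      qed
    qed
    thus "norm (cos_kernel p t s) \<le> norm (?g s)"
      using g cos_kernel_nonneg[of p t s] by simp
  qed
qed measurable

text \<open>Rescaling s by |t| turns the kernel for 1 into the one for t. The mixing density
  contributes |t|^(-1-p) and the line element |t|, which leaves homogeneity of degree p.\<close>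

lemma integral_cos_kernel:
  assumes p: "0 < p"
  shows "(\<integral>s. cos_kernel p t s \<partial>lborel) = \<bar>t\<bar> powr p * (\<integral>s. cos_kernel p 1 s \<partial>lborel)"
proof (cases "t = 0")
  case True
  thus ?thesis by (simp add: cos_kernel_def)
next
  case False
  let ?c = "\<bar>t\<bar>"
  have c: "0 < ?c" using False by simp
  have "(\<integral>s. cos_kernel p 1 s \<partial>lborel) = ?c * (\<integral>s. cos_kernel p 1 (0 + ?c * s) \<partial>lborel)"
    using c lborel_integral_real_affine[of ?c "cos_kernel p 1" 0] by simp
  also have "cos_kernel p 1 (0 + ?c * s) = ?c powr (-1 - p) * cos_kernel p t s" for s
  proof (cases "0 < s")
    case True
    have "cos (?c * s) = cos (t * s)" by (simp add: abs_if)
    thus ?thesis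
      using True c by (simp add: cos_kernel_def powr_mult indicator_def zero_less_mult_iff)
  next
    case False
    hence "\<not> 0 < ?c * s" using c by (simp add: zero_less_mult_iff)
    thus ?thesis using False by (simp add: cos_kernel_def)
  qed
  hence "(\<integral>s. cos_kernel p 1 (0 + ?c * s) \<partial>lborel) = ?c powr (-1 - p) * (\<integral>s. cos_kernel p t s \<partial>lborel)"
    by simp
  finally have "?c powr p * (\<integral>s. cos_kernel p 1 s \<partial>lborel)
      = (?c powr p * ?c powr 1 * ?c powr (-1 - p)) * (\<integral>s. cos_kernel p t s \<partial>lborel)"
    using c by simp
  also have "?c powr p * ?c powr 1 * ?c powr (-1 - p) = ?c powr (p + 1 + (-1 - p))"
    by (simp only: powr_add)
  also have "\<dots> = 1" using c by simp
  finally show ?thesis by simp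
qed

lemma integral_cos_kernel_pos:
  assumes p: "0 < p" "p < 2"
  shows "0 < (\<integral>s. cos_kernel p 1 s \<partial>lborel)"
proof -
  have "(\<integral>s. cos_kernel p 1 s \<partial>lborel) \<noteq> 0"
  proof
    assume "(\<integral>s. cos_kernel p 1 s \<partial>lborel) = 0"
    hence "AE s in lborel. cos_kernel p 1 s = 0"
      using integrable_cos_kernel[OF p]
      by (subst (asm) integral_nonneg_eq_0_iff_AE) (auto simp: cos_kernel_nonneg)
    hence "AE s in lborel. \<not> (0 < s \<and> s < (1::real))"
    proof eventually_elim
      case (elim s)
      show ?case
      proof
        assume s: "0 < s \<and> s < 1"
        have "cos s < cos 0" using s pi_gt3 by (intro cos_monotone_0_pi) auto
        with s elim show False by (simp add: cos_kernel_def)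
      qed
    qed
    hence "emeasure lborel {s::real. 0 < s \<and> s < 1} = 0"
      by (subst (asm) AE_iff_measurable[OF _ refl]) auto
    moreover have "{s::real. 0 < s \<and> s < 1} = {0<..<1}" by auto
    ultimately show False by simp
  qed
  moreover have "0 \<le> (\<integral>s. cos_kernel p 1 s \<partial>lborel)"
    by (intro integral_nonneg_AE AE_I2 cos_kernel_nonneg)
  ultimately show ?thesis by simp
qed

text \<open>Since \<open>\<bar>t\<bar>\<close> to the power \<open>p\<close> is a positive multiple of the integral of \<open>1 - cos (t s)\<close> against
  \<open>s\<close> to the power \<open>-1 - p\<close>, the difference of the two sides is the integral of
  \<open>2 (\<Sum>i. b i sin (t i s))\<^sup>2\<close>.\<close>

lemma sum_abs_diff_powr_le_sum_abs_add_powr: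
  fixes b t :: "nat \<Rightarrow> real"
  assumes p: "0 < p" "p < 2"
  shows "(\<Sum>j<m. b j * (\<Sum>i<m. b i * \<bar>t i - t j\<bar> powr p)) \<le> (\<Sum>j<m. b j * (\<Sum>i<m. b i * \<bar>t i + t j\<bar> powr p))"
proof -
  define C where "C = (\<integral>s. cos_kernel p 1 s \<partial>lborel)"
  have C: "0 < C" unfolding C_def by (rule integral_cos_kernel_pos[OF p])
  define w where "w s = s powr (-1 - p) * indicator {0<..} s" for s :: real
  have K: "(\<integral>s. cos_kernel p z s \<partial>lborel) = \<bar>z\<bar> powr p * C" for z
    unfolding C_def by (rule integral_cos_kernel[OF p(1)])
  have int1: "integrable lborel (\<lambda>s. (\<Sum>i<m. b i * cos_kernel p (f i) s))" for f
    by (intro integrable_mult_right Bochner_Integration.integrable_sum integrable_cos_kernel p)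
  have rep1: "(\<integral>s. (\<Sum>i<m. b i * cos_kernel p (f i) s) \<partial>lborel) = (\<Sum>i<m. b i * (\<bar>f i\<bar> powr p * C))" for f
  proof -
    have "(\<integral>s. (\<Sum>i<m. b i * cos_kernel p (f i) s) \<partial>lborel) = (\<Sum>i<m. \<integral>s. b i * cos_kernel p (f i) s \<partial>lborel)"
      by (intro Bochner_Integration.integral_sum integrable_mult_right integrable_cos_kernel p)
    thus ?thesis by (simp add: K)
  qed
  have rep: "(\<integral>s. (\<Sum>j<m. b j * (\<Sum>i<m. b i * cos_kernel p (f i j) s)) \<partial>lborel)
      = C * (\<Sum>j<m. b j * (\<Sum>i<m. b i * \<bar>f i j\<bar> powr p))" for f
  proof -
    have "(\<integral>s. (\<Sum>j<m. b j * (\<Sum>i<m. b i * cos_kernel p (f i j) s)) \<partial>lborel)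
        = (\<Sum>j<m. \<integral>s. b j * (\<Sum>i<m. b i * cos_kernel p (f i j) s) \<partial>lborel)"
      by (intro Bochner_Integration.integral_sum integrable_mult_right int1)
    also have "\<dots> = (\<Sum>j<m. b j * (\<Sum>i<m. b i * (\<bar>f i j\<bar> powr p * C)))"
      by (simp add: rep1)
    also have "\<dots> = C * (\<Sum>j<m. b j * (\<Sum>i<m. b i * \<bar>f i j\<bar> powr p))"
      unfolding sum_distrib_left by (intro sum.cong refl) (simp only: mult_ac)
    finally show ?thesis .
  qed
  have int: "integrable lborel (\<lambda>s. (\<Sum>j<m. b j * (\<Sum>i<m. b i * cos_kernel p (f i j) s)))" for f
    by (intro integrable_mult_right Bochner_Integration.integrable_sum integrable_cos_kernel p)
  have "C * (\<Sum>j<m. b j * (\<Sum>i<m. b i * \<bar>t i - t j\<bar> powr p))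
      = (\<integral>s. (\<Sum>j<m. b j * (\<Sum>i<m. b i * cos_kernel p (t i - t j) s)) \<partial>lborel)"
    by (rule rep[symmetric])
  also have "\<dots> \<le> (\<integral>s. (\<Sum>j<m. b j * (\<Sum>i<m. b i * cos_kernel p (t i + t j) s)) \<partial>lborel)"
  proof (rule integral_mono[OF int int])
    fix s :: real
    have "(\<Sum>j<m. b j * (\<Sum>i<m. b i * cos_kernel p (t i + t j) s)) - (\<Sum>j<m. b j * (\<Sum>i<m. b i * cos_kernel p (t i - t j) s))
        = (\<Sum>j<m. \<Sum>i<m. b j * (b i * (cos_kernel p (t i + t j) s - cos_kernel p (t i - t j) s)))"
      by (simp add: sum_distrib_left sum_subtractf right_diff_distrib)
    \<comment> \<open>By the addition formulas, cos ((t i - t j) s) - cos ((t i + t j) s) = 2 sin (t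
      i s) sin (t j s). This is a product, so the double sum factors into a square.\<close>
    also have "\<dots> = (\<Sum>j<m. \<Sum>i<m. (2 * w s) * ((b j * sin (t j * s)) * (b i * sin (t i * s))))"
      by (intro sum.cong refl)
        (simp add: cos_kernel_def w_def cos_add cos_diff distrib_right left_diff_distrib algebra_simps)
    also have "\<dots> = (2 * w s) * ((\<Sum>j<m. b j * sin (t j * s)) * (\<Sum>i<m. b i * sin (t i * s)))"
      unfolding sum_product by (simp add: sum_distrib_left)
    also have "\<dots> \<ge> 0"
      by (rule mult_nonneg_nonneg) (simp_all add: w_def)
    finally show "(\<Sum>j<m. b j * (\<Sum>i<m. b i * cos_kernel p (t i - t j) s)) \<le> (\<Sum>j<m. b j * (\<Sum>i<m. b i * cos_kernel p (t i + t j) s))"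
      by simp
  qed
  also have "\<dots> = C * (\<Sum>j<m. b j * (\<Sum>i<m. b i * \<bar>t i + t j\<bar> powr p))"
    by (rule rep)
  finally show ?thesis using C by simp
qed

section \<open>Peaked marginals of radial densities\<close>

text \<open>Up to a constant, the marginal of the density \<open>1 - (norm x)\<^sup>2\<close> on the
  ball of dimension \<open>k + 1\<close>. Multiplied by powers of 1 - t^2 it gives the marginals of
  the higher powers.\<close>

definition weight :: "nat \<Rightarrow> real \<Rightarrow> real" where
  "weight k t = indicator {-1..1} t * ((1 - t\<^sup>2) * sqrt (1 - t\<^sup>2) ^ k)"

lemma borel_measurable_weight [measurable]: "weight k \<in> borel_measurable borel"
  unfolding weight_def[abs_def] by measurable

lemma weight_nonneg: "0 \<le> weight k t"
  by (auto simp: weight_def indicator_def abs_square_le_1 abs_le_iff)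

lemma weight_le_indicator: "weight k t \<le> indicator {-1..1} t"
proof (cases "t \<in> {-1..1}")
  case True
  hence "t\<^sup>2 \<le> 1" by (simp add: abs_square_le_1 abs_le_iff)
  hence "(1 - t\<^sup>2) * sqrt (1 - t\<^sup>2) ^ k \<le> 1 * 1"
    by (intro mult_mono power_le_one) auto
  thus ?thesis using True by (simp add: weight_def)
qed (simp add: weight_def)

lemma weight_uminus: "weight k (- t) = weight k t"
  by (auto simp: weight_def indicator_def)

lemma integrable_weight_mult:
  assumes [measurable]: "f \<in> borel_measurable borel" and B: "\<And>t. t \<in> {-1..1} \<Longrightarrow> \<bar>f t\<bar> \<le> B"
  shows "integrable lborel (\<lambda>t. f t * weight k t)"
proof (rule Bochner_Integration.integrable_bound)
  show "integrable lborel (\<lambda>t. B * indicator {-1..1::real} t)"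
    by (intro integrable_mult_right integrable_real_indicator) auto
  show "AE t in lborel. norm (f t * weight k t) \<le> norm (B * indicator {-1..1} t)"
  proof (intro AE_I2)
    fix t :: real
    show "norm (f t * weight k t) \<le> norm (B * indicator {-1..1} t)"
    proof (cases "t \<in> {-1..1}")
      case True
      hence "\<bar>f t\<bar> * weight k t \<le> B * 1"
        using B[OF True] weight_nonneg weight_le_indicator[of k t] by (intro mult_mono) auto
      thus ?thesis using True weight_nonneg[of k t] B[OF True] by (simp add: abs_mult)
    qed (simp add: weight_def)
  qed
qed measurable

text \<open>Applied to indicators, the formula for nonnegative functions identifies two measures on
  the line, and so extends to real-valued \<open>g\<close>. A rotation taking the basis vector to
  \<open>u\<close> then covers every direction.\<close>

lemma integral_ball_measure_power_marginal:
  fixes u :: "real^'n" and g :: "real \<Rightarrow> real"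
  assumes u: "norm u = 1" and [measurable]: "g \<in> borel_measurable borel"
  defines "k \<equiv> DIM(real^'n) - 1"
  shows "(\<integral>x. g (x \<bullet> u) * (1 - (norm x)\<^sup>2) ^ (m + 1) \<partial>ball_measure)
    = real (m + 1) * unit_ball_vol (real k) * beta_const m k * (\<integral>t. g t * (weight k t * (1 - t\<^sup>2) ^ m) \<partial>lborel)"
proof -
  let ?e = "axis undefined 1 :: real^'n"
  let ?\<beta> = "ball_measure :: (real^'n) measure"
  have e: "?e \<in> Basis" by simp
  define C where "C = real (m + 1) * unit_ball_vol (real k) * beta_const m k"
  have C: "0 \<le> C"
    unfolding C_def using beta_const_pos[of m k] by (intro mult_nonneg_nonneg) (auto simp: unit_ball_vol_def)
  have nn: "0 \<le> weight k t * (1 - t\<^sup>2) ^ m" for t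
    using weight_nonneg[of k t] by (cases "t \<in> {-1..1}") (auto simp: weight_def abs_square_le_1 abs_le_iff)
  define P where "P = distr (density ?\<beta> (\<lambda>x. ennreal ((1 - (norm x)\<^sup>2) ^ (m + 1)))) borel (\<lambda>x. x \<bullet> ?e)"
  define Q where "Q = density lborel (\<lambda>t. ennreal (C * (weight k t * (1 - t\<^sup>2) ^ m)))"
  have "P = Q"
  proof (rule measure_eqI)
    show "sets P = sets Q" by (simp add: P_def Q_def)
    fix A assume "A \<in> sets P"
    hence A[measurable]: "A \<in> sets borel" by (simp add: P_def)
    have "emeasure P A = (\<integral>\<^sup>+t. indicator A t \<partial>P)"
      by (rule nn_integral_indicator[symmetric]) (simp add: P_def)
    also have "\<dots> = (\<integral>\<^sup>+x. indicator A (x \<bullet> ?e) \<partial>density ?\<beta> (\<lambda>x. ennreal ((1 - (norm x)\<^sup>2) ^ (m + 1))))"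
      unfolding P_def by (rule nn_integral_distr) measurable
    also have "\<dots> = (\<integral>\<^sup>+x. ennreal ((1 - (norm x)\<^sup>2) ^ (m + 1)) * indicator A (x \<bullet> ?e) \<partial>?\<beta>)"
      by (rule nn_integral_density) measurable
    also have "\<dots> = (\<integral>\<^sup>+x. indicator A (x \<bullet> ?e) * ennreal ((1 - (norm x)\<^sup>2) ^ (m + 1)) \<partial>?\<beta>)"
      by (simp only: mult.commute)
    also have "\<dots> = (\<integral>\<^sup>+t. indicator A t * ennreal (C * ((1 - t\<^sup>2) ^ (m + 1) * sqrt (1 - t\<^sup>2) ^ k)) * indicator {-1..1} t \<partial>lborel)"
      unfolding C_def k_def by (rule nn_integral_ball_measure_marginal[OF e]) measurable
    also have "\<dots> = (\<integral>\<^sup>+t. ennreal (C * (weight k t * (1 - t\<^sup>2) ^ m)) * indicator A t \<partial>lborel)"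
      by (intro nn_integral_cong) (auto simp: weight_def indicator_def mult_ac)
    also have "\<dots> = emeasure Q A"
      unfolding Q_def by (subst emeasure_density) auto
    finally show "emeasure P A = emeasure Q A" .
  qed
  hence PQ: "(\<integral>t. g t \<partial>P) = (\<integral>t. g t \<partial>Q)" by simp
  have AEnn: "AE x in ?\<beta>. 0 \<le> (1 - (norm x)\<^sup>2) ^ (m + 1)"
    using AE_ball_measure by eventually_elim (simp add: abs_square_le_1)
  have "(\<integral>t. g t \<partial>P) = (\<integral>x. (1 - (norm x)\<^sup>2) ^ (m + 1) * g (x \<bullet> ?e) \<partial>?\<beta>)"
    unfolding P_def using AEnn by (subst integral_distr) (auto simp: integral_density)
  moreover have "(\<integral>t. g t \<partial>Q) = (\<integral>t. (C * (weight k t * (1 - t\<^sup>2) ^ m)) * g t \<partial>lborel)"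
    unfolding Q_def using C nn by (subst integral_density) auto
  moreover have "\<dots> = C * (\<integral>t. g t * (weight k t * (1 - t\<^sup>2) ^ m) \<partial>lborel)"
    unfolding integral_mult_right_zero[symmetric] by (intro Bochner_Integration.integral_cong) auto
  ultimately have eq: "(\<integral>x. g (x \<bullet> ?e) * (1 - (norm x)\<^sup>2) ^ (m + 1) \<partial>?\<beta>)
      = C * (\<integral>t. g t * (weight k t * (1 - t\<^sup>2) ^ m) \<partial>lborel)"
    using PQ by (simp add: mult.commute)
  obtain f where f: "orthogonal_transformation f" "f ?e = u"
    using orthogonal_transformation_exists_1[of ?e u] u by auto
  have "(\<integral>x. g (x \<bullet> u) * (1 - (norm x)\<^sup>2) ^ (m + 1) \<partial>?\<beta>)
      = (\<integral>x. g (f x \<bullet> u) * (1 - (norm (f x))\<^sup>2) ^ (m + 1) \<partial>?\<beta>)"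
    by (rule integral_ball_measure_orthogonal_transformation[OF f(1), symmetric]) measurable
  also have "f x \<bullet> u = x \<bullet> ?e" for x
    using f unfolding orthogonal_transformation_def by metis
  hence "(\<integral>x. g (f x \<bullet> u) * (1 - (norm (f x))\<^sup>2) ^ (m + 1) \<partial>?\<beta>)
      = (\<integral>x. g (x \<bullet> ?e) * (1 - (norm x)\<^sup>2) ^ (m + 1) \<partial>?\<beta>)"
    by (simp add: orthogonal_transformation_norm[OF f(1)])
  finally show ?thesis using eq by (simp add: C_def)
qed

text \<open>Taking marginals is diagonal in powers: \<open>(1 - (norm x)\<^sup>2) ^ (i + 1)\<close>
  goes to \<open>C i\<close> times \<open>weight\<close> times (1 - t^2)^i. Hence each coefficient
  of \<open>q\<close> is divided by \<open>C i\<close>. As \<open>H\<close> is radial, one and the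
  same \<open>H\<close> serves all directions \<open>u\<close>.\<close>

lemma radial_density_of_polynomial:
  fixes q :: "real poly"
  defines "k \<equiv> DIM(real^'n) - 1"
  shows "\<exists>H :: real^'n \<Rightarrow> real. H \<in> borel_measurable borel \<and> (\<exists>B. \<forall>x. norm x \<le> 1 \<longrightarrow> \<bar>H x\<bar> \<le> B) \<and>
    (\<forall>u g. norm u = 1 \<longrightarrow> g \<in> borel_measurable borel \<longrightarrow> (\<exists>B. \<forall>t\<in>{-1..1}. \<bar>g t\<bar> \<le> B) \<longrightarrow>
      (\<integral>x. g (x \<bullet> u) * H x \<partial>ball_measure) = (\<integral>t. g t * (weight k t * poly q (1 - t\<^sup>2)) \<partial>lborel))"
proof -
  define C where "C m = real (m + 1) * unit_ball_vol (real k) * beta_const m k" for m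
  have C: "C m \<noteq> 0" for m
  proof -
    have "0 < unit_ball_vol (real k)" by simp
    thus ?thesis unfolding C_def using beta_const_pos[of m k] by (simp del: unit_ball_vol_pos)
  qed
  define H where "H x = (\<Sum>i\<le>degree q. coeff q i / C i * (1 - (norm x)\<^sup>2) ^ (i + 1))" for x :: "real^'n"
  have pw: "\<bar>(1 - (norm x)\<^sup>2) ^ i\<bar> \<le> 1" if "norm x \<le> 1" for x :: "real^'n" and i
    using that by (simp add: power_abs abs_square_le_1 power_le_one)
  have Hm: "H \<in> borel_measurable borel" unfolding H_def by measurable
  have Hb: "\<bar>H x\<bar> \<le> (\<Sum>i\<le>degree q. \<bar>coeff q i / C i\<bar>)" if "norm x \<le> 1" for x
  proof -
    have "\<bar>c * (1 - (norm x)\<^sup>2) ^ i\<bar> \<le> \<bar>c\<bar>" for c i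
      using mult_left_le[OF pw[OF that] abs_ge_zero] by (simp only: abs_mult)
    thus ?thesis unfolding H_def by (intro order_trans[OF sum_abs] sum_mono)
  qed
  have "(\<integral>x. g (x \<bullet> u) * H x \<partial>ball_measure) = (\<integral>t. g t * (weight k t * poly q (1 - t\<^sup>2)) \<partial>lborel)"
    if u: "norm u = 1" and g[measurable]: "g \<in> borel_measurable borel" and B: "\<forall>t\<in>{-1..1}. \<bar>g t\<bar> \<le> B" for u g B
  proof -
    have gu: "\<bar>g (x \<bullet> u)\<bar> \<le> B" if "norm x \<le> 1" for x
    proof -
      have "\<bar>x \<bullet> u\<bar> \<le> 1" using Cauchy_Schwarz_ineq2[of x u] that u by simp
      thus ?thesis using B by (simp add: abs_le_iff)
    qed
    have int1: "integrable ball_measure (\<lambda>x. g (x \<bullet> u) * (1 - (norm x)\<^sup>2) ^ i)" for i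
    proof (rule integrable_ball_measure_bounded[where B = "B * 1"])
      show "\<bar>g (x \<bullet> u) * (1 - (norm x)\<^sup>2) ^ i\<bar> \<le> B * 1" if "norm x \<le> 1" for x
        unfolding abs_mult using gu[OF that] pw[OF that, of i] by (intro mult_mono) auto
    qed measurable
    have int2: "integrable lborel (\<lambda>t. (g t * (1 - t\<^sup>2) ^ i) * weight k t)" for i
    proof (rule integrable_weight_mult[where B = "B * 1"])
      show "\<bar>g t * (1 - t\<^sup>2) ^ i\<bar> \<le> B * 1" if "t \<in> {-1..1}" for t
      proof -
        have "t\<^sup>2 \<le> 1" using that by (simp add: abs_square_le_1 abs_le_iff)
        hence "\<bar>(1 - t\<^sup>2) ^ i\<bar> \<le> 1" by (simp add: power_abs power_le_one)
        thus ?thesis unfolding abs_mult using B that by (intro mult_mono) auto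
      qed
    qed measurable
    have "(\<integral>x. g (x \<bullet> u) * H x \<partial>ball_measure)
        = (\<integral>x. (\<Sum>i\<le>degree q. coeff q i / C i * (g (x \<bullet> u) * (1 - (norm x)\<^sup>2) ^ (i + 1))) \<partial>ball_measure)"
      unfolding H_def by (simp add: sum_distrib_left mult_ac)
    also have "\<dots> = (\<Sum>i\<le>degree q. \<integral>x. coeff q i / C i * (g (x \<bullet> u) * (1 - (norm x)\<^sup>2) ^ (i + 1)) \<partial>ball_measure)"
      by (intro Bochner_Integration.integral_sum integrable_mult_right int1)
    also have "\<dots> = (\<Sum>i\<le>degree q. coeff q i / C i * (C i * (\<integral>t. g t * (weight k t * (1 - t\<^sup>2) ^ i) \<partial>lborel)))"
      by (simp only: integral_mult_right_zero C_def k_def integral_ball_measure_power_marginal[OF u g])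
    also have "\<dots> = (\<Sum>i\<le>degree q. \<integral>t. coeff q i * ((g t * (1 - t\<^sup>2) ^ i) * weight k t) \<partial>lborel)"
    proof (rule sum.cong[OF refl])
      fix i
      have "(\<integral>t. g t * (weight k t * (1 - t\<^sup>2) ^ i) \<partial>lborel) = (\<integral>t. (g t * (1 - t\<^sup>2) ^ i) * weight k t \<partial>lborel)"
        by (simp only: mult_ac)
      thus "coeff q i / C i * (C i * (\<integral>t. g t * (weight k t * (1 - t\<^sup>2) ^ i) \<partial>lborel))
          = (\<integral>t. coeff q i * ((g t * (1 - t\<^sup>2) ^ i) * weight k t) \<partial>lborel)"
        using C[of i] by (simp only: integral_mult_right_zero) simp
    qed
    also have "\<dots> = (\<integral>t. (\<Sum>i\<le>degree q. coeff q i * ((g t * (1 - t\<^sup>2) ^ i) * weight k t)) \<partial>lborel)"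
      by (intro Bochner_Integration.integral_sum[symmetric] integrable_mult_right int2)
    also have "\<dots> = (\<integral>t. g t * (weight k t * poly q (1 - t\<^sup>2)) \<partial>lborel)"
      by (simp add: poly_altdef sum_distrib_left mult_ac)
    finally show ?thesis .
  qed
  with Hm Hb show ?thesis by blast
qed

text \<open>Normalising integral of a Landau kernel in the variable t^2. On [-1,1] the base lies
  between 0 and 1 and equals 1 exactly where t^2 = s^2. It is a polynomial in 1 - t^2, as lifting to
  the ball demands.\<close>

definition peak_mass :: "nat \<Rightarrow> real \<Rightarrow> nat \<Rightarrow> real" where
  "peak_mass k s N = (\<integral>t. (1 - (t\<^sup>2 - s\<^sup>2)\<^sup>2) ^ N * weight k t \<partial>lborel)"

text \<open>As \<open>N\<close> grows, this even probability density concentrates at \<open>s\<close> and \<open>- s\<close>.\<close>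

definition peak :: "nat \<Rightarrow> real \<Rightarrow> nat \<Rightarrow> real \<Rightarrow> real" where
  "peak k s N t = (1 - (t\<^sup>2 - s\<^sup>2)\<^sup>2) ^ N / peak_mass k s N * weight k t"

lemma borel_measurable_peak [measurable]: "peak k s N \<in> borel_measurable borel"
  unfolding peak_def[abs_def] by measurable

lemma sq_diff_bounds:
  fixes s t :: real
  assumes "s \<in> {-1..1}" "t \<in> {-1..1}"
  shows "0 \<le> 1 - (t\<^sup>2 - s\<^sup>2)\<^sup>2" "1 - (t\<^sup>2 - s\<^sup>2)\<^sup>2 \<le> 1"
proof -
  have "t\<^sup>2 \<le> 1" "s\<^sup>2 \<le> 1" using assms by (auto simp: abs_square_le_1 abs_le_iff)
  hence "\<bar>t\<^sup>2 - s\<^sup>2\<bar> \<le> 1" using zero_le_power2[of t] zero_le_power2[of s] by linarith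
  thus "0 \<le> 1 - (t\<^sup>2 - s\<^sup>2)\<^sup>2" "1 - (t\<^sup>2 - s\<^sup>2)\<^sup>2 \<le> 1" by (simp_all add: abs_square_le_1)
qed

lemma integrable_peak_integrand:
  assumes s: "s \<in> {-1..1}"
  shows "integrable lborel (\<lambda>t. (1 - (t\<^sup>2 - s\<^sup>2)\<^sup>2) ^ N * weight k t)"
proof (rule integrable_weight_mult[where B = 1])
  fix t :: real assume t: "t \<in> {-1..1}"
  show "\<bar>(1 - (t\<^sup>2 - s\<^sup>2)\<^sup>2) ^ N\<bar> \<le> 1"
    using sq_diff_bounds[OF s t] by (simp add: power_abs power_le_one)
qed measurable

lemma weight_eq_0: "t \<notin> {-1..1} \<Longrightarrow> weight k t = 0"
  by (simp add: weight_def)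

text \<open>The weight vanishes at the ends of the interval, so for s = 1 or s = -1 positivity has
  to come from interior points near s.\<close>

lemma integral_weight_near_pos:
  assumes s: "s \<in> {-1..1}" and d: "0 < d" "d \<le> 1"
  shows "0 < (\<integral>t. indicator {t. \<bar>t\<^sup>2 - s\<^sup>2\<bar> < d} t * weight k t \<partial>lborel)"
proof -
  let ?f = "\<lambda>t. indicator {t. \<bar>t\<^sup>2 - s\<^sup>2\<bar> < d} t * weight k t"
  define S where "S = {t::real. -1 < t \<and> t < 1 \<and> \<bar>t\<^sup>2 - s\<^sup>2\<bar> < d}"
  have S[measurable]: "{t. \<bar>t\<^sup>2 - s\<^sup>2\<bar> < d} \<in> sets borel" by measurable
  have int: "integrable lborel ?f"
    by (rule integrable_weight_mult[OF borel_measurable_indicator[OF S], where B = 1]) (simp add: indicator_def)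
  have nn: "0 \<le> ?f t" for t using weight_nonneg[of k t] by simp
  have "open S"
    unfolding S_def by (intro open_Collect_conj open_Collect_less continuous_intros)
  \<comment> \<open>Shrinking by the factor 1 - d/4 moves \<open>s\<close> into the open interval
    and lowers its square by s^2 (d/2 - d^2/16), which is less than d.\<close>
  moreover have "s * (1 - d / 4) \<in> S"
  proof -
    have "\<bar>s * (1 - d / 4)\<bar> = \<bar>s\<bar> * (1 - d / 4)" using d by (simp add: abs_mult)
    also have "\<dots> \<le> 1 * (1 - d / 4)" using s d by (intro mult_right_mono) (auto simp: abs_le_iff)
    also have "\<dots> < 1" using d by simp
    finally have 1: "\<bar>s * (1 - d / 4)\<bar> < 1" .
    have s2: "s\<^sup>2 \<le> 1" using s by (simp add: abs_square_le_1 abs_le_iff)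
    have "(s * (1 - d / 4))\<^sup>2 - s\<^sup>2 = - (s\<^sup>2 * (d / 2 - d\<^sup>2 / 16))"
      by (simp add: power2_eq_square algebra_simps)
    moreover have "0 \<le> d / 2 - d\<^sup>2 / 16" "d / 2 - d\<^sup>2 / 16 < d"
      using d mult_left_le[of d d] zero_less_power[OF d(1), of 2] unfolding power2_eq_square by linarith+
    moreover from this have "s\<^sup>2 * (d / 2 - d\<^sup>2 / 16) \<le> 1 * (d / 2 - d\<^sup>2 / 16)"
      using s2 by (intro mult_right_mono)
    ultimately have "\<bar>(s * (1 - d / 4))\<^sup>2 - s\<^sup>2\<bar> < d" by simp
    with 1 show ?thesis unfolding S_def by auto
  qed
  ultimately obtain r where r: "0 < r" "ball (s * (1 - d / 4)) r \<subseteq> S"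
    by (meson openE)
  have "(\<integral>t. ?f t \<partial>lborel) \<noteq> 0"
  proof
    assume "(\<integral>t. ?f t \<partial>lborel) = 0"
    hence "AE t in lborel. ?f t = 0"
      using int nn by (subst (asm) integral_nonneg_eq_0_iff_AE) auto
    hence "AE t in lborel. t \<notin> ball (s * (1 - d / 4)) r"
    proof eventually_elim
      case (elim t)
      show ?case
      proof
        assume "t \<in> ball (s * (1 - d / 4)) r"
        hence t: "-1 < t" "t < 1" "\<bar>t\<^sup>2 - s\<^sup>2\<bar> < d" using r by (auto simp: S_def)
        hence "t\<^sup>2 < 1" by (simp add: abs_square_less_1)
        hence "0 < weight k t" using t by (simp add: weight_def)
        with elim t show False by simp
      qed
    qed
    hence "emeasure lborel (ball (s * (1 - d / 4)) r) = 0"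
      by (subst (asm) AE_iff_measurable[where N = "ball (s * (1 - d / 4)) r"]) auto
    thus False using content_ball_pos[OF r(1), of "s * (1 - d / 4)"] by (simp add: measure_def)
  qed
  moreover have "0 \<le> (\<integral>t. ?f t \<partial>lborel)" by (intro integral_nonneg_AE AE_I2 nn)
  ultimately show ?thesis by simp
qed

text \<open>The integral is restricted to the points with |t^2 - s^2| < d, where the base of the
  power is at least 1 - d^2.\<close>

lemma peak_mass_ge:
  assumes s: "s \<in> {-1..1}" and d: "0 < d" "d \<le> 1"
  shows "(1 - d\<^sup>2) ^ N * (\<integral>t. indicator {t. \<bar>t\<^sup>2 - s\<^sup>2\<bar> < d} t * weight k t \<partial>lborel) \<le> peak_mass k s N"
  unfolding peak_mass_def integral_mult_right_zero[symmetric]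
proof (rule integral_mono)
  have S[measurable]: "{t. \<bar>t\<^sup>2 - s\<^sup>2\<bar> < d} \<in> sets borel" by measurable
  show "integrable lborel (\<lambda>t. (1 - d\<^sup>2) ^ N * (indicator {t. \<bar>t\<^sup>2 - s\<^sup>2\<bar> < d} t * weight k t))"
    by (intro integrable_mult_right integrable_weight_mult[OF borel_measurable_indicator[OF S], where B = 1]) (simp add: indicator_def)
  show "integrable lborel (\<lambda>t. (1 - (t\<^sup>2 - s\<^sup>2)\<^sup>2) ^ N * weight k t)"
    by (rule integrable_peak_integrand[OF s])
  have d1: "0 \<le> 1 - d\<^sup>2" using d by (simp add: abs_square_le_1)
  show "(1 - d\<^sup>2) ^ N * (indicator {t. \<bar>t\<^sup>2 - s\<^sup>2\<bar> < d} t * weight k t) \<le> (1 - (t\<^sup>2 - s\<^sup>2)\<^sup>2) ^ N * weight k t" for t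
  proof (cases "t \<in> {-1..1}")
    case True
    show ?thesis
    proof (cases "\<bar>t\<^sup>2 - s\<^sup>2\<bar> < d")
      case near: True
      have "(t\<^sup>2 - s\<^sup>2)\<^sup>2 \<le> d\<^sup>2" using near d by (simp flip: abs_le_square_iff)
      thus ?thesis
        using near d1 weight_nonneg[of k t] by (simp add: mult_right_mono power_mono)
    next
      case False
      thus ?thesis
        using sq_diff_bounds[OF s True] weight_nonneg[of k t] by simp
    qed
  qed (simp add: weight_eq_0)
qed

lemma peak_mass_pos:
  assumes s: "s \<in> {-1..1}"
  shows "0 < peak_mass k s N"
proof -
  have "0 < (1 - (1 / 2 :: real)\<^sup>2) ^ N * (\<integral>t. indicator {t. \<bar>t\<^sup>2 - s\<^sup>2\<bar> < 1 / 2} t * weight k t \<partial>lborel)"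
    by (intro mult_pos_pos zero_less_power integral_weight_near_pos[OF s]) (simp_all add: power2_eq_square)
  also have "\<dots> \<le> peak_mass k s N" by (rule peak_mass_ge[OF s]) auto
  finally show ?thesis .
qed

lemma peak_nonneg: "s \<in> {-1..1} \<Longrightarrow> 0 \<le> peak k s N t"
  using peak_mass_pos[of s k N] sq_diff_bounds[of s t] weight_nonneg[of k t]
  by (cases "t \<in> {-1..1}") (auto simp: peak_def weight_eq_0)

lemma peak_uminus: "peak k s N (- t) = peak k s N t"
  by (simp add: peak_def weight_uminus)

lemma integral_peak: "s \<in> {-1..1} \<Longrightarrow> (\<integral>t. peak k s N t \<partial>lborel) = 1"
  using peak_mass_pos[of s k N] by (simp add: peak_def peak_mass_def)

lemma integrable_mult_peak:
  assumes s: "s \<in> {-1..1}" and [measurable]: "f \<in> borel_measurable borel"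
    and B: "\<And>t. t \<in> {-1..1} \<Longrightarrow> \<bar>f t\<bar> \<le> B"
  shows "integrable lborel (\<lambda>t. f t * peak k s N t)"
proof -
  have "integrable lborel (\<lambda>t. (f t * ((1 - (t\<^sup>2 - s\<^sup>2)\<^sup>2) ^ N / peak_mass k s N)) * weight k t)"
  proof (rule integrable_weight_mult[where B = "B * (1 / peak_mass k s N)"])
    fix t :: real assume t: "t \<in> {-1..1}"
    show "\<bar>f t * ((1 - (t\<^sup>2 - s\<^sup>2)\<^sup>2) ^ N / peak_mass k s N)\<bar> \<le> B * (1 / peak_mass k s N)"
      unfolding abs_mult using B[OF t] sq_diff_bounds[OF s t] peak_mass_pos[OF s, of k N]
      by (intro mult_mono) (auto simp: power_abs power_le_one divide_right_mono)
  qed measurable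
  thus ?thesis by (simp add: peak_def mult.assoc)
qed

lemma peak_eq_polynomial: "\<exists>q. \<forall>t. peak k s N t = weight k t * poly q (1 - t\<^sup>2)"
proof -
  \<comment> \<open>At x = 1 - t^2 the linear polynomial takes the value (1 - s^2) - x = t^2 -
    s^2.\<close>
  let ?q = "smult (1 / peak_mass k s N) ((1 - [:1 - s\<^sup>2, -1:]\<^sup>2) ^ N)"
  have "peak k s N t = weight k t * poly ?q (1 - t\<^sup>2)" for t
    by (simp add: peak_def poly_power)
  thus ?thesis by blast
qed

text \<open>Where |t^2 - s^2| is at least d, the power in the numerator is at most (1 - d^2)^N,
  while the normaliser, bounded below over the points closer than d/2, is at least a positive
  multiple of (1 - d^2/4)^N. The quotient decays geometrically.\<close>

lemma peak_tail_tendsto_0: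
  assumes s: "s \<in> {-1..1}" and d: "0 < d" "d \<le> 1"
  shows "(\<lambda>N. \<integral>t. indicator {t. d \<le> \<bar>t\<^sup>2 - s\<^sup>2\<bar>} t * peak k s N t \<partial>lborel) \<longlonglongrightarrow> 0"
proof -
  define w0 where "w0 = (\<integral>t. indicator {t. \<bar>t\<^sup>2 - s\<^sup>2\<bar> < d / 2} t * weight k t \<partial>lborel)"
  have w0: "0 < w0" unfolding w0_def using d by (intro integral_weight_near_pos[OF s]) auto
  define W where "W = (\<integral>t. 1 * weight k t \<partial>lborel)"
  define \<rho> where "\<rho> = (1 - d\<^sup>2) / (1 - (d / 2)\<^sup>2)"
  have d2: "0 < d\<^sup>2" "d\<^sup>2 \<le> 1" using d by (auto simp: abs_square_le_1)
  have den: "0 < 1 - (d / 2)\<^sup>2" using d2 by (simp add: power_divide)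
  have \<rho>: "0 \<le> \<rho>" "\<rho> < 1" using d2 den by (simp_all add: \<rho>_def power_divide)
  have intw: "integrable lborel (\<lambda>t. 1 * weight k t)"
    by (rule integrable_weight_mult[where B = 1]) auto
  have up: "(\<integral>t. indicator {t. d \<le> \<bar>t\<^sup>2 - s\<^sup>2\<bar>} t * peak k s N t \<partial>lborel) \<le> W / w0 * \<rho> ^ N" for N
  proof -
    have S[measurable]: "{t. d \<le> \<bar>t\<^sup>2 - s\<^sup>2\<bar>} \<in> sets borel" by measurable
    have Z: "0 < peak_mass k s N" by (rule peak_mass_pos[OF s])
    have "(\<integral>t. indicator {t. d \<le> \<bar>t\<^sup>2 - s\<^sup>2\<bar>} t * peak k s N t \<partial>lborel)
        \<le> (\<integral>t. (1 - d\<^sup>2) ^ N / peak_mass k s N * (1 * weight k t) \<partial>lborel)"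
    proof (rule integral_mono)
      show "integrable lborel (\<lambda>t. indicator {t. d \<le> \<bar>t\<^sup>2 - s\<^sup>2\<bar>} t * peak k s N t)"
        by (rule integrable_mult_peak[OF s borel_measurable_indicator[OF S], where B = 1]) (simp add: indicator_def)
      show "integrable lborel (\<lambda>t. (1 - d\<^sup>2) ^ N / peak_mass k s N * (1 * weight k t))"
        by (intro integrable_mult_right intw)
      fix t :: real
      show "indicator {t. d \<le> \<bar>t\<^sup>2 - s\<^sup>2\<bar>} t * peak k s N t \<le> (1 - d\<^sup>2) ^ N / peak_mass k s N * (1 * weight k t)"
      proof (cases "t \<in> {-1..1} \<and> d \<le> \<bar>t\<^sup>2 - s\<^sup>2\<bar>")
        case True
        have "d\<^sup>2 \<le> (t\<^sup>2 - s\<^sup>2)\<^sup>2" using True d by (simp flip: abs_le_square_iff)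
        hence "(1 - (t\<^sup>2 - s\<^sup>2)\<^sup>2) ^ N \<le> (1 - d\<^sup>2) ^ N"
          using sq_diff_bounds[OF s, of t] True by (intro power_mono) auto
        thus ?thesis
          using True Z weight_nonneg[of k t] by (simp add: peak_def mult_right_mono divide_right_mono)
      next
        case False
        thus ?thesis
          using Z d2 weight_nonneg[of k t] by (auto simp: peak_def weight_eq_0)
      qed
    qed
    also have "\<dots> = (1 - d\<^sup>2) ^ N * W / peak_mass k s N"
      unfolding W_def by (simp only: integral_mult_right_zero) simp
    also have "\<dots> \<le> (1 - d\<^sup>2) ^ N * W / ((1 - (d / 2)\<^sup>2) ^ N * w0)"
    proof (rule divide_left_mono)
      show "(1 - (d / 2)\<^sup>2) ^ N * w0 \<le> peak_mass k s N"
        unfolding w0_def using d by (intro peak_mass_ge[OF s]) auto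
      show "0 \<le> (1 - d\<^sup>2) ^ N * W"
        using d2 by (intro mult_nonneg_nonneg) (auto simp: W_def intro!: integral_nonneg_AE weight_nonneg)
      show "0 < peak_mass k s N * ((1 - (d / 2)\<^sup>2) ^ N * w0)"
        using Z den w0 by simp
    qed
    also have "\<dots> = W / w0 * \<rho> ^ N" by (simp add: \<rho>_def power_divide mult.commute)
    finally show ?thesis .
  qed
  have "(\<lambda>N. W / w0 * \<rho> ^ N) \<longlonglongrightarrow> W / w0 * 0"
    using \<rho> by (intro tendsto_mult_left LIMSEQ_power_zero) auto
  hence lim: "(\<lambda>N. W / w0 * \<rho> ^ N) \<longlonglongrightarrow> 0" by simp
  show ?thesis
  proof (rule tendsto_sandwich[OF _ _ tendsto_const lim])
    show "\<forall>\<^sub>F N in sequentially. 0 \<le> (\<integral>t. indicator {t. d \<le> \<bar>t\<^sup>2 - s\<^sup>2\<bar>} t * peak k s N t \<partial>lborel)"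
      by (intro always_eventually allI integral_nonneg_AE AE_I2 mult_nonneg_nonneg peak_nonneg[OF s]) auto
  qed (use up in auto)
qed

text \<open>A peak is even, so it only sees the even part of \<open>f\<close>. Where t^2 is close to
  s^2 this part deviates by at most \<open>e\<close> from its value at \<open>s\<close>; elsewhere
  the deviation is at most \<open>2 * B\<close> and is weighted by the tail mass.\<close>

lemma integral_mult_peak_approx:
  assumes s: "s \<in> {-1..1}" and f[measurable]: "f \<in> borel_measurable borel"
    and B: "\<And>t. t \<in> {-1..1} \<Longrightarrow> \<bar>f t\<bar> \<le> B"
    and osc: "\<And>t. t \<in> {-1..1} \<Longrightarrow> \<bar>t\<^sup>2 - s\<^sup>2\<bar> < d \<Longrightarrow> \<bar>(f t + f (- t)) / 2 - (f s + f (- s)) / 2\<bar> \<le> e"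
    and e: "0 \<le> e"
  shows "\<bar>(\<integral>t. f t * peak k s N t \<partial>lborel) - (f s + f (- s)) / 2\<bar>
    \<le> e + 2 * B * (\<integral>t. indicator {t. d \<le> \<bar>t\<^sup>2 - s\<^sup>2\<bar>} t * peak k s N t \<partial>lborel)"
proof -
  let ?k = "peak k s N" and ?I = "indicator {t. d \<le> \<bar>t\<^sup>2 - s\<^sup>2\<bar>} :: real \<Rightarrow> real"
  define g where "g t = (f t + f (- t)) / 2" for t
  have [measurable]: "g \<in> borel_measurable borel" unfolding g_def by measurable
  have S[measurable]: "{t. d \<le> \<bar>t\<^sup>2 - s\<^sup>2\<bar>} \<in> sets borel" by measurable
  have gB: "\<bar>g t\<bar> \<le> B" if "t \<in> {-1..1}" for t
    using B[OF that] B[of "- t"] that unfolding g_def by auto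
  have B0: "0 \<le> B" using gB[OF s] by linarith
  have if1: "integrable lborel (\<lambda>t. f t * ?k t)" by (rule integrable_mult_peak[OF s f B])
  have if2: "integrable lborel (\<lambda>t. f (- t) * ?k t)"
    by (rule integrable_mult_peak[OF s, where B = B]) (measurable, use B in auto)
  have ig: "integrable lborel (\<lambda>t. g t * ?k t)"
    by (rule integrable_mult_peak[OF s _ gB]) measurable
  have ik: "integrable lborel (\<lambda>t. 1 * ?k t)"
    by (rule integrable_mult_peak[OF s, where B = 1]) auto
  have iI: "integrable lborel (\<lambda>t. ?I t * ?k t)"
    by (rule integrable_mult_peak[OF s borel_measurable_indicator[OF S], where B = 1]) (simp add: indicator_def)
  have "(\<integral>t. f t * ?k t \<partial>lborel) = (\<integral>t. f (- t) * ?k t \<partial>lborel)"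
    using lborel_integral_real_affine[of "-1" "\<lambda>t. f t * ?k t" 0] by (simp add: peak_uminus)
  moreover have "(\<integral>t. g t * ?k t \<partial>lborel) = ((\<integral>t. f t * ?k t \<partial>lborel) + (\<integral>t. f (- t) * ?k t \<partial>lborel)) / 2"
    unfolding Bochner_Integration.integral_add[OF if1 if2, symmetric] integral_divide_zero[symmetric]
    by (intro Bochner_Integration.integral_cong) (auto simp: g_def algebra_simps add_divide_distrib)
  ultimately have "(\<integral>t. f t * ?k t \<partial>lborel) - g s = (\<integral>t. g t * ?k t - g s * (1 * ?k t) \<partial>lborel)"
    by (subst Bochner_Integration.integral_diff[OF ig integrable_mult_right[OF ik]])
      (simp add: integral_peak[OF s])
  also have "\<bar>\<dots>\<bar> \<le> (\<integral>t. \<bar>g t * ?k t - g s * (1 * ?k t)\<bar> \<partial>lborel)"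
    by (rule integral_abs_bound)
  also have "\<dots> \<le> (\<integral>t. e * (1 * ?k t) + 2 * B * (?I t * ?k t) \<partial>lborel)"
  proof (rule integral_mono)
    show "integrable lborel (\<lambda>t. \<bar>g t * ?k t - g s * (1 * ?k t)\<bar>)"
      by (intro integrable_abs Bochner_Integration.integrable_diff ig integrable_mult_right ik)
    show "integrable lborel (\<lambda>t. e * (1 * ?k t) + 2 * B * (?I t * ?k t))"
      by (intro Bochner_Integration.integrable_add integrable_mult_right ik iI)
    fix t :: real
    have k0: "0 \<le> ?k t" by (rule peak_nonneg[OF s])
    have "\<bar>g t * ?k t - g s * (1 * ?k t)\<bar> = \<bar>g t - g s\<bar> * ?k t"
      using k0 by (simp add: abs_mult flip: left_diff_distrib)
    also have "\<dots> \<le> (e + 2 * B * ?I t) * ?k t"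
    proof (cases "t \<in> {-1..1}")
      case True
      have "\<bar>g t - g s\<bar> \<le> e + 2 * B * ?I t"
      proof (cases "d \<le> \<bar>t\<^sup>2 - s\<^sup>2\<bar>")
        case far: True
        thus ?thesis using gB[OF True] gB[OF s] e by simp
      next
        case False
        thus ?thesis using osc[OF True] unfolding g_def by simp
      qed
      thus ?thesis using k0 by (intro mult_right_mono)
    qed (simp add: peak_def weight_eq_0)
    finally show "\<bar>g t * ?k t - g s * (1 * ?k t)\<bar> \<le> e * (1 * ?k t) + 2 * B * (?I t * ?k t)"
      by (simp add: algebra_simps)
  qed
  also have "\<dots> = e + 2 * B * (\<integral>t. ?I t * ?k t \<partial>lborel)"
    by (subst Bochner_Integration.integral_add[OF integrable_mult_right[OF ik] integrable_mult_right[OF iI]])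
      (simp add: integral_peak[OF s])
  finally show ?thesis unfolding g_def .
qed

text \<open>The kernel |c - t|^p averaged over the reflection of t. It arises because in the limit a
  peak carries half of its mass at \<open>s\<close> and half at \<open>- s\<close>.\<close>

definition sym_kernel :: "real \<Rightarrow> real \<Rightarrow> real \<Rightarrow> real" where
  "sym_kernel p c t = (\<bar>c - t\<bar> powr p + \<bar>c + t\<bar> powr p) / 2"

lemma abs_powr_le_interval:
  fixes c t :: real
  assumes "c \<in> {-1..1}" "t \<in> {-1..1}" "0 \<le> p"
  shows "\<bar>c - t\<bar> powr p \<le> 2 powr p" "\<bar>c + t\<bar> powr p \<le> 2 powr p"
  using assms by (auto intro!: powr_mono2)

lemma sym_kernel_bounds:
  assumes "c \<in> {-1..1}" "t \<in> {-1..1}" "0 \<le> p"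
  shows "\<bar>sym_kernel p c t\<bar> \<le> 2 powr p"
  using abs_powr_le_interval[OF assms] by (simp add: sym_kernel_def)

lemma sym_kernel_commute: "sym_kernel p c t = sym_kernel p t c"
  by (simp add: sym_kernel_def add.commute abs_minus_commute)

lemma sym_kernel_abs: "sym_kernel p c \<bar>t\<bar> = sym_kernel p c t"
  by (auto simp: sym_kernel_def abs_if)

text \<open>Peaks are localised in t^2, so the modulus of continuity is needed in that variable. The
  kernel is even in t, and the square of |t| - |s| is at most |t^2 - s^2|, whence the threshold
  d^2.\<close>

lemma sym_kernel_oscillation:
  assumes p: "0 < p" and e: "0 < e"
  shows "\<exists>d>0. d \<le> 1 \<and> (\<forall>c\<in>{-1..1}. \<forall>t\<in>{-1..1}. \<forall>s\<in>{-1..1}.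
    \<bar>t\<^sup>2 - s\<^sup>2\<bar> < d \<longrightarrow> \<bar>sym_kernel p c t - sym_kernel p c s\<bar> \<le> e)"
proof -
  obtain d where d: "0 < d" and dd: "\<And>r s. 0 \<le> r \<Longrightarrow> r \<le> 2 \<Longrightarrow> 0 \<le> s \<Longrightarrow> s \<le> 2 \<Longrightarrow> \<bar>r - s\<bar> < d \<Longrightarrow> \<bar>r powr p - s powr p\<bar> < e"
    using powr_uniformly_continuous[OF p e, of 2] by (metis atLeastAtMost_iff)
  show ?thesis
  proof (intro exI[of _ "min (d\<^sup>2) 1"] conjI ballI impI)
    fix c t s :: real
    assume c: "c \<in> {-1..1}" and t: "t \<in> {-1..1}" and s: "s \<in> {-1..1}" and near: "\<bar>t\<^sup>2 - s\<^sup>2\<bar> < min (d\<^sup>2) 1"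
    let ?t = "\<bar>t\<bar>" and ?s = "\<bar>s\<bar>"
    have "\<bar>?t - ?s\<bar>\<^sup>2 \<le> \<bar>?t - ?s\<bar> * \<bar>?t + ?s\<bar>"
      unfolding power2_eq_square by (intro mult_left_mono) auto
    also have "\<dots> = \<bar>t\<^sup>2 - s\<^sup>2\<bar>"
      unfolding abs_mult[symmetric] by (simp add: algebra_simps power2_eq_square)
    also have "\<dots> < d\<^sup>2" using near by simp
    finally have ts: "\<bar>?t - ?s\<bar> < d"
      by (rule power2_less_imp_less) (use d in simp)
    have "\<bar>\<bar>c - x\<bar> - \<bar>c - y\<bar>\<bar> \<le> \<bar>x - y\<bar>" "\<bar>\<bar>c + x\<bar> - \<bar>c + y\<bar>\<bar> \<le> \<bar>x - y\<bar>" for x y :: real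
      by linarith+
    from order.strict_trans1[OF this(1) ts] order.strict_trans1[OF this(2) ts]
    have near': "\<bar>\<bar>c - ?t\<bar> - \<bar>c - ?s\<bar>\<bar> < d" "\<bar>\<bar>c + ?t\<bar> - \<bar>c + ?s\<bar>\<bar> < d" .
    have "\<bar>c\<bar> \<le> 1" "?t \<le> 1" "?s \<le> 1" using c t s by (auto simp: abs_le_iff)
    hence bnd: "\<bar>c - ?t\<bar> \<le> 2" "\<bar>c - ?s\<bar> \<le> 2" "\<bar>c + ?t\<bar> \<le> 2" "\<bar>c + ?s\<bar> \<le> 2"
      by linarith+
    have a: "\<bar>\<bar>c - ?t\<bar> powr p - \<bar>c - ?s\<bar> powr p\<bar> \<le> e"
      using near' bnd by (intro order.strict_implies_order[OF dd]) auto
    have b: "\<bar>\<bar>c + ?t\<bar> powr p - \<bar>c + ?s\<bar> powr p\<bar> \<le> e"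
      using near' bnd by (intro order.strict_implies_order[OF dd]) auto
    have "\<bar>(x + y) / 2 - (x' + y') / 2\<bar> \<le> e" if "\<bar>x - x'\<bar> \<le> e" "\<bar>y - y'\<bar> \<le> e" for x x' y y' :: real
      using that by (auto simp: abs_le_iff field_simps)
    from this[OF a b] have "\<bar>sym_kernel p c ?t - sym_kernel p c ?s\<bar> \<le> e"
      unfolding sym_kernel_def .
    thus "\<bar>sym_kernel p c t - sym_kernel p c s\<bar> \<le> e" by (simp add: sym_kernel_abs)
  qed (use d in auto)
qed

definition peak_potential :: "real \<Rightarrow> nat \<Rightarrow> real \<Rightarrow> nat \<Rightarrow> real \<Rightarrow> real" where
  "peak_potential p k s N c = (\<integral>t. \<bar>t - c\<bar> powr p * peak k s N t \<partial>lborel)"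

lemma borel_measurable_peak_potential [measurable]: "peak_potential p k s N \<in> borel_measurable borel"
  unfolding peak_potential_def[abs_def] by measurable

lemma peak_potential_bound:
  assumes s: "s \<in> {-1..1}" and c: "c \<in> {-1..1}" and p: "0 \<le> p"
  shows "\<bar>peak_potential p k s N c\<bar> \<le> 2 powr p"
proof -
  have "\<bar>peak_potential p k s N c\<bar> \<le> (\<integral>t. \<bar>\<bar>t - c\<bar> powr p * peak k s N t\<bar> \<partial>lborel)"
    unfolding peak_potential_def by (rule integral_abs_bound)
  also have "\<dots> \<le> (\<integral>t. 2 powr p * peak k s N t \<partial>lborel)"
  proof (rule integral_mono)
    show "integrable lborel (\<lambda>t. \<bar>\<bar>t - c\<bar> powr p * peak k s N t\<bar>)"
      by (intro integrable_abs integrable_mult_peak[OF s, where B = "2 powr p"])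
        (measurable, use abs_powr_le_interval[OF _ c p] in simp)
    show "integrable lborel (\<lambda>t. 2 powr p * peak k s N t)"
      by (rule integrable_mult_peak[OF s, where B = "2 powr p"]) auto
    show "\<bar>\<bar>t - c\<bar> powr p * peak k s N t\<bar> \<le> 2 powr p * peak k s N t" for t
    proof (cases "t \<in> {-1..1}")
      case True
      thus ?thesis
        using mult_right_mono[OF abs_powr_le_interval(1)[OF True c p] peak_nonneg[OF s]] peak_nonneg[OF s]
        by (simp add: abs_mult)
    qed (simp add: peak_def weight_eq_0)
  qed
  finally show ?thesis by (simp add: integral_peak[OF s])
qed

text \<open>The even part of t -> |t - c|^p is \<open>sym_kernel p c\<close>. The modulus
  \<open>d\<close> does not depend on \<open>c\<close>, so the potential is approximated uniformly
  and can itself be integrated against a second peak.\<close>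

lemma peak_potential_approx:
  assumes s: "s \<in> {-1..1}" and c: "c \<in> {-1..1}" and p: "0 \<le> p" and e: "0 \<le> e"
    and osc: "\<forall>c\<in>{-1..1}. \<forall>t\<in>{-1..1}. \<forall>s\<in>{-1..1}.
      \<bar>t\<^sup>2 - s\<^sup>2\<bar> < d \<longrightarrow> \<bar>sym_kernel p c t - sym_kernel p c s\<bar> \<le> e"
  shows "\<bar>peak_potential p k s N c - sym_kernel p c s\<bar>
    \<le> e + 2 * 2 powr p * (\<integral>t. indicator {t. d \<le> \<bar>t\<^sup>2 - s\<^sup>2\<bar>} t * peak k s N t \<partial>lborel)"
proof -
  let ?f = "\<lambda>t. \<bar>t - c\<bar> powr p"
  have sym: "(?f t + ?f (- t)) / 2 = sym_kernel p c t" for t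
  proof -
    have "\<bar>- t - c\<bar> = \<bar>c + t\<bar>" by linarith
    thus ?thesis by (simp add: sym_kernel_def abs_minus_commute)
  qed
  have "\<bar>(\<integral>t. ?f t * peak k s N t \<partial>lborel) - (?f s + ?f (- s)) / 2\<bar>
      \<le> e + 2 * 2 powr p * (\<integral>t. indicator {t. d \<le> \<bar>t\<^sup>2 - s\<^sup>2\<bar>} t * peak k s N t \<partial>lborel)"
  proof (rule integral_mult_peak_approx[OF s])
    show "?f \<in> borel_measurable borel" by measurable
    show "\<bar>?f t\<bar> \<le> 2 powr p" if "t \<in> {-1..1}" for t
      using abs_powr_le_interval(1)[OF that c p] by simp
    show "\<bar>(?f t + ?f (- t)) / 2 - (?f s + ?f (- s)) / 2\<bar> \<le> e" if "t \<in> {-1..1}" "\<bar>t\<^sup>2 - s\<^sup>2\<bar> < d" for t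
      unfolding sym using osc s c that by blast
  qed fact
  thus ?thesis unfolding sym peak_potential_def .
qed

text \<open>In the limit both peaks split evenly between plus and minus their centres. The four
  interactions involve only the distances |s' - s| and |s' + s|, each with total weight 1/2, which
  is \<open>sym_kernel\<close>.\<close>

lemma peak_energy_tendsto:
  assumes s: "s \<in> {-1..1}" and s': "s' \<in> {-1..1}" and p: "0 < p"
  shows "(\<lambda>N. \<integral>c. peak_potential p k s N c * peak k s' N c \<partial>lborel) \<longlonglongrightarrow> sym_kernel p s' s"
proof (rule LIMSEQ_I)
  fix r :: real assume r: "0 < r"
  \<comment> \<open>The oscillation enters once for each of the two peaks, which uses up 2 e = r /
    2; the tails share the other half.\<close>
  define e where "e = r / 4"
  have e: "0 < e" using r by (simp add: e_def)
  obtain d where d: "0 < d" "d \<le> 1" and osc: "\<forall>c\<in>{-1..1}. \<forall>t\<in>{-1..1}. \<forall>s\<in>{-1..1}.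
      \<bar>t\<^sup>2 - s\<^sup>2\<bar> < d \<longrightarrow> \<bar>sym_kernel p c t - sym_kernel p c s\<bar> \<le> e"
    using sym_kernel_oscillation[OF p e] by blast
  define tail where "tail z N = (\<integral>t. indicator {t. d \<le> \<bar>t\<^sup>2 - z\<^sup>2\<bar>} t * peak k z N t \<partial>lborel)" for z N
  have main: "\<bar>(\<integral>c. peak_potential p k s N c * peak k s' N c \<partial>lborel) - sym_kernel p s' s\<bar>
      \<le> 2 * e + 2 * 2 powr p * (tail s N + tail s' N)" for N
  proof -
    let ?g = "\<lambda>c. sym_kernel p c s"
    have gm[measurable]: "?g \<in> borel_measurable borel" unfolding sym_kernel_def by measurable
    have gB: "\<bar>?g c\<bar> \<le> 2 powr p" if "c \<in> {-1..1}" for c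
      using sym_kernel_bounds[OF that s] p by simp
    have even: "?g (- c) = ?g c" for c
      by (metis abs_minus_cancel sym_kernel_abs sym_kernel_commute)
    have ig: "integrable lborel (\<lambda>c. ?g c * peak k s' N c)"
      by (rule integrable_mult_peak[OF s' gm gB])
    have ip: "integrable lborel (\<lambda>c. peak_potential p k s N c * peak k s' N c)"
      using p by (intro integrable_mult_peak[OF s' _ peak_potential_bound[OF s]]) auto
    define b where "b = e + 2 * 2 powr p * tail s N"
    have bnd: "\<bar>peak_potential p k s N c - ?g c\<bar> \<le> b" if "c \<in> {-1..1}" for c
      unfolding b_def tail_def using p e by (intro peak_potential_approx[OF s that _ _ osc]) auto
    have "\<bar>(\<integral>c. peak_potential p k s N c * peak k s' N c \<partial>lborel) - (\<integral>c. ?g c * peak k s' N c \<partial>lborel)\<bar>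
        = \<bar>\<integral>c. peak_potential p k s N c * peak k s' N c - ?g c * peak k s' N c \<partial>lborel\<bar>"
      using ip ig by simp
    also have "\<dots> \<le> (\<integral>c. \<bar>peak_potential p k s N c * peak k s' N c - ?g c * peak k s' N c\<bar> \<partial>lborel)"
      by (rule integral_abs_bound)
    also have "\<dots> \<le> (\<integral>c. b * peak k s' N c \<partial>lborel)"
    proof (rule integral_mono)
      show "integrable lborel (\<lambda>c. \<bar>peak_potential p k s N c * peak k s' N c - ?g c * peak k s' N c\<bar>)"
        by (intro integrable_abs Bochner_Integration.integrable_diff ip ig)
      show "integrable lborel (\<lambda>c. b * peak k s' N c)"
        by (rule integrable_mult_peak[OF s', where B = "\<bar>b\<bar>"]) auto
      show "\<bar>peak_potential p k s N c * peak k s' N c - ?g c * peak k s' N c\<bar> \<le> b * peak k s' N c" for c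
      proof (cases "c \<in> {-1..1}")
        case True
        have "\<bar>peak_potential p k s N c * peak k s' N c - ?g c * peak k s' N c\<bar>
            = \<bar>peak_potential p k s N c - ?g c\<bar> * peak k s' N c"
          using peak_nonneg[OF s', of k N c] by (simp add: abs_mult flip: left_diff_distrib)
        also have "\<dots> \<le> b * peak k s' N c"
          by (intro mult_right_mono bnd True peak_nonneg s')
        finally show ?thesis .
      qed (simp add: peak_def weight_eq_0)
    qed
    also have "\<dots> = b" by (simp add: integral_peak[OF s'])
    finally have 1: "\<bar>(\<integral>c. peak_potential p k s N c * peak k s' N c \<partial>lborel) - (\<integral>c. ?g c * peak k s' N c \<partial>lborel)\<bar> \<le> b" .
    have "\<bar>(\<integral>c. ?g c * peak k s' N c \<partial>lborel) - (?g s' + ?g (- s')) / 2\<bar> \<le> e + 2 * 2 powr p * tail s' N"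
      unfolding tail_def
    proof (rule integral_mult_peak_approx[OF s' gm gB])
      show "\<bar>(?g t + ?g (- t)) / 2 - (?g s' + ?g (- s')) / 2\<bar> \<le> e" if "t \<in> {-1..1}" "\<bar>t\<^sup>2 - s'\<^sup>2\<bar> < d" for t
      proof -
        have "\<bar>sym_kernel p s t - sym_kernel p s s'\<bar> \<le> e" using osc s s' that by blast
        thus ?thesis unfolding even by (simp add: sym_kernel_commute[of p _ s])
      qed
    qed (use e in auto)
    hence 2: "\<bar>(\<integral>c. ?g c * peak k s' N c \<partial>lborel) - sym_kernel p s' s\<bar> \<le> e + 2 * 2 powr p * tail s' N"
      by (simp add: even)
    have "\<bar>x - z\<bar> \<le> u + v" if "\<bar>x - y\<bar> \<le> u" "\<bar>y - z\<bar> \<le> v" for x y z u v :: real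
      using that by linarith
    from this[OF 1 2] show ?thesis by (simp add: b_def distrib_left)
  qed
  define X where "X N = 2 * 2 powr p * (tail s N + tail s' N)" for N
  define J where "J N = (\<integral>c. peak_potential p k s N c * peak k s' N c \<partial>lborel)" for N
  have "(\<lambda>N. 2 * 2 powr p * (tail s N + tail s' N)) \<longlonglongrightarrow> 2 * 2 powr p * (0 + 0)"
    unfolding tail_def by (intro tendsto_intros peak_tail_tendsto_0 s s' d)
  hence lim: "X \<longlonglongrightarrow> 0" unfolding X_def by simp
  have "\<forall>\<^sub>F N in sequentially. X N < r / 2"
    by (rule order_tendstoD(2)[OF lim]) (use r in simp)
  hence "\<forall>\<^sub>F N in sequentially. \<bar>J N - sym_kernel p s' s\<bar> < r"
  proof eventually_elim
    case (elim N)
    have "\<bar>J N - sym_kernel p s' s\<bar> \<le> 2 * e + X N"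
      unfolding J_def X_def by (rule main)
    also have "\<dots> < r" using elim by (simp add: e_def)
    finally show ?case .
  qed
  thus "\<exists>N0. \<forall>N\<ge>N0. norm ((\<integral>c. peak_potential p k s N c * peak k s' N c \<partial>lborel) - sym_kernel p s' s) < r"
    unfolding eventually_sequentially J_def real_norm_def .
qed

section \<open>Interchanging integrals over the ball\<close>

lemma abs_integral_ball_measure_le:
  fixes f :: "'a::euclidean_space \<Rightarrow> real"
  assumes f: "f \<in> borel_measurable borel" and C: "\<And>x. norm x \<le> 1 \<Longrightarrow> \<bar>f x\<bar> \<le> C"
  shows "\<bar>\<integral>x. f x \<partial>ball_measure\<bar> \<le> C * measure (ball_measure :: 'a measure) UNIV"
proof -
  interpret finite_measure "ball_measure :: 'a measure" by (rule finite_measure_ball_measure)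
  have "\<bar>\<integral>x. f x \<partial>ball_measure\<bar> \<le> (\<integral>x. \<bar>f x\<bar> \<partial>ball_measure)"
    by (rule integral_abs_bound)
  also have "\<dots> \<le> integral\<^sup>L ball_measure (\<lambda>x::'a. C)"
  proof (rule integral_mono_AE)
    show "integrable ball_measure (\<lambda>x. \<bar>f x\<bar>)"
      by (intro integrable_abs integrable_ball_measure_bounded[OF f C])
    show "AE x in ball_measure. \<bar>f x\<bar> \<le> C"
      using AE_ball_measure by eventually_elim (use C in auto)
  qed simp
  finally show ?thesis by (simp add: mult.commute)
qed

text \<open>The bound concerns the ball only, while the measure lives on the whole type. The cutoffs
  \<open>i\<close> and \<open>j\<close>, equal to 1 almost everywhere, produce a globally bounded
  integrand \<open>F\<close> to which Fubini on the product measure applies.\<close>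

lemma ball_measure_Fubini:
  fixes f :: "'a::euclidean_space \<Rightarrow> 'b::euclidean_space \<Rightarrow> real"
  assumes f[measurable]: "(\<lambda>z. f (fst z) (snd z)) \<in> borel_measurable (borel \<Otimes>\<^sub>M borel)"
    and B: "\<And>x y. norm x \<le> 1 \<Longrightarrow> norm y \<le> 1 \<Longrightarrow> \<bar>f x y\<bar> \<le> B"
  shows "(\<integral>x. (\<integral>y. f x y \<partial>ball_measure) \<partial>ball_measure) = (\<integral>y. (\<integral>x. f x y \<partial>ball_measure) \<partial>ball_measure)"
proof -
  let ?A = "ball_measure :: 'a measure" and ?B = "ball_measure :: 'b measure"
  interpret A: finite_measure ?A by (rule finite_measure_ball_measure)
  interpret B: finite_measure ?B by (rule finite_measure_ball_measure)
  interpret pair_sigma_finite ?A ?B ..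
  interpret AB: finite_measure "?A \<Otimes>\<^sub>M ?B"
    by (intro finite_measure_pair_measure finite_measure_ball_measure)
  define i where "i x = (indicator (cball 0 1) x :: real)" for x :: 'a
  define j where "j y = (indicator (cball 0 1) y :: real)" for y :: 'b
  have [measurable]: "i \<in> borel_measurable borel" "j \<in> borel_measurable borel"
    unfolding i_def[abs_def] j_def[abs_def] by (auto intro!: borel_measurable_indicator)
  have f1[measurable]: "f x \<in> borel_measurable borel" for x
    using measurable_compose[OF measurable_Pair1'[of x borel borel] f] by simp
  have f2[measurable]: "(\<lambda>x. f x y) \<in> borel_measurable borel" for y
    using measurable_compose[OF measurable_Pair2'[of y borel borel] f] by simp
  define F where "F x y = i x * (j y * f x y)" for x y
  have "integrable (?A \<Otimes>\<^sub>M ?B) (\<lambda>(x, y). F x y)"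
  proof (rule AB.integrable_const_bound[where B = "\<bar>B\<bar>"])
    show "AE z in ?A \<Otimes>\<^sub>M ?B. norm (case z of (x, y) \<Rightarrow> F x y) \<le> \<bar>B\<bar>"
    proof (intro AE_I2, clarify)
      fix x :: 'a and y :: 'b
      show "norm (F x y) \<le> \<bar>B\<bar>"
        using B[of x y] by (auto simp: F_def i_def j_def indicator_def)
    qed
    have "(\<lambda>z. F (fst z) (snd z)) \<in> borel_measurable (borel \<Otimes>\<^sub>M borel)"
      unfolding F_def by measurable
    thus "(\<lambda>(x, y). F x y) \<in> borel_measurable (?A \<Otimes>\<^sub>M ?B)"
      by (simp add: case_prod_beta' cong: measurable_cong_sets sets_pair_measure_cong)
  qed
  from Fubini_integral[OF this]
  have eq: "(\<integral>y. (\<integral>x. F x y \<partial>?A) \<partial>?B) = (\<integral>x. (\<integral>y. F x y \<partial>?B) \<partial>?A)" .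
  have ij: "AE x in ?A. i x = 1" "AE y in ?B. j y = 1"
    unfolding i_def j_def by (rule eventually_mono[OF AE_ball_measure], simp)+
  have "(\<integral>x. (\<integral>y. F x y \<partial>?B) \<partial>?A) = (\<integral>x. (\<integral>y. f x y \<partial>?B) \<partial>?A)"
  proof (rule integral_cong_AE)
    have "(\<integral>y. F x y \<partial>?B) = i x * (\<integral>y. f x y \<partial>?B)" for x
    proof -
      have "(\<integral>y. j y * f x y \<partial>?B) = (\<integral>y. f x y \<partial>?B)"
        by (rule integral_cong_AE) (measurable, use ij(2) in eventually_elim, simp)
      thus ?thesis by (simp add: F_def)
    qed
    thus "AE x in ?A. (\<integral>y. F x y \<partial>?B) = (\<integral>y. f x y \<partial>?B)"
      by (intro eventually_mono[OF ij(1)]) simp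
    show "(\<lambda>x. \<integral>y. F x y \<partial>?B) \<in> borel_measurable ?A" "(\<lambda>x. \<integral>y. f x y \<partial>?B) \<in> borel_measurable ?A"
      unfolding F_def using f by (auto intro!: B.borel_measurable_lebesgue_integral simp: case_prod_beta' cong: measurable_cong_sets sets_pair_measure_cong)
  qed
  moreover have "(\<integral>y. (\<integral>x. F x y \<partial>?A) \<partial>?B) = (\<integral>y. (\<integral>x. f x y \<partial>?A) \<partial>?B)"
  proof (rule integral_cong_AE)
    have "(\<integral>x. F x y \<partial>?A) = j y * (\<integral>x. f x y \<partial>?A)" for y
    proof -
      have "(\<integral>x. i x * f x y \<partial>?A) = (\<integral>x. f x y \<partial>?A)"
        by (rule integral_cong_AE) (measurable, use ij(1) in eventually_elim, simp)
      moreover have "F x y = j y * (i x * f x y)" for x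
        by (simp add: F_def mult.left_commute)
      ultimately show ?thesis by simp
    qed
    thus "AE y in ?B. (\<integral>x. F x y \<partial>?A) = (\<integral>x. f x y \<partial>?A)"
      by (intro eventually_mono[OF ij(2)]) simp
    have sw: "(\<lambda>z. f (snd z) (fst z)) \<in> borel_measurable (borel \<Otimes>\<^sub>M borel)"
      using measurable_compose[OF measurable_pair_swap' f] by (simp add: case_prod_beta')
    have [measurable]: "(\<lambda>z. F (snd z) (fst z)) \<in> borel_measurable (borel \<Otimes>\<^sub>M borel)"
      unfolding F_def using sw by measurable
    show "(\<lambda>y. \<integral>x. F x y \<partial>?A) \<in> borel_measurable ?B" "(\<lambda>y. \<integral>x. f x y \<partial>?A) \<in> borel_measurable ?B"
      using sw by (auto intro!: A.borel_measurable_lebesgue_integral simp: case_prod_beta' cong: measurable_cong_sets sets_pair_measure_cong)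
  qed
  ultimately show ?thesis using eq by simp
qed

text \<open>Each peak is \<open>weight\<close> times a polynomial in 1 - t^2, hence so is their
  combination, and a single radial density on the ball has it as marginal in every
  direction.\<close>

lemma radial_density_of_peaks:
  fixes s b :: "nat \<Rightarrow> real"
  assumes s: "\<And>i. i < m \<Longrightarrow> s i \<in> {-1..1}"
  defines "k \<equiv> DIM(real^'n) - 1"
  shows "\<exists>H :: real^'n \<Rightarrow> real. H \<in> borel_measurable borel \<and> (\<exists>B. \<forall>x. norm x \<le> 1 \<longrightarrow> \<bar>H x\<bar> \<le> B) \<and>
    (\<forall>u g. norm u = 1 \<longrightarrow> g \<in> borel_measurable borel \<longrightarrow> (\<exists>B. \<forall>t\<in>{-1..1}. \<bar>g t\<bar> \<le> B) \<longrightarrow>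
      (\<integral>x. g (x \<bullet> u) * H x \<partial>ball_measure) = (\<Sum>i<m. b i * (\<integral>t. g t * peak k (s i) N t \<partial>lborel)))"
proof -
  have "\<forall>i. \<exists>q. \<forall>t. peak k (s i) N t = weight k t * poly q (1 - t\<^sup>2)"
    using peak_eq_polynomial by blast
  then obtain q where q: "\<And>i t. peak k (s i) N t = weight k t * poly (q i) (1 - t\<^sup>2)"
    by metis
  define Q where "Q = (\<Sum>i<m. smult (b i) (q i))"
  have Q: "weight k t * poly Q (1 - t\<^sup>2) = (\<Sum>i<m. b i * peak k (s i) N t)" for t
    by (simp add: Q_def poly_sum sum_distrib_left q mult_ac)
  have "(\<integral>t. g t * (weight k t * poly Q (1 - t\<^sup>2)) \<partial>lborel) = (\<Sum>i<m. b i * (\<integral>t. g t * peak k (s i) N t \<partial>lborel))"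
    if g: "g \<in> borel_measurable borel" and B: "\<forall>t\<in>{-1..1}. \<bar>g t\<bar> \<le> B" for g B
  proof -
    have "(\<integral>t. g t * (weight k t * poly Q (1 - t\<^sup>2)) \<partial>lborel) = (\<integral>t. (\<Sum>i<m. b i * (g t * peak k (s i) N t)) \<partial>lborel)"
      unfolding Q by (simp add: sum_distrib_left mult_ac)
    also have "\<dots> = (\<Sum>i<m. \<integral>t. b i * (g t * peak k (s i) N t) \<partial>lborel)"
      using B by (intro Bochner_Integration.integral_sum integrable_mult_right integrable_mult_peak[where B = B] s g) auto
    finally show ?thesis by simp
  qed
  moreover obtain H :: "real^'n \<Rightarrow> real" where "H \<in> borel_measurable borel" "\<exists>B. \<forall>x. norm x \<le> 1 \<longrightarrow> \<bar>H x\<bar> \<le> B"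
    "\<forall>u g. norm u = 1 \<longrightarrow> g \<in> borel_measurable borel \<longrightarrow> (\<exists>B. \<forall>t\<in>{-1..1}. \<bar>g t\<bar> \<le> B) \<longrightarrow>
      (\<integral>x. g (x \<bullet> u) * H x \<partial>ball_measure) = (\<integral>t. g t * (weight k t * poly Q (1 - t\<^sup>2)) \<partial>lborel)"
    using radial_density_of_polynomial[where 'n = 'n, of Q] unfolding k_def by blast
  ultimately show ?thesis by (intro exI[of _ H] conjI allI impI) auto
qed

section \<open>Energy of radial densities under a linear map\<close>

definition peak_energy :: "real \<Rightarrow> nat \<Rightarrow> nat \<Rightarrow> (nat \<Rightarrow> real) \<Rightarrow> (nat \<Rightarrow> real) \<Rightarrow> nat \<Rightarrow> real" where
  "peak_energy p k m b s N =
    (\<Sum>j<m. b j * (\<Sum>i<m. b i * (\<integral>c. peak_potential p k (s i) N c * peak k (s j) N c \<partial>lborel)))"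

text \<open>The density \<open>H\<close> has the combination of peaks as marginal in every
  direction. Projected along \<open>adjoint T u\<close>, its energy is therefore
  \<open>norm (adjoint T u) powr p\<close> times \<open>peak_energy\<close>, and averaging over
  \<open>u\<close> turns the first factor into the moment of the adjoint.\<close>

lemma peak_energy_le_max_energy:
  fixes T :: "real^'n \<Rightarrow> real^'n" and s b :: "nat \<Rightarrow> real"
  assumes T: "linear T" and p: "0 < p"
    and s: "\<And>i. i < m \<Longrightarrow> s i \<in> {-1..1}" and b: "(\<Sum>i<m. b i) = 1"
  shows "ereal (peak_energy p (DIM(real^'n) - 1) m b s N * (op_moment p T / abs_moment TYPE('n) p))
    \<le> max_energy p (T ` cball 0 1)"
proof -
  define k where "k = DIM(real^'n) - 1"
  let ?\<beta> = "ball_measure :: (real^'n) measure" and ?\<kappa> = "abs_moment TYPE('n) p"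
  let ?J = "peak_energy p k m b s N"
  interpret finite_measure ?\<beta> by (rule finite_measure_ball_measure)
  have \<kappa>: "0 < ?\<kappa>" by (rule abs_moment_pos[OF p])
  have Tm[measurable]: "T \<in> borel_measurable borel" by (rule borel_measurable_linear[OF T])
  obtain B where B: "1 \<le> B" "\<And>x. norm (T x) \<le> B * norm x" using linear_norm_bound[OF T] by blast
  obtain H BH where Hm[measurable]: "H \<in> borel_measurable borel" and BH: "\<And>x. norm x \<le> 1 \<Longrightarrow> \<bar>H x\<bar> \<le> BH"
    and H: "\<And>u g. norm u = 1 \<Longrightarrow> g \<in> borel_measurable borel \<Longrightarrow> \<exists>B. \<forall>t\<in>{-1..1}. \<bar>g t\<bar> \<le> B \<Longrightarrow>
      (\<integral>x. g (x \<bullet> u) * H x \<partial>?\<beta>) = (\<Sum>i<m. b i * (\<integral>t. g t * peak k (s i) N t \<partial>lborel))"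
    using radial_density_of_peaks[where 'n = 'n and m = m and s = s and b = b and N = N, OF s] unfolding k_def by blast
  have BH0: "0 \<le> BH" using BH[of 0] by simp
  have mass: "(\<integral>x. H x \<partial>?\<beta>) = 1"
  proof -
    have "(\<integral>x. 1 * H x \<partial>?\<beta>) = (\<Sum>i<m. b i * (\<integral>t. 1 * peak k (s i) N t \<partial>lborel))"
      by (rule H[of "axis undefined 1"]) (auto intro: exI[of _ 1])
    also have "\<dots> = (\<Sum>i<m. b i)" by (intro sum.cong refl) (simp add: integral_peak[OF s])
    finally show ?thesis using b by simp
  qed
  \<comment> \<open>The contribution of the direction \<open>u\<close> to the potential at
    \<open>T y\<close>; its integral over \<open>u\<close> is \<kappa> times that potential.\<close>
  define G where "G u y = (\<integral>x. H x * \<bar>u \<bullet> (T x - T y)\<bar> powr p \<partial>?\<beta>)" for u y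
  have Tb: "norm (T x) \<le> B" if "norm x \<le> 1" for x
  proof -
    have "B * norm x \<le> B * 1" using that B(1) by (intro mult_left_mono) auto
    with B(2)[of x] show ?thesis by simp
  qed
  have kb: "\<bar>u \<bullet> (T x - T y)\<bar> powr p \<le> (B + norm (T y)) powr p" if "norm x \<le> 1" "norm u \<le> 1" for u x y
  proof -
    have "\<bar>u \<bullet> (T x - T y)\<bar> \<le> norm u * norm (T x - T y)" by (rule Cauchy_Schwarz_ineq2)
    also have "\<dots> \<le> 1 * (B + norm (T y))"
      using that Tb[OF that(1)] norm_triangle_ineq4[of "T x" "T y"] by (intro mult_mono) auto
    finally show ?thesis using p by (intro powr_mono2) auto
  qed
  have Hkb: "\<bar>H x * \<bar>u \<bullet> (T x - T y)\<bar> powr p\<bar> \<le> BH * (B + norm (T y)) powr p" if "norm x \<le> 1" "norm u \<le> 1" for u x y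
    unfolding abs_mult using BH[OF that(1)] kb[OF that, of y] BH0 by (intro mult_mono) auto
  have G: "?\<kappa> * (\<integral>x. H x * dist (T x) (T y) powr p \<partial>?\<beta>) = (\<integral>u. G u y \<partial>?\<beta>)" for y
  proof -
    have "?\<kappa> * (\<integral>x. H x * dist (T x) (T y) powr p \<partial>?\<beta>) = (\<integral>x. (\<integral>u. H x * \<bar>u \<bullet> (T x - T y)\<bar> powr p \<partial>?\<beta>) \<partial>?\<beta>)"
      unfolding integral_mult_right_zero integral_abs_inner_powr[OF p]
      unfolding integral_mult_right_zero[symmetric]
      by (intro Bochner_Integration.integral_cong) (simp_all add: dist_norm)
    also have "\<dots> = (\<integral>u. G u y \<partial>?\<beta>)"
      unfolding G_def
    proof (rule ball_measure_Fubini)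
      show "(\<lambda>z. H (fst z) * \<bar>snd z \<bullet> (T (fst z) - T y)\<bar> powr p) \<in> borel_measurable (borel \<Otimes>\<^sub>M borel)"
        by measurable
    qed (rule Hkb)
    finally show ?thesis .
  qed
  have Gu: "(\<integral>y. H y * G u y \<partial>?\<beta>) = norm (adjoint T u) powr p * ?J" for u
  proof -
    let ?v = "adjoint T u"
    have uv: "u \<bullet> (T x - T y) = x \<bullet> ?v - y \<bullet> ?v" for x y
      by (simp add: inner_diff_right adjoint_works[OF T] inner_commute)
    show ?thesis
    proof (cases "?v = 0")
      case True
      thus ?thesis by (simp add: G_def uv)
    next
      case False
      define e where "e = ?v /\<^sub>R norm ?v"
      have e: "norm e = 1" and ve: "x \<bullet> ?v = norm ?v * (x \<bullet> e)" for x
        using False by (simp_all add: e_def)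
      \<comment> \<open>The potential of the combination of peaks. The marginal identity of
        \<open>H\<close> is used twice: for the function t -> |t - y . e|^p, which produces
        \<open>\<Psi> (y \<bullet> e)\<close>, and then for \<open>\<Psi>\<close> itself.\<close>
      define \<Psi> where "\<Psi> c = (\<Sum>i<m. b i * peak_potential p k (s i) N c)" for c
      have \<Psi>m: "\<Psi> \<in> borel_measurable borel" unfolding \<Psi>_def by measurable
      have Gy: "G u y = norm ?v powr p * \<Psi> (y \<bullet> e)" for y
      proof -
        have "\<bar>x \<bullet> ?v - y \<bullet> ?v\<bar> = norm ?v * \<bar>x \<bullet> e - y \<bullet> e\<bar>" for x
          unfolding ve right_diff_distrib[symmetric] by (simp add: abs_mult)
        hence "G u y = (\<integral>x. norm ?v powr p * (\<bar>x \<bullet> e - y \<bullet> e\<bar> powr p * H x) \<partial>?\<beta>)"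
          unfolding G_def uv by (simp add: powr_mult mult_ac)
        also have "\<dots> = norm ?v powr p * (\<integral>x. \<bar>x \<bullet> e - y \<bullet> e\<bar> powr p * H x \<partial>?\<beta>)"
          by (rule integral_mult_right_zero)
        also have "(\<integral>x. \<bar>x \<bullet> e - y \<bullet> e\<bar> powr p * H x \<partial>?\<beta>) = \<Psi> (y \<bullet> e)"
          unfolding \<Psi>_def peak_potential_def
        proof (rule H[OF e])
          show "(\<lambda>t. \<bar>t - y \<bullet> e\<bar> powr p) \<in> borel_measurable borel" by measurable
          show "\<exists>B. \<forall>t\<in>{-1..1}. \<bar>\<bar>t - y \<bullet> e\<bar> powr p\<bar> \<le> B"
            using p by (intro exI[of _ "(1 + \<bar>y \<bullet> e\<bar>) powr p"]) (auto intro!: powr_mono2)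
        qed
        finally show ?thesis .
      qed
      have ppb: "\<bar>peak_potential p k (s i) N c\<bar> \<le> 2 powr p" if "i < m" "c \<in> {-1..1}" for i c
        using p by (intro peak_potential_bound s that) auto
      have "(\<integral>y. H y * G u y \<partial>?\<beta>) = (\<integral>y. norm ?v powr p * (\<Psi> (y \<bullet> e) * H y) \<partial>?\<beta>)"
        unfolding Gy by (simp only: mult_ac)
      also have "\<dots> = norm ?v powr p * (\<integral>y. \<Psi> (y \<bullet> e) * H y \<partial>?\<beta>)"
        by (rule integral_mult_right_zero)
      also have "(\<integral>y. \<Psi> (y \<bullet> e) * H y \<partial>?\<beta>) = (\<Sum>j<m. b j * (\<integral>c. \<Psi> c * peak k (s j) N c \<partial>lborel))"
      proof (rule H[OF e \<Psi>m], intro exI ballI)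
        fix c :: real assume c: "c \<in> {-1..1}"
        show "\<bar>\<Psi> c\<bar> \<le> (\<Sum>i<m. \<bar>b i\<bar> * 2 powr p)"
          unfolding \<Psi>_def using ppb[OF _ c]
          by (intro order_trans[OF sum_abs] sum_mono) (auto simp: abs_mult intro!: mult_left_mono)
      qed
      also have "\<dots> = ?J"
        unfolding peak_energy_def
      proof (intro sum.cong refl arg_cong2[where f = "(*)"])
        fix j assume "j \<in> {..<m}"
        hence j: "j < m" by simp
        have "(\<integral>c. \<Psi> c * peak k (s j) N c \<partial>lborel)
            = (\<integral>c. (\<Sum>i<m. b i * (peak_potential p k (s i) N c * peak k (s j) N c)) \<partial>lborel)"
          unfolding \<Psi>_def sum_distrib_right by (simp only: mult.assoc)
        also have "\<dots> = (\<Sum>i<m. \<integral>c. b i * (peak_potential p k (s i) N c * peak k (s j) N c) \<partial>lborel)"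
          using ppb by (intro Bochner_Integration.integral_sum integrable_mult_right
              integrable_mult_peak[OF s[OF j], where B = "2 powr p"]) auto
        finally show "(\<integral>c. \<Psi> c * peak k (s j) N c \<partial>lborel)
            = (\<Sum>i<m. b i * (\<integral>c. peak_potential p k (s i) N c * peak k (s j) N c \<partial>lborel))" by simp
      qed
      finally show ?thesis .
    qed
  qed
  define I where "I y = (\<integral>x. H x * dist (T x) (T y) powr p \<partial>?\<beta>)" for y
  have "?\<kappa> * (\<integral>y. H y * I y \<partial>?\<beta>) = (\<integral>y. ?\<kappa> * (H y * I y) \<partial>?\<beta>)"
    by (rule integral_mult_right_zero[symmetric])
  also have "\<dots> = (\<integral>y. H y * (?\<kappa> * I y) \<partial>?\<beta>)"
    by (simp only: mult.left_commute)
  also have "\<dots> = (\<integral>y. (\<integral>u. H y * G u y \<partial>?\<beta>) \<partial>?\<beta>)"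
    unfolding I_def G by simp
  also have "\<dots> = (\<integral>u. (\<integral>y. H y * G u y \<partial>?\<beta>) \<partial>?\<beta>)"
  proof (rule ball_measure_Fubini)
    have "(\<lambda>z. G (snd z) (fst z)) \<in> borel_measurable (borel \<Otimes>\<^sub>M borel)"
      unfolding G_def by measurable
    thus "(\<lambda>z. H (fst z) * G (snd z) (fst z)) \<in> borel_measurable (borel \<Otimes>\<^sub>M borel)"
      by measurable
    fix y u :: "real^'n" assume yu: "norm y \<le> 1" "norm u \<le> 1"
    have "\<bar>G u y\<bar> \<le> BH * (B + B) powr p * measure ?\<beta> UNIV"
      unfolding G_def
    proof (rule abs_integral_ball_measure_le)
      fix x :: "real^'n" assume x: "norm x \<le> 1"
      have "\<bar>H x * \<bar>u \<bullet> (T x - T y)\<bar> powr p\<bar> \<le> BH * (B + norm (T y)) powr p"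
        by (rule Hkb[OF x yu(2)])
      also have "\<dots> \<le> BH * (B + B) powr p"
        using Tb[OF yu(1)] BH0 B(1) p by (intro mult_left_mono powr_mono2) auto
      finally show "\<bar>H x * \<bar>u \<bullet> (T x - T y)\<bar> powr p\<bar> \<le> BH * (B + B) powr p" .
    qed measurable
    thus "\<bar>H y * G u y\<bar> \<le> BH * (BH * (B + B) powr p * measure ?\<beta> UNIV)"
      unfolding abs_mult using BH[OF yu(1)] BH0 by (intro mult_mono) auto
  qed
  also have "\<dots> = op_moment p T * ?J"
    unfolding Gu integral_mult_left_zero op_moment_def[symmetric] op_moment_adjoint[OF T p] ..
  finally have E: "(\<integral>y. H y * I y \<partial>?\<beta>) = ?J * (op_moment p T / ?\<kappa>)"
    using \<kappa> by (simp add: field_simps)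
  have "ereal (\<integral>y. H y * I y \<partial>?\<beta>) \<le> max_energy p (T ` cball 0 1)"
    unfolding I_def
  proof (rule energy_density_le_max_energy[OF finite_measure_ball_measure])
    show "T \<in> ?\<beta> \<rightarrow>\<^sub>M borel" by measurable
    show "compact (T ` cball 0 1)"
      using T by (intro compact_continuous_image linear_continuous_on) (auto simp: linear_conv_bounded_linear)
    show "AE x in ?\<beta>. T x \<in> T ` cball 0 1"
      using AE_ball_measure by eventually_elim auto
    show "integrable ?\<beta> H" by (rule integrable_ball_measure_bounded[OF Hm BH])
  qed (use mass p in auto)
  thus ?thesis unfolding E k_def .
qed

text \<open>With \<open>b\<close> and \<open>s\<close> fixed, N tends to infinity in
  \<open>peak_energy_le_max_energy\<close>. The limit \<open>L\<close> is the energy of the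
  symmetrised point masses, the mean of the double sums with |s i - s j|^p and |s i + s j|^p; the
  second sum dominates the first, which is the original energy.\<close>

lemma discrete_energy_interval_le_max_energy:
  fixes T :: "real^'n \<Rightarrow> real^'n" and s b :: "nat \<Rightarrow> real"
  assumes T: "linear T" and p: "0 < p" "p < 2"
    and s: "\<And>i. i < m \<Longrightarrow> s i \<in> {-1..1}" and b: "(\<Sum>i<m. b i) = 1"
  shows "ereal (discrete_energy p m b s * (op_moment p T / abs_moment TYPE('n) p)) \<le> max_energy p (T ` cball 0 1)"
proof -
  let ?A = "op_moment p T / abs_moment TYPE('n) p" and ?k = "DIM(real^'n) - 1"
  define L where "L = (\<Sum>j<m. b j * (\<Sum>i<m. b i * sym_kernel p (s j) (s i)))"
  have A: "0 \<le> ?A"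
    using abs_moment_pos[OF p(1), where 'n = 'n] op_moment_nonneg[of p T] by simp
  have "(\<lambda>N. peak_energy p ?k m b s N) \<longlonglongrightarrow> L"
    unfolding peak_energy_def L_def
    by (intro tendsto_sum tendsto_mult tendsto_const peak_energy_tendsto s p) auto
  hence "(\<lambda>N. ereal (peak_energy p ?k m b s N * ?A)) \<longlonglongrightarrow> ereal (L * ?A)"
    by (intro tendsto_ereal tendsto_mult tendsto_const)
  hence L_le: "ereal (L * ?A) \<le> max_energy p (T ` cball 0 1)"
    by (rule LIMSEQ_le_const2) (intro exI allI impI peak_energy_le_max_energy T p s b)
  have "discrete_energy p m b s \<le> L"
  proof -
    define D where "D j = (\<Sum>i<m. b i * \<bar>s i - s j\<bar> powr p)" for j
    define S where "S j = (\<Sum>i<m. b i * \<bar>s i + s j\<bar> powr p)" for j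
    have "b i * sym_kernel p (s j) (s i) = (b i * \<bar>s i - s j\<bar> powr p + b i * \<bar>s i + s j\<bar> powr p) / 2" for i j
      unfolding sym_kernel_def abs_minus_commute[of "s j"] add.commute[of "s j"]
      by (simp only: distrib_left times_divide_eq_right)
    hence "(\<Sum>i<m. b i * sym_kernel p (s j) (s i)) = (D j + S j) / 2" for j
      unfolding D_def S_def sum.distrib[symmetric] sum_divide_distrib by (intro sum.cong refl)
    hence "L = (\<Sum>j<m. b j * ((D j + S j) / 2))"
      unfolding L_def by (intro sum.cong refl) simp
    also have "\<dots> = ((\<Sum>j<m. b j * D j) + (\<Sum>j<m. b j * S j)) / 2"
      unfolding sum.distrib[symmetric] sum_divide_distrib
      by (intro sum.cong refl) (simp only: distrib_left times_divide_eq_right)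
    finally have L: "L = ((\<Sum>j<m. b j * D j) + (\<Sum>j<m. b j * S j)) / 2" .
    have le: "(\<Sum>j<m. b j * D j) \<le> (\<Sum>j<m. b j * S j)"
      unfolding D_def S_def by (rule sum_abs_diff_powr_le_sum_abs_add_powr[OF p])
    have E: "discrete_energy p m b s = (\<Sum>j<m. b j * D j)"
      unfolding discrete_energy_def D_def dist_real_def ..
    have "x \<le> (x + y) / 2" if "x \<le> y" for x y :: real
      using that by simp
    from this[OF le] show ?thesis unfolding L E .
  qed
  hence "discrete_energy p m b s * ?A \<le> L * ?A"
    by (rule mult_right_mono) (rule A)
  hence "ereal (discrete_energy p m b s * ?A) \<le> ereal (L * ?A)"
    by (simp only: ereal_less_eq)
  thus ?thesis using L_le by (rule order_trans)
qed

theorem theorem2p1: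
  fixes T :: "real ^ 'n \<Rightarrow> real ^ 'n" and p :: real
  assumes "linear T" and "0 < p" and "p < 2"
  shows "max_energy p (T ` cball 0 1) =
           max_energy p {-1..1::real} * ereal (summing_norm p T powr p)"
proof (rule antisym)
  note T = assms(1) and p = assms(2,3)
  let ?A = "op_moment p T / abs_moment TYPE('n) p" and ?K = "T ` cball 0 1"
  have K: "compact ?K"
    using T by (intro compact_continuous_image linear_continuous_on) (auto simp: linear_conv_bounded_linear)
  have A: "summing_norm p T powr p = ?A" by (rule summing_norm_powr[OF T p(1)])
  show "max_energy p ?K \<le> max_energy p {-1..1::real} * ereal (summing_norm p T powr p)"
    unfolding A by (rule max_energy_leI[OF K p(1)]) (rule discrete_energy_linear_image_le[OF T p(1)])
  have "0 \<le> ?A"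
    using abs_moment_pos[OF p(1), where 'n = 'n] op_moment_nonneg[of p T] by simp
  \<comment> \<open>For \<open>?A = 0\<close> the product is 0 even if the supremum is infinite, and
    the point mass at \<open>T 0\<close> has energy 0. For positive \<open>?A\<close> the factor can
    be divided out.\<close>
  then consider "?A = 0" | "0 < ?A" by linarith
  thus "max_energy p {-1..1::real} * ereal (summing_norm p T powr p) \<le> max_energy p ?K"
    unfolding A
  proof cases
    case 1
    have "ereal (discrete_energy p 1 (\<lambda>_. 1) (\<lambda>_. T 0)) \<le> max_energy p ?K"
      using p by (intro discrete_energy_le_max_energy[OF K]) auto
    thus "max_energy p {-1..1::real} * ereal ?A \<le> max_energy p ?K"
      unfolding 1 by (simp add: discrete_energy_def zero_ereal_def[symmetric])
  next
    case 2
    define r where "r = ?A"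
    have r: "0 < ereal r" "ereal r \<noteq> \<infinity>" using 2 by (simp_all add: r_def)
    \<comment> \<open>Dividing by the positive finite factor isolates the supremum, so that
      \<open>max_energy_leI\<close> reduces the claim to finite sums on the interval.\<close>
    have "max_energy p {-1..1::real} \<le> max_energy p ?K / ereal r"
    proof (rule max_energy_leI[OF _ p(1)])
      fix m :: nat and a x assume "\<And>i. i < m \<Longrightarrow> x i \<in> {-1..1::real}" "(\<Sum>i<m. a i) = (1 :: real)"
      hence "ereal (discrete_energy p m a x * r) \<le> max_energy p ?K"
        unfolding r_def by (rule discrete_energy_interval_le_max_energy[OF T p])
      hence "ereal r * ereal (discrete_energy p m a x) \<le> max_energy p ?K"
        by (simp only: times_ereal.simps mult.commute)
      thus "ereal (discrete_energy p m a x) \<le> max_energy p ?K / ereal r"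
        by (rule ereal_le_divide_pos[OF r, THEN iffD2])
    qed simp
    hence "ereal r * max_energy p {-1..1::real} \<le> max_energy p ?K"
      by (rule ereal_le_divide_pos[OF r, THEN iffD1])
    thus "max_energy p {-1..1::real} * ereal ?A \<le> max_energy p ?K"
      unfolding r_def by (simp only: mult.commute)
  qed
qed

end
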